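(* There exist universal constants $0 < c \leq c' < \infty$ such that for every integer $n \geq 1$ and all $1 \leq p < q \leq \infty$, $$ c\,\left(\frac{n}{(p\wedge n)\,\log\!\big(\mathrm{e}\,\tfrac{n}{q\wedge n}\big)}\right)^{\tau} \;\leq\; \mathsf{A}^\star_{p,q}(\sigma_{n-1}) \;\leq\; c'\,\left(\frac{n}{(p\wedge n)\,\log\!\big(\mathrm{e}\,\tfrac{n}{q\wedge n}\big)}\right)^{\tau}, \qquad \tau = \frac12\Big(1-\frac pq\Big). $$
   Context: $\mathcal{C}_n$ is the class of closed convex sets $C \subset \mathbb{R}^n$ containing the origin. For $C \in \mathcal{C}_n$, $\Pi_C(x) = \arg\min_{y\in C}\|x-y\|_2$ is the metric projection. $\sigma_{n-1}$ is the uniform probability measure on the unit sphere $\mathbf{S}^{n-1} \subset \mathbb{R}^n$ (for $n=1$, the uniform measure on $\{-1,1\}$). For a probability measure $\mu$ and a measurable vector-valued map $f$, $\|f\|_{L^p(\mu)} = (\mathbf{E}_{\xi\sim\mu}\|f(\xi)\|_2^p)^{1/p}$ for $1\leq p<\infty$, and $\|f\|_{L^\infty(\mu)}$ is the $\mu$-essential supremum of $\|f(\xi)\|_2$. The extremal constant is $$\mathsf{A}^\star_{p,q}(\mu) = \sup_{C\in\mathcal{C}_n,\,C\neq\{0\}} \frac{\|\Pi_C\|_{L^q(\mu)}}{\|\Pi_C\|_{L^p(\mu)}},$$ the supremum being restricted to those $C$ for which the denominator is positive. For $r\in[1,\infty)$, $r\wedge n = \min\{r,n\}$; for $r=\infty$,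 $r\wedge n = n$. For $p$ finite and $q=\infty$, $p/q=0$. $\log$ is the natural logarithm. *)

theory Defs
  imports "HOL-Probability.Probability"
begin

text \<open>
  The dimension \<open>n\<close> is quantified inside the statement, below the universal constants, so it
  cannot be a type. \<open>\<real>\<^sup>n\<close> is the carrier of \<^const>\<open>Euclidean_space\<close> \<open>n\<close>, i.e. the functions
  \<open>x :: nat \<Rightarrow> real\<close> with \<open>x i = 0\<close> for \<open>i \<ge> n\<close>.
\<close>

abbreviation enorm :: "nat \<Rightarrow> (nat \<Rightarrow> real) \<Rightarrow> real" where
  "enorm n x \<equiv> L2_set x {..<n}"

definition convex_class :: "nat \<Rightarrow> (nat \<Rightarrow> real) set set" where
  "convex_class n = {C. closedin (Euclidean_space n) C \<and>
     (\<forall>x\<in>C. \<forall>y\<in>C. \<forall>u v. 0 \<le> u \<longrightarrow> 0 \<le> v \<longrightarrow> u + v = 1 \<longrightarrow> (\<lambda>i. u * x i + v * y i) \<in> C) \<and>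
     (\<lambda>_. 0) \<in> C}"

text \<open>
  For \<open>C \<in> convex_class n\<close> the minimiser is unique, so the choice made by
  \<^const>\<open>arg_min_on\<close> is irrelevant.
\<close>
definition metric_proj :: "nat \<Rightarrow> (nat \<Rightarrow> real) set \<Rightarrow> (nat \<Rightarrow> real) \<Rightarrow> (nat \<Rightarrow> real)" where
  "metric_proj n C x = arg_min_on (\<lambda>y. enorm n (\<lambda>i. x i - y i)) C"

definition lebesgue_Rn :: "nat \<Rightarrow> (nat \<Rightarrow> real) measure" where
  "lebesgue_Rn n = distr (\<Pi>\<^sub>M i\<in>{..<n}. lborel) borel (\<lambda>x i. if i < n then x i else 0)"

text \<open>
  The uniform probability measure on the unit sphere of \<open>\<real>\<^sup>n\<close>, \<open>n \<ge> 1\<close>, as normalised cone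
  measure: the mass of \<open>A\<close> is the proportion of the unit ball covered by the cone
  \<open>{t a | a \<in> A, 0 < t \<le> 1}\<close>. It is a Borel measure on the ambient function type that gives full
  mass to the sphere; for \<open>n = 1\<close> it gives mass \<open>1/2\<close> to each of the two unit vectors.
\<close>
definition sphere_measure :: "nat \<Rightarrow> (nat \<Rightarrow> real) measure" where
  "sphere_measure n =
     distr (uniform_measure (lebesgue_Rn n) {x. enorm n x \<le> 1}) borel (\<lambda>x i. x i / enorm n x)"

text \<open>
  The first branch is the essential supremum. In the other branch, \<^const>\<open>nn_integral\<close> is used so that
  a divergent integral gives \<open>\<infinity>\<close>.
\<close>
definition Lp_norm :: "nat \<Rightarrow> (nat \<Rightarrow> real) measure \<Rightarrow> ereal \<Rightarrow>
    ((nat \<Rightarrow> real) \<Rightarrow> (nat \<Rightarrow> real)) \<Rightarrow> ereal" where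
  "Lp_norm n \<mu> p f =
     (if p = \<infinity> then esssup \<mu> (\<lambda>x. ereal (enorm n (f x)))
      else let I = (\<integral>\<^sup>+ x. ennreal (enorm n (f x) powr real_of_ereal p) \<partial>\<mu>)
           in if I = \<infinity> then \<infinity> else ereal (enn2real I powr (1 / real_of_ereal p)))"

definition A_star :: "nat \<Rightarrow> ereal \<Rightarrow> ereal \<Rightarrow> (nat \<Rightarrow> real) measure \<Rightarrow> ereal" where
  "A_star n p q \<mu> =
     (SUP C \<in> {C \<in> convex_class n. C \<noteq> {\<lambda>_. 0} \<and> 0 < Lp_norm n \<mu> p (metric_proj n C)}.
        Lp_norm n \<mu> q (metric_proj n C) / Lp_norm n \<mu> p (metric_proj n C))"

definition trunc :: "ereal \<Rightarrow> nat \<Rightarrow> real" where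
  "trunc r n = real_of_ereal (min r (ereal (real n)))"

text \<open>Division on \<^typ>\<open>ereal\<close> gives \<open>p / \<infinity> = 0\<close> for finite \<open>p\<close>.\<close>
definition tau :: "ereal \<Rightarrow> ereal \<Rightarrow> real" where
  "tau p q = (1 / 2) * (1 - real_of_ereal (p / q))"

definition rate :: "nat \<Rightarrow> ereal \<Rightarrow> ereal \<Rightarrow> real" where
  "rate n p q = (real n / (trunc p n * ln (exp 1 * (real n / trunc q n)))) powr tau p q"

end

theory Submission
  imports Defs
begin

text \<open>
  Write \<open>f x = \<parallel>\<Pi>\<^sub>C x\<parallel>\<close> and \<open>m\<close> for the \<open>L\<^sup>p\<close> norm of \<open>f\<close> on the sphere. If \<open>z \<in> C\<close>, \<open>A = \<parallel>z\<parallel> \<le> 1\<close> and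
  \<open>e = z/A\<close>, the obtuse angle property of the projection gives, for all unit vectors \<open>x\<close>, \<open>x'\<close>,
  \<open>f x' \<ge> A\<langle>x,e\<rangle> - f x (A + \<parallel>x - x'\<parallel>)\<close>.

  Upper bound. The choice \<open>x = x'\<close>, \<open>z = \<Pi>\<^sub>C x0\<close> and the lower tail of \<open>\<langle>x,e\<rangle>\<close> bound \<open>sup f\<close> by a multiple of
  \<open>m (n/(p\<and>n))\<^sup>1\<^sup>/\<^sup>2\<close>; as \<open>\<integral>f\<^sup>q \<le> (sup f)\<^sup>q\<^sup>-\<^sup>p \<integral>f\<^sup>p\<close>, this is the claim up to the logarithm
  \<open>L = ln (e n/q)\<close>. For \<open>q < n\<close> and \<open>L\<close> large there are two cases, separated by the threshold
  \<open>(pL/n)\<^sup>1\<^sup>/\<^sup>2 (q/n)\<^sup>1\<^sup>/\<^sup>4\<close>. If \<open>m\<close> is above it, Gaussian concentration of the 1-Lipschitz function \<open>f\<close> makes the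
  contribution of \<open>{f > R m}\<close>, \<open>R = (n/(pL))\<^sup>1\<^sup>/\<^sup>2\<close>, to \<open>\<integral>f\<^sup>q\<close> negligible. If \<open>m\<close> is below it, take \<open>x\<close> to be the
  normalisation of \<open>x' + s e\<close> with \<open>s\<close> of order \<open>(pL/n)\<^sup>1\<^sup>/\<^sup>2\<close>: the shift changes measures by a factor
  \<open>exp (pL/8)\<close> only, so by Markov's inequality \<open>f x\<close> is small for most \<open>x'\<close>, hence \<open>f x' \<ge> A s/4\<close> on a set of measure
  at least \<open>1/4\<close>, and \<open>sup f\<close> is at most a multiple of \<open>R m\<close>.

  Lower bound. For the convex hull of a ball of radius \<open>A\<theta>\<close> and a point at distance \<open>A\<close>, \<open>f\<close> is about \<open>A\<theta>\<close> on
  \<open>{\<langle>x,e\<rangle> \<le> \<theta>}\<close> and at least \<open>A/4\<close> on \<open>{\<langle>x,e\<rangle> \<ge> \<theta> + A}\<close>. For large \<open>q\<close>, \<open>A\<close> and \<open>\<theta>\<close> are explicit; for small \<open>q\<close>, \<open>\<theta>\<close>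
  is a quantile of \<open>\<langle>x,e\<rangle>\<close> and \<open>A\<close> is tiny.
\<close>

section \<open>Norms and Lebesgue measure on the carrier of \<open>\<real>\<^sup>n\<close>\<close>

text \<open>Cone measure lets estimates on the sphere be made in the unit ball, where translations
  and dilations of Lebesgue measure and the Prekopa--Leindler inequality apply. The obstacle is the
  logarithm: interpolation against the supremum bound alone loses a power of L when q is much
  smaller than n. The threshold says that R m is of order (q/n)^(1/4). Above it, n (R m)^2 is at
  least of order sqrt (q n), which dominates both q and p ln R, so the Gaussian tail beats the
  growth of f^q. Below it, a Markov level of order exp (L/8) m is needed to beat the factor exp (p
  L/8) of the shift, and (q/n)^(1/4) = exp ((1 - L)/4) is small enough to pay for that level; the
  exponent 1/4 is one choice between 1/8 and 1/2. In the lower bound for large q, the logarithm is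
  what keeps the spike from dominating the p-th moment: a cap at height of order (pL/n)^(1/2)
  carries a factor exp (- pL/2), whose p-th root exp (- L/2) is at most a multiple of A.\<close>

abbreviation ip :: "nat \<Rightarrow> (nat \<Rightarrow> real) \<Rightarrow> (nat \<Rightarrow> real) \<Rightarrow> real" where
  "ip n x y \<equiv> (\<Sum>i<n. x i * y i)"

abbreviation edist :: "nat \<Rightarrow> (nat \<Rightarrow> real) \<Rightarrow> (nat \<Rightarrow> real) \<Rightarrow> real" where
  "edist n x y \<equiv> enorm n (\<lambda>i. x i - y i)"

text \<open>The normalisation that defines \<open>sphere_measure\<close>. As x / 0 = 0, a vector of
  norm 0 is sent to 0, so the norm of a direction is at most 1 without exception.\<close>

definition dir :: "nat \<Rightarrow> (nat \<Rightarrow> real) \<Rightarrow> (nat \<Rightarrow> real)" where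
  "dir n x = (\<lambda>i. x i / enorm n x)"

lemma enorm_sq: "(enorm n x)\<^sup>2 = ip n x x"
  by (simp add: L2_set_def power2_eq_square sum_nonneg)

lemma enorm_nonneg: "0 \<le> enorm n x"
  by (rule L2_set_nonneg)

lemma ip_commute: "ip n x y = ip n y x"
  by (simp add: mult.commute)

lemma ip_le: "ip n x y \<le> enorm n x * enorm n y"
proof -
  have "ip n x y \<le> (\<Sum>i<n. \<bar>x i\<bar> * \<bar>y i\<bar>)"
    by (intro sum_mono) (metis abs_ge_self abs_mult)
  also have "\<dots> \<le> enorm n x * enorm n y" by (rule L2_set_mult_ineq)
  finally show ?thesis .
qed

lemma enorm_add_sq: "(enorm n (\<lambda>i. x i + y i))\<^sup>2 = (enorm n x)\<^sup>2 + 2 * ip n x y + (enorm n y)\<^sup>2"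
  unfolding enorm_sq by (simp add: algebra_simps sum.distrib sum_distrib_left)

lemma enorm_diff_sq: "(edist n x y)\<^sup>2 = (enorm n x)\<^sup>2 - 2 * ip n x y + (enorm n y)\<^sup>2"
  unfolding enorm_sq by (simp add: algebra_simps sum.distrib sum_distrib_left sum_subtractf)

lemma enorm_scale: "enorm n (\<lambda>i. c * x i) = \<bar>c\<bar> * enorm n x"
proof -
  have "enorm n (\<lambda>i. c * x i) = sqrt (c\<^sup>2 * (\<Sum>i<n. (x i)\<^sup>2))"
    by (simp add: L2_set_def power_mult_distrib sum_distrib_left)
  then show ?thesis by (simp add: L2_set_def real_sqrt_mult)
qed

lemma enorm_divide: "enorm n (\<lambda>i. x i / c) = enorm n x / \<bar>c\<bar>"
  using enorm_scale[of "inverse c" x n] by (simp add: field_simps)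

lemma enorm_uminus: "enorm n (\<lambda>i. - x i) = enorm n x"
  using enorm_scale[of "-1" x n] by simp

lemma enorm_minus_commute: "edist n x y = edist n y x"
  using enorm_uminus[of "\<lambda>i. x i - y i" n] by simp

lemma enorm_zero: "enorm n (\<lambda>i. 0) = 0"
  by (simp add: L2_set_def)

lemma enorm_cong: "(\<And>i. i < n \<Longrightarrow> x i = y i) \<Longrightarrow> enorm n x = enorm n y"
  by (auto intro!: L2_set_cong)

lemma enorm_eq_0: "enorm n x = 0 \<longleftrightarrow> (\<forall>i<n. x i = 0)"
  by (auto simp: L2_set_eq_0_iff)

lemma enorm_triangle_diff: "enorm n x \<le> enorm n y + edist n x y"
  using L2_set_triangle_ineq[of y "\<lambda>i. x i - y i" "{..<n}"] by simp

lemma abs_le_enorm: "i < n \<Longrightarrow> \<bar>x i\<bar> \<le> enorm n x"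
  using member_le_L2_set[of "{..<n}" i "\<lambda>i. \<bar>x i\<bar>"] by (simp add: L2_set_def)

lemma enorm_pos: "enorm n x \<noteq> 0 \<Longrightarrow> 0 < enorm n x"
  by (simp add: less_le)

lemma enorm_dir: "enorm n x \<noteq> 0 \<Longrightarrow> enorm n (dir n x) = 1"
  unfolding dir_def enorm_divide using enorm_nonneg[of x n] by simp

lemma enorm_dir_le: "enorm n (dir n x) \<le> 1"
  by (cases "enorm n x = 0") (simp_all add: enorm_dir, simp add: dir_def enorm_zero)

lemma dir_scale: "0 < c \<Longrightarrow> dir n (\<lambda>i. c * x i) = dir n x"
  by (simp add: dir_def enorm_scale)

lemma ip_dir: "ip n (dir n x) y = ip n x y / enorm n x"
  by (simp add: dir_def sum_divide_distrib)

lemma ip_add_left: "ip n (\<lambda>i. x i + y i) z = ip n x z + ip n y z"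
  by (simp add: algebra_simps sum.distrib)

lemma ip_diff_left: "ip n (\<lambda>i. x i - y i) z = ip n x z - ip n y z"
  by (simp add: algebra_simps sum_subtractf)

lemma ip_scale_left: "ip n (\<lambda>i. c * x i) z = c * ip n x z"
  by (simp add: algebra_simps sum_distrib_left)

text \<open>Split the difference as (x - y)/|x| plus ((|y| - |x|)/|x|) \<open>dir n y\<close>. Each
  term is at most |x - y|/|x|, and |x| is at least 1/2.\<close>

lemma dir_dist:
  assumes "1/2 \<le> enorm n x" "1/2 \<le> enorm n y"
  shows "edist n (dir n x) (dir n y) \<le> 4 * edist n x y"
proof -
  let ?a = "enorm n x" and ?b = "enorm n y" and ?d = "edist n x y"
  have ab: "?a > 0" "?b > 0" using assms by auto
  have "(\<lambda>i. dir n x i - dir n y i) = (\<lambda>i. (x i - y i) / ?a + (?b - ?a) / ?a * dir n y i)"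
    using ab by (auto simp: dir_def field_simps)
  then have "edist n (dir n x) (dir n y) \<le> ?d / \<bar>?a\<bar> + \<bar>(?b - ?a) / ?a\<bar> * enorm n (dir n y)"
    using L2_set_triangle_ineq[of "\<lambda>i. (x i - y i) / ?a" "\<lambda>i. (?b - ?a) / ?a * dir n y i" "{..<n}"]
    by (simp only: enorm_divide enorm_scale)
  also have "\<dots> = ?d / ?a + \<bar>?b - ?a\<bar> / ?a" using ab by (simp add: enorm_dir)
  also have "\<dots> \<le> ?d / ?a + ?d / ?a"
    using enorm_triangle_diff[of x n y] enorm_triangle_diff[of y n x] enorm_minus_commute[of x y n] ab
    by (intro add_left_mono divide_right_mono) auto
  also have "\<dots> = ?d * (2 / ?a)" by simp
  also have "\<dots> \<le> ?d * 4"
    using assms ab by (intro mult_left_mono enorm_nonneg) (auto simp: field_simps)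
  finally show ?thesis by simp
qed

section \<open>Measurability, and Lebesgue measure under affine maps\<close>

lemma borel_measurable_coord [measurable]: "(\<lambda>x::nat \<Rightarrow> real. x i) \<in> borel_measurable borel"
  by (intro borel_measurable_continuous_onI continuous_on_product_coordinates)

lemma borel_measurable_funI:
  assumes "\<And>i. (\<lambda>x. f x i) \<in> borel_measurable M"
  shows "f \<in> measurable M (borel :: (nat \<Rightarrow> real) measure)"
  using assms by (rule measurable_coordinatewise_then_product)

lemma borel_measurable_enorm [measurable]:
  assumes "\<And>i. (\<lambda>x. f x i) \<in> borel_measurable M"
  shows "(\<lambda>x. enorm n (f x)) \<in> borel_measurable M"
  unfolding L2_set_def using assms by measurable

lemma borel_measurable_dir [measurable]: "dir n \<in> borel \<rightarrow>\<^sub>M borel"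
  unfolding dir_def by (intro borel_measurable_funI) measurable

text \<open>Points of the product measure space are extensional, hence \<open>undefined\<close> from
  n on; this is the zero padding that \<open>lebesgue_Rn\<close> applies to them.\<close>

abbreviation ext0 :: "nat \<Rightarrow> (nat \<Rightarrow> real) \<Rightarrow> (nat \<Rightarrow> real)" where
  "ext0 n x \<equiv> (\<lambda>i. if i < n then x i else 0)"

interpretation lborel_product: product_sigma_finite "\<lambda>_::nat. lborel :: real measure"
  by standard

lemma ext0_measurable: "ext0 n \<in> (\<Pi>\<^sub>M i\<in>{..<n}. lborel) \<rightarrow>\<^sub>M borel"
proof (rule borel_measurable_funI)
  fix i show "(\<lambda>x. ext0 n x i) \<in> borel_measurable (\<Pi>\<^sub>M i\<in>{..<n}. lborel)"
    by (cases "i < n") (auto intro: measurable_component_singleton[of i "{..<n}" "\<lambda>_. lborel", simplified])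
qed

lemma sets_lebesgue_Rn [measurable_cong, simp]: "sets (lebesgue_Rn n) = sets borel"
  by (simp add: lebesgue_Rn_def)

lemma space_lebesgue_Rn [simp]: "space (lebesgue_Rn n) = UNIV"
  by (simp add: lebesgue_Rn_def)

lemma nn_integral_lebesgue_Rn:
  assumes [measurable]: "f \<in> borel_measurable borel"
  shows "integral\<^sup>N (lebesgue_Rn n) f = (\<integral>\<^sup>+x. f (ext0 n x) \<partial>(\<Pi>\<^sub>M i\<in>{..<n}. lborel))"
  unfolding lebesgue_Rn_def by (intro nn_integral_distr ext0_measurable) simp

text \<open>A product measure is determined by its values on boxes, and the map acts coordinatewise,
  so the one-dimensional substitution rule contributes one factor |c| per coordinate.\<close>

lemma PiM_lborel_affine:
  fixes c :: real and v :: "nat \<Rightarrow> real"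
  assumes c: "c \<noteq> 0" and I: "finite I"
  shows "density (distr (\<Pi>\<^sub>M i\<in>I. lborel) (\<Pi>\<^sub>M i\<in>I. lborel) (\<lambda>x. \<lambda>i\<in>I. v i + c * x i))
     (\<lambda>_. ennreal (\<bar>c\<bar> ^ card I)) = (\<Pi>\<^sub>M i\<in>I. lborel)"
proof (rule lborel_product.PiM_eqI)
  let ?P = "\<Pi>\<^sub>M i\<in>I. (lborel :: real measure)"
  let ?T = "\<lambda>x. \<lambda>i\<in>I. v i + c * x i"
  show "finite I" by fact
  show "sets (density (distr ?P ?P ?T) (\<lambda>_. ennreal (\<bar>c\<bar> ^ card I))) = sets ?P" by simp
  have T[measurable]: "?T \<in> ?P \<rightarrow>\<^sub>M ?P" by measurable
  fix A :: "nat \<Rightarrow> real set" assume A: "\<And>i. i \<in> I \<Longrightarrow> A i \<in> sets lborel"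
  have AP: "Pi\<^sub>E I A \<in> sets ?P" using A by (intro sets_PiM_I_finite I)
  have vim: "?T -` Pi\<^sub>E I A \<inter> space ?P = Pi\<^sub>E I (\<lambda>i. (\<lambda>u. v i + c * u) -` A i)"
    by (rule set_eqI) (simp add: space_PiM PiE_iff)
  have one: "ennreal \<bar>c\<bar> * emeasure lborel ((\<lambda>u. v i + c * u) -` A i) = emeasure lborel (A i)" if "i \<in> I" for i
  proof -
    have [measurable]: "A i \<in> sets borel" using A[OF that] by simp
    have "emeasure lborel (A i) = (\<integral>\<^sup>+u. indicator (A i) u \<partial>lborel)" by simp
    also have "\<dots> = ennreal \<bar>c\<bar> * (\<integral>\<^sup>+u. indicator (A i) (v i + c * u) \<partial>lborel)"
      by (intro nn_integral_real_affine c) measurable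
    also have "(\<integral>\<^sup>+u. indicator (A i) (v i + c * u) \<partial>lborel) = (\<integral>\<^sup>+u. indicator ((\<lambda>u. v i + c * u) -` A i) u \<partial>lborel)"
      by (intro nn_integral_cong) (simp add: indicator_def)
    also have "\<dots> = emeasure lborel ((\<lambda>u. v i + c * u) -` A i)"
      using measurable_sets[of "\<lambda>u. v i + c * u" borel borel "A i"] by (intro nn_integral_indicator) simp
    finally show ?thesis by simp
  qed
  have "emeasure (density (distr ?P ?P ?T) (\<lambda>_. ennreal (\<bar>c\<bar> ^ card I))) (Pi\<^sub>E I A)
     = ennreal (\<bar>c\<bar> ^ card I) * emeasure ?P (Pi\<^sub>E I (\<lambda>i. (\<lambda>u. v i + c * u) -` A i))"
    using AP by (simp add: emeasure_density_const emeasure_distr vim)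
  also have "emeasure ?P (Pi\<^sub>E I (\<lambda>i. (\<lambda>u. v i + c * u) -` A i)) = (\<Prod>i\<in>I. emeasure lborel ((\<lambda>u. v i + c * u) -` A i))"
  proof (rule lborel_product.emeasure_PiM[OF I])
    fix i assume "i \<in> I" then have [measurable]: "A i \<in> sets borel" using A by simp
    show "(\<lambda>u. v i + c * u) -` A i \<in> sets lborel"
      using measurable_sets[of "\<lambda>u. v i + c * u" borel borel "A i"] by simp
  qed
  also have "ennreal (\<bar>c\<bar> ^ card I) * \<dots> = (\<Prod>i\<in>I. ennreal \<bar>c\<bar> * emeasure lborel ((\<lambda>u. v i + c * u) -` A i))"
    by (simp add: prod.distrib ennreal_power)
  also have "\<dots> = (\<Prod>i\<in>I. emeasure lborel (A i))" by (intro prod.cong one refl)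
  finally show "emeasure (density (distr ?P ?P ?T) (\<lambda>_. ennreal (\<bar>c\<bar> ^ card I))) (Pi\<^sub>E I A) = (\<Prod>i\<in>I. emeasure lborel (A i))" .
qed

text \<open>The measure lives on the zero-padded functions; requiring v to vanish from n on keeps
  the image of the affine map there.\<close>

lemma nn_integral_lebesgue_Rn_affine:
  assumes [measurable]: "f \<in> borel_measurable borel" and c: "c \<noteq> 0" and v: "\<And>i. i \<ge> n \<Longrightarrow> v i = 0"
  shows "integral\<^sup>N (lebesgue_Rn n) f = ennreal (\<bar>c\<bar> ^ n) * (\<integral>\<^sup>+x. f (\<lambda>i. v i + c * x i) \<partial>lebesgue_Rn n)"
proof -
  let ?P = "\<Pi>\<^sub>M i\<in>{..<n}. (lborel :: real measure)"
  let ?T = "\<lambda>x. \<lambda>i\<in>{..<n}. v i + c * x i"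
  note [measurable] = ext0_measurable
  have T[measurable]: "?T \<in> ?P \<rightarrow>\<^sub>M ?P" by measurable
  have [measurable]: "(\<lambda>x. (\<lambda>i. v i + c * x i)) \<in> borel \<rightarrow>\<^sub>M (borel :: (nat \<Rightarrow> real) measure)"
    by (intro borel_measurable_funI) measurable
  have "integral\<^sup>N (lebesgue_Rn n) f = (\<integral>\<^sup>+x. f (ext0 n x) \<partial>density (distr ?P ?P ?T) (\<lambda>_. ennreal (\<bar>c\<bar> ^ card {..<n})))"
    by (subst PiM_lborel_affine[OF c]) (simp_all add: nn_integral_lebesgue_Rn)
  also have "\<dots> = ennreal (\<bar>c\<bar> ^ n) * (\<integral>\<^sup>+x. f (ext0 n (?T x)) \<partial>?P)"
    by (subst nn_integral_density) (auto simp: nn_integral_cmult nn_integral_distr)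
  also have "(\<integral>\<^sup>+x. f (ext0 n (?T x)) \<partial>?P) = (\<integral>\<^sup>+x. f (\<lambda>i. v i + c * ext0 n x i) \<partial>?P)"
    by (intro nn_integral_cong arg_cong[where f=f]) (auto simp: v)
  also have "\<dots> = (\<integral>\<^sup>+x. f (\<lambda>i. v i + c * x i) \<partial>lebesgue_Rn n)"
    by (subst nn_integral_lebesgue_Rn) simp_all
  finally show ?thesis .
qed

lemma emeasure_lebesgue_Rn_affine:
  assumes [measurable]: "E \<in> sets borel" and c: "c \<noteq> 0" and v: "\<And>i. i \<ge> n \<Longrightarrow> v i = 0"
  shows "emeasure (lebesgue_Rn n) E = ennreal (\<bar>c\<bar> ^ n) * emeasure (lebesgue_Rn n) {x. (\<lambda>i. v i + c * x i) \<in> E}"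
proof -
  have [measurable]: "(\<lambda>x. (\<lambda>i. v i + c * x i)) \<in> borel \<rightarrow>\<^sub>M (borel :: (nat \<Rightarrow> real) measure)"
    by (intro borel_measurable_funI) measurable
  have [measurable]: "{x. (\<lambda>i. v i + c * x i) \<in> E} \<in> sets borel"
    using measurable_sets[OF \<open>(\<lambda>x. (\<lambda>i. v i + c * x i)) \<in> borel \<rightarrow>\<^sub>M (borel :: (nat \<Rightarrow> real) measure)\<close> assms(1)]
    by (simp add: vimage_def)
  have "(\<integral>\<^sup>+x. indicator E (\<lambda>i. v i + c * x i) \<partial>lebesgue_Rn n) = (\<integral>\<^sup>+x. indicator {x. (\<lambda>i. v i + c * x i) \<in> E} x \<partial>lebesgue_Rn n)"
    by (intro nn_integral_cong) (simp add: indicator_def)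
  then show ?thesis
    using nn_integral_lebesgue_Rn_affine[of "indicator E" c n v] c v by simp
qed

lemma AE_lebesgue_Rn_ext0: "AE x in lebesgue_Rn n. \<forall>i\<ge>n. x i = 0"
  unfolding lebesgue_Rn_def
  by (subst AE_distr_iff[OF ext0_measurable]) (auto, measurable)

section \<open>Volume of the unit ball and scaling of cones\<close>

abbreviation unit_ball :: "nat \<Rightarrow> (nat \<Rightarrow> real) set" where
  "unit_ball n \<equiv> {x. enorm n x \<le> 1}"

lemma box_borel: "{x :: nat \<Rightarrow> real. \<forall>i<n. x i \<in> {a..b}} \<in> sets borel"
proof -
  have "{x :: nat \<Rightarrow> real. \<forall>i<n. x i \<in> {a..b}} = (\<Inter>i\<in>{..<n}. {x. a \<le> x i \<and> x i \<le> b})" by auto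
  also have "closed \<dots>"
    by (intro closed_INT ballI closed_Collect_conj closed_Collect_le continuous_on_const continuous_on_product_coordinates)
  finally show ?thesis by (rule borel_closed)
qed

lemma emeasure_box:
  assumes "a \<le> b"
  shows "emeasure (lebesgue_Rn n) {x. \<forall>i<n. x i \<in> {a..b}} = ennreal ((b - a) ^ n)"
proof -
  let ?P = "\<Pi>\<^sub>M i\<in>{..<n}. (lborel :: real measure)"
  have "ext0 n -` {x. \<forall>i<n. x i \<in> {a..b}} \<inter> space ?P = Pi\<^sub>E {..<n} (\<lambda>_. {a..b})"
    by (rule set_eqI) (simp add: space_PiM PiE_iff Ball_def conj_commute)
  then have "emeasure (lebesgue_Rn n) {x. \<forall>i<n. x i \<in> {a..b}} = emeasure ?P (Pi\<^sub>E {..<n} (\<lambda>_. {a..b}))"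
    unfolding lebesgue_Rn_def by (simp only: emeasure_distr[OF ext0_measurable box_borel])
  also have "\<dots> = (\<Prod>i<n. emeasure lborel {a..b})" by (rule lborel_product.emeasure_PiM) simp_all
  also have "\<dots> = ennreal ((b - a) ^ n)" using assms by (simp add: ennreal_power)
  finally show ?thesis .
qed

lemma unit_ball_borel [measurable]: "unit_ball n \<in> sets borel" by measurable

text \<open>Dilation preserves directions, so truncated cones scale like balls; Y =
  \<open>UNIV\<close> gives the balls themselves.\<close>

lemma emeasure_cball_lebesgue_Rn:
  assumes "0 < r" and [measurable]: "Y \<in> sets borel"
  shows "emeasure (lebesgue_Rn n) {x. enorm n x \<le> r \<and> dir n x \<in> Y} = ennreal (r ^ n) * emeasure (lebesgue_Rn n) {x. enorm n x \<le> 1 \<and> dir n x \<in> Y}"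
proof -
  have [measurable]: "{x. enorm n x \<le> r \<and> dir n x \<in> Y} \<in> sets borel" by measurable
  have "(enorm n (\<lambda>i. r * x i) \<le> r) = (enorm n x \<le> 1)" for x
    using assms by (simp add: enorm_scale)
  then show ?thesis
    using emeasure_lebesgue_Rn_affine[of "{x. enorm n x \<le> r \<and> dir n x \<in> Y}" r n "\<lambda>_. 0"] assms
    by (simp add: dir_scale)
qed

lemma emeasure_unit_ball_finite: "emeasure (lebesgue_Rn n) (unit_ball n) < \<infinity>"
proof -
  have "emeasure (lebesgue_Rn n) (unit_ball n) \<le> emeasure (lebesgue_Rn n) {x. \<forall>i<n. x i \<in> {-1..1}}"
  proof (intro emeasure_mono subsetI CollectI allI impI)
    fix x i assume "x \<in> unit_ball n" "i < n"
    then show "x i \<in> {-1..1}" using abs_le_enorm[of i n x] by auto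
  next
    show "{x. \<forall>i<n. x i \<in> {-1..1}} \<in> sets (lebesgue_Rn n)" using box_borel by simp
  qed
  then show ?thesis by (subst (asm) emeasure_box) (auto intro: le_less_trans)
qed

text \<open>If the unit ball were null, every ball would be null by scaling, but a ball of radius n
  + 1 contains the unit cube.\<close>

lemma emeasure_unit_ball_pos: "0 < emeasure (lebesgue_Rn n) (unit_ball n)"
proof (rule ccontr)
  assume "\<not> ?thesis"
  then have 0: "emeasure (lebesgue_Rn n) (unit_ball n) = 0" by simp
  have "1 = emeasure (lebesgue_Rn n) {x. \<forall>i<n. x i \<in> {0..1}}" by (subst emeasure_box) auto
  also have "\<dots> \<le> emeasure (lebesgue_Rn n) {x. enorm n x \<le> real (Suc n) \<and> dir n x \<in> UNIV}"
  proof (intro emeasure_mono subsetI)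
    fix x :: "nat \<Rightarrow> real" assume "x \<in> {x. \<forall>i<n. x i \<in> {0..1}}"
    then have "enorm n x \<le> (\<Sum>i<n. \<bar>x i\<bar>)" "(\<Sum>i<n. \<bar>x i\<bar>) \<le> (\<Sum>i<n. 1)"
      by (intro L2_set_le_sum_abs, intro sum_mono, auto)
    then show "x \<in> {x. enorm n x \<le> real (Suc n) \<and> dir n x \<in> UNIV}" by simp
  qed simp
  also have "\<dots> = 0" by (subst emeasure_cball_lebesgue_Rn) (auto simp: 0)
  finally show False by simp
qed

section \<open>The Prekopa--Leindler inequality\<close>

text \<open>With a = max A and b = min B, the sets (A + b)/2 and (a + B)/2 both lie in S and meet at
  most in (a + b)/2, so their measures add up.\<close>

lemma brunn_minkowski_compact:
  fixes A B S :: "real set"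
  assumes A: "compact A" "A \<noteq> {}" and B: "compact B" "B \<noteq> {}" and S: "S \<in> sets borel"
    and mid: "\<And>x y. x \<in> A \<Longrightarrow> y \<in> B \<Longrightarrow> (x + y) / 2 \<in> S"
  shows "emeasure lborel A + emeasure lborel B \<le> 2 * emeasure lborel S"
proof -
  obtain a where a: "a \<in> A" "\<And>x. x \<in> A \<Longrightarrow> x \<le> a" using compact_attains_sup[OF A] by auto
  obtain b where b: "b \<in> B" "\<And>x. x \<in> B \<Longrightarrow> b \<le> x" using compact_attains_inf[OF B] by auto
  define A' where "A' = (\<lambda>u. - b + 2 * u) -` A"
  define B' where "B' = (\<lambda>u. - a + 2 * u) -` B"
  have half: "emeasure lborel X = 2 * emeasure lborel ((\<lambda>u. t + 2 * u) -` X)" "(\<lambda>u. t + 2 * u) -` X \<in> sets borel"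
    if X[measurable]: "X \<in> sets borel" for X and t :: real
  proof -
    show *: "(\<lambda>u. t + 2 * u) -` X \<in> sets borel"
      using measurable_sets[of "\<lambda>u. t + 2 * u" borel borel X] by simp
    have "emeasure lborel X = (\<integral>\<^sup>+u. indicator X u \<partial>lborel)" by simp
    also have "\<dots> = ennreal \<bar>2\<bar> * (\<integral>\<^sup>+u. indicator X (t + 2 * u) \<partial>lborel)"
      by (intro nn_integral_real_affine) auto
    also have "(\<integral>\<^sup>+u. indicator X (t + 2 * u) \<partial>lborel) = (\<integral>\<^sup>+u. indicator ((\<lambda>u. t + 2 * u) -` X) u \<partial>lborel)"
      by (intro nn_integral_cong) (simp add: indicator_def)
    finally show "emeasure lborel X = 2 * emeasure lborel ((\<lambda>u. t + 2 * u) -` X)" using * by simp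
  qed
  have AB: "A \<in> sets borel" "B \<in> sets borel" using A B by (auto intro: borel_compact)
  have m: "A' \<in> sets borel" "B' \<in> sets borel" unfolding A'_def B'_def using AB by (auto intro!: half(2) simp del: add_uminus_conv_diff uminus_add_conv_diff)
  have "A' \<inter> B' \<subseteq> {(a + b) / 2}"
  proof
    fix u assume "u \<in> A' \<inter> B'"
    then have "- b + 2 * u \<le> a" "b \<le> - a + 2 * u" using a b by (auto simp: A'_def B'_def)
    then show "u \<in> {(a + b) / 2}" by (simp add: field_simps)
  qed
  then have "emeasure lborel (A' \<inter> B') \<le> emeasure lborel {(a + b) / 2}" by (intro emeasure_mono) auto
  then have 0: "emeasure lborel (A' \<inter> B') = 0" by simp
  have sub: "A' \<union> B' \<subseteq> S"
  proof
    fix u assume "u \<in> A' \<union> B'"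
    then consider "- b + 2 * u \<in> A" | "- a + 2 * u \<in> B" by (auto simp: A'_def B'_def)
    then show "u \<in> S"
    proof cases
      case 1 then show ?thesis using mid[of "- b + 2 * u" b] b by simp
    next
      case 2 then show ?thesis using mid[of a "- a + 2 * u"] a by simp
    qed
  qed
  have "emeasure lborel A + emeasure lborel B = 2 * (emeasure lborel A' + emeasure lborel B')"
    using half(1)[of A "-b"] half(1)[of B "-a"] AB by (simp add: A'_def B'_def distrib_left)
  also have "emeasure lborel A' + emeasure lborel B' = emeasure lborel (A' \<union> B')"
    using emeasure_Un_Int[of A' lborel B'] m 0 by simp
  also have "2 * \<dots> \<le> 2 * emeasure lborel S"
    using sub S by (intro mult_left_mono emeasure_mono) auto
  finally show ?thesis .
qed

text \<open>Compact sets approximate from inside for finite measures, hence the restriction to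
  [-k, k] before the limit. A Borel superset S stands for the set of midpoints, which need not be
  Borel itself.\<close>

lemma brunn_minkowski_real:
  fixes A B S :: "real set"
  assumes A: "A \<in> sets borel" "A \<noteq> {}" and B: "B \<in> sets borel" "B \<noteq> {}" and S: "S \<in> sets borel"
    and mid: "\<And>x y. x \<in> A \<Longrightarrow> y \<in> B \<Longrightarrow> (x + y) / 2 \<in> S"
  shows "emeasure lborel A + emeasure lborel B \<le> 2 * emeasure lborel S"
proof -
  define M where "M k = density lborel (indicator {- real k..real k})" for k
  have Ms: "sets (M k) = sets borel" for k by (simp add: M_def)
  have Me: "emeasure (M k) X = emeasure lborel (X \<inter> {- real k..real k})" if [measurable]: "X \<in> sets borel" for k X
  proof -
    have "emeasure (M k) X = (\<integral>\<^sup>+x. indicator {- real k..real k} x * indicator X x \<partial>lborel)"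
      unfolding M_def by (rule emeasure_density) auto
    also have "\<dots> = (\<integral>\<^sup>+x. indicator (X \<inter> {- real k..real k}) x \<partial>lborel)"
      by (intro nn_integral_cong) (simp add: indicator_inter_arith mult.commute)
    finally show ?thesis by simp
  qed
  have Mfin: "emeasure (M k) (space (M k)) \<noteq> \<infinity>" for k
    using Me[of UNIV k] by (simp add: M_def)
  have reg: "emeasure (M k) X = (SUP K \<in> {K. K \<subseteq> X \<and> compact K}. emeasure (M k) K)" if "X \<in> sets borel" for k X
    using inner_regular[OF Ms Mfin, of X] that by simp
  have le: "emeasure (M k) K + emeasure (M k) L \<le> 2 * emeasure lborel S"
    if K: "K \<subseteq> A" "compact K" and L: "L \<subseteq> B" "compact L" for k K L
  proof -
    obtain a b where ab: "a \<in> A" "b \<in> B" using A B by auto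
    \<comment> \<open>The approximating compact sets may be empty; an added point makes the compact
      case applicable.\<close>
    have c: "compact (insert a K)" "compact (insert b L)" using K L by auto
    have "emeasure (M k) K \<le> emeasure lborel (insert a K)" 
      using K c by (subst Me) (auto intro!: emeasure_mono borel_compact)
    moreover have "emeasure (M k) L \<le> emeasure lborel (insert b L)"
      using L c by (subst Me) (auto intro!: emeasure_mono borel_compact)
    moreover have "emeasure lborel (insert a K) + emeasure lborel (insert b L) \<le> 2 * emeasure lborel S"
      using K L ab by (intro brunn_minkowski_compact c S mid) auto
    ultimately show ?thesis by (meson add_mono order_trans)
  qed
  have le2: "emeasure (M k) A + emeasure (M k) B \<le> 2 * emeasure lborel S" for k
  proof -
    have "emeasure (M k) K + emeasure (M k) B \<le> 2 * emeasure lborel S" if K: "K \<subseteq> A" "compact K" for K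
    proof -
      have "emeasure (M k) B + emeasure (M k) K = (SUP L \<in> {K. K \<subseteq> B \<and> compact K}. emeasure (M k) L + emeasure (M k) K)"
        unfolding reg[OF B(1)] by (subst ennreal_SUP_add_left) auto
      also have "\<dots> \<le> 2 * emeasure lborel S" using le[OF K] by (intro SUP_least) (auto simp: add.commute)
      finally show ?thesis by (simp add: add.commute)
    qed
    then have "(SUP L \<in> {K. K \<subseteq> A \<and> compact K}. emeasure (M k) L + emeasure (M k) B) \<le> 2 * emeasure lborel S"
      by (intro SUP_least) auto
    moreover have "(SUP L \<in> {K. K \<subseteq> A \<and> compact K}. emeasure (M k) L + emeasure (M k) B) = emeasure (M k) A + emeasure (M k) B"
      unfolding reg[OF A(1)] by (subst ennreal_SUP_add_left) auto
    ultimately show ?thesis by simp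
  qed
  have lim: "(\<lambda>k. emeasure (M k) X) \<longlonglongrightarrow> emeasure lborel X" if "X \<in> sets borel" for X
  proof -
    have "(\<lambda>k. emeasure lborel (X \<inter> {- real k..real k})) \<longlonglongrightarrow> emeasure lborel (\<Union>k. X \<inter> {- real k..real k})"
      using that by (intro Lim_emeasure_incseq) (auto simp: incseq_def)
    moreover have "(\<Union>k. X \<inter> {- real k..real k}) = X"
    proof -
      have "\<exists>k. x \<in> {- real k..real k}" for x
        using real_arch_simple[of "\<bar>x\<bar>"] by (metis abs_le_iff atLeastAtMost_iff minus_le_iff)
      then show ?thesis by auto
    qed
    ultimately show ?thesis using that by (simp add: Me)
  qed
  show ?thesis
    by (rule LIMSEQ_le_const2[OF tendsto_add[OF lim[OF A(1)] lim[OF B(1)]]]) (auto intro: le2)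
qed

text \<open>Levels are measured relative to the upper bound a, so that two functions with different
  suprema can be compared at the same t in (0, 1).\<close>

lemma layer_cake:
  fixes f :: "real \<Rightarrow> real"
  assumes [measurable]: "f \<in> borel_measurable borel" and a: "0 < a" and f: "\<And>x. 0 \<le> f x" "\<And>x. f x \<le> a"
  shows "(\<integral>\<^sup>+x. ennreal (f x) \<partial>lborel) = ennreal a * (\<integral>\<^sup>+t. indicator {0<..<1} t * emeasure lborel {x. t * a < f x} \<partial>lborel)"
proof -
  let ?g = "\<lambda>t x. indicator {0<..<1} t * indicator {t. t * a < f x} t :: ennreal"
  have pt: "ennreal (f x) = ennreal a * (\<integral>\<^sup>+t. ?g t x \<partial>lborel)" for x
  proof -
    have lt1: "t < 1" if "t * a < f x" for t
    proof -
      have "t * a < 1 * a" using that f(2)[of x] by simp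
      then show ?thesis using a by (simp only: mult_less_cancel_right_pos)
    qed
    have "(\<integral>\<^sup>+t. ?g t x \<partial>lborel) = (\<integral>\<^sup>+t. indicator {0<..<f x / a} t \<partial>lborel)"
      using a lt1 by (intro nn_integral_cong) (auto simp: indicator_def pos_less_divide_eq)
    also have "\<dots> = ennreal (f x / a)" using a f[of x] by simp
    finally show ?thesis using a f[of x] by (simp add: ennreal_mult[symmetric])
  qed
  have "(\<integral>\<^sup>+x. ennreal (f x) \<partial>lborel) = ennreal a * (\<integral>\<^sup>+x. \<integral>\<^sup>+t. ?g t x \<partial>lborel \<partial>lborel)"
    by (subst pt, subst nn_integral_cmult) auto
  also have "(\<integral>\<^sup>+x. \<integral>\<^sup>+t. ?g t x \<partial>lborel \<partial>lborel)
     = (\<integral>\<^sup>+t. \<integral>\<^sup>+x. ?g t x \<partial>lborel \<partial>lborel)"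
    by (rule lborel_pair.Fubini') measurable
  also have "\<dots> = (\<integral>\<^sup>+t. indicator {0<..<1} t * emeasure lborel {x. t * a < f x} \<partial>lborel)"
  proof (intro nn_integral_cong)
    fix t :: real
    have "(\<integral>\<^sup>+x. ?g t x \<partial>lborel) = indicator {0<..<1} t * (\<integral>\<^sup>+x. indicator {x. t * a < f x} x \<partial>lborel)"
      by (subst nn_integral_cmult[symmetric]) (auto intro!: nn_integral_cong simp: indicator_def)
    then show "(\<integral>\<^sup>+x. ?g t x \<partial>lborel) = indicator {0<..<1} t * emeasure lborel {x. t * a < f x}"
      by simp
  qed
  finally show ?thesis .
qed

text \<open>At a relative level t < 1 the superlevel sets of f and g are nonempty, as
  one-dimensional Brunn--Minkowski requires, and their midpoints lie in {H > t s}, where s is the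
  geometric mean of the suprema. Integrating over t bounds the sum of the normalised integrals X and
  Y, and 4 X Y \<le> (X + Y)^2 turns the sum into the product.\<close>

lemma prekopa_leindler_bounded:
  fixes f g :: "real \<Rightarrow> real" and H :: "real \<Rightarrow> ennreal"
  assumes [measurable]: "f \<in> borel_measurable borel" "g \<in> borel_measurable borel" "H \<in> borel_measurable borel"
    and f: "\<And>x. 0 \<le> f x" "\<And>x. f x \<le> K" and g: "\<And>x. 0 \<le> g x" "\<And>x. g x \<le> K"
    and fin: "(\<integral>\<^sup>+x. ennreal (f x) \<partial>lborel) < \<infinity>" "(\<integral>\<^sup>+x. ennreal (g x) \<partial>lborel) < \<infinity>"
    and H: "\<And>x y. ennreal (f x) * ennreal (g y) \<le> (H ((x + y) / 2))\<^sup>2"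
  shows "(\<integral>\<^sup>+x. ennreal (f x) \<partial>lborel) * (\<integral>\<^sup>+x. ennreal (g x) \<partial>lborel) \<le> (\<integral>\<^sup>+x. H x \<partial>lborel)\<^sup>2"
proof (cases "(\<forall>x. f x = 0) \<or> (\<forall>x. g x = 0) \<or> integral\<^sup>N lborel H = \<infinity>")
  case True
  then show ?thesis by (auto simp: power2_eq_square ennreal_top_mult)
next
  case False
  then obtain x0 y0 where "f x0 \<noteq> 0" "g y0 \<noteq> 0" by auto
  define a where "a = (SUP x. f x)"
  define b where "b = (SUP x. g x)"
  have bdd: "bdd_above (range f)" "bdd_above (range g)" using f g by (auto intro!: bdd_aboveI)
  have fa: "f x \<le> a" and gb: "g x \<le> b" for x unfolding a_def b_def using bdd by (auto intro: cSUP_upper)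
  have ab: "0 < a" "0 < b"
    using \<open>f x0 \<noteq> 0\<close> \<open>g y0 \<noteq> 0\<close> f[of x0] g[of y0] fa[of x0] gb[of y0] by linarith+
  define s where "s = sqrt (a * b)"
  have s: "0 < s" "s\<^sup>2 = a * b" using ab by (auto simp: s_def)
  define \<phi> where "\<phi> t = emeasure lborel {x. ennreal (t * s) < H x}" for t
  have key: "emeasure lborel {x. t * a < f x} + emeasure lborel {x. t * b < g x} \<le> 2 * \<phi> t" if t: "0 < t" "t < 1" for t
    unfolding \<phi>_def
  proof (rule brunn_minkowski_real)
    have "t * a < a" "t * b < b" using t ab by auto
    then show "{x. t * a < f x} \<noteq> {}" "{x. t * b < g x} \<noteq> {}"
      using less_cSUP_iff[OF _ bdd(1), of "t * a"] less_cSUP_iff[OF _ bdd(2), of "t * b"]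
      by (auto simp: a_def[symmetric] b_def[symmetric])
    fix x y assume xy: "x \<in> {x. t * a < f x}" "y \<in> {x. t * b < g x}"
    have "0 < f x" using xy(1) mult_pos_pos[OF t(1) ab(1)] by simp
    have "(t * s)\<^sup>2 = (t * a) * (t * b)" using s by (simp add: power_mult_distrib power2_eq_square)
    also have "\<dots> < f x * g y" using xy t ab \<open>0 < f x\<close> by (intro mult_strict_mono) auto
    finally have "ennreal ((t * s)\<^sup>2) < ennreal (f x * g y)" using t s by (subst ennreal_less_iff) auto
    also have "\<dots> \<le> (H ((x + y) / 2))\<^sup>2" using H[of x y] f g by (simp add: ennreal_mult)
    finally have "(ennreal (t * s))\<^sup>2 < (H ((x + y) / 2))\<^sup>2" using t s by (simp add: ennreal_power)
    then have "ennreal (t * s) < H ((x + y) / 2)"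
      by (meson linorder_not_less power_mono zero_le)
    then show "(x + y) / 2 \<in> {x. ennreal (t * s) < H x}" by simp
  qed measurable
  have [measurable]: "(\<lambda>t. emeasure lborel {x. t * a < f x}) \<in> borel_measurable borel"
    "(\<lambda>t. emeasure lborel {x. t * b < g x}) \<in> borel_measurable borel" "\<phi> \<in> borel_measurable borel"
    unfolding \<phi>_def by measurable
  let ?I = "indicator {0<..<1} :: real \<Rightarrow> ennreal"
  let ?h = "\<lambda>t x. ?I t * indicator {x. ennreal (t * s) < H x} x"
  let ?X = "\<integral>\<^sup>+t. ?I t * emeasure lborel {x. t * a < f x} \<partial>lborel"
  let ?Y = "\<integral>\<^sup>+t. ?I t * emeasure lborel {x. t * b < g x} \<partial>lborel"
  have F: "(\<integral>\<^sup>+x. ennreal (f x) \<partial>lborel) = ennreal a * ?X" by (rule layer_cake) (auto simp: ab f fa)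
  have G: "(\<integral>\<^sup>+x. ennreal (g x) \<partial>lborel) = ennreal b * ?Y" by (rule layer_cake) (auto simp: ab g gb)
  have HH: "ennreal s * (\<integral>\<^sup>+t. ?I t * \<phi> t \<partial>lborel) \<le> integral\<^sup>N lborel H"
  proof -
    have "(\<integral>\<^sup>+t. ?I t * \<phi> t \<partial>lborel) = (\<integral>\<^sup>+t. \<integral>\<^sup>+x. ?h t x \<partial>lborel \<partial>lborel)"
      unfolding \<phi>_def by (intro nn_integral_cong, subst nn_integral_cmult) auto
    also have "\<dots> = (\<integral>\<^sup>+x. \<integral>\<^sup>+t. ?h t x \<partial>lborel \<partial>lborel)"
      by (rule lborel_pair.Fubini') measurable
    finally have "ennreal s * (\<integral>\<^sup>+t. ?I t * \<phi> t \<partial>lborel) = (\<integral>\<^sup>+x. ennreal s * (\<integral>\<^sup>+t. ?h t x \<partial>lborel) \<partial>lborel)"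
      by (simp add: nn_integral_cmult)
    also have "\<dots> \<le> integral\<^sup>N lborel H"
    proof (intro nn_integral_mono)
      fix x :: real
      show "ennreal s * (\<integral>\<^sup>+t. ?h t x \<partial>lborel) \<le> H x"
      proof (cases "H x")
        case (real r)
        have "(\<integral>\<^sup>+t. ?h t x \<partial>lborel) \<le> (\<integral>\<^sup>+t. indicator {0<..<r / s} t \<partial>lborel)"
          using s real by (intro nn_integral_mono) (auto simp: indicator_def field_simps ennreal_less_iff)
        also have "\<dots> = ennreal (r / s)" using s real by simp
        finally have "ennreal s * (\<integral>\<^sup>+t. ?h t x \<partial>lborel) \<le> ennreal s * ennreal (r / s)"
          by (intro mult_left_mono) auto
        also have "\<dots> = H x" using s real by (simp add: ennreal_mult[symmetric])
        finally show ?thesis .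
      qed simp
    qed
    finally show ?thesis .
  qed
  have XY: "?X + ?Y \<le> 2 * (\<integral>\<^sup>+t. ?I t * \<phi> t \<partial>lborel)"
  proof -
    have "?X + ?Y = (\<integral>\<^sup>+t. ?I t * (emeasure lborel {x. t * a < f x} + emeasure lborel {x. t * b < g x}) \<partial>lborel)"
      by (subst nn_integral_add[symmetric]) (auto simp: distrib_left)
    also have "\<dots> \<le> (\<integral>\<^sup>+t. 2 * (?I t * \<phi> t) \<partial>lborel)"
      using key by (intro nn_integral_mono) (auto simp: indicator_def)
    finally show ?thesis by (simp add: nn_integral_cmult)
  qed
  have fX: "?X < \<infinity>" "?Y < \<infinity>" using fin F G ab by (auto simp: ennreal_mult_less_top ennreal_mult_eq_top_iff less_top)
  obtain X where X: "?X = ennreal X" "0 \<le> X" using fX(1) by (cases ?X) auto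
  obtain Y where Y: "?Y = ennreal Y" "0 \<le> Y" using fX(2) by (cases ?Y) auto
  obtain h where h: "integral\<^sup>N lborel H = ennreal h" "0 \<le> h" using False by (cases "\<integral>\<^sup>+x. H x \<partial>lborel") auto
  have "ennreal (s * (X + Y)) = ennreal s * (?X + ?Y)" using s X Y by (simp add: ennreal_mult ennreal_plus)
  also have "\<dots> \<le> ennreal s * (2 * (\<integral>\<^sup>+t. ?I t * \<phi> t \<partial>lborel))" by (intro mult_left_mono XY) simp
  also have "\<dots> = 2 * (ennreal s * (\<integral>\<^sup>+t. ?I t * \<phi> t \<partial>lborel))" by (simp add: ac_simps)
  also have "\<dots> \<le> 2 * integral\<^sup>N lborel H" by (intro mult_left_mono HH) simp
  also have "\<dots> = ennreal (2 * h)" using h by (simp add: ennreal_mult)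
  finally have le: "s * (X + Y) \<le> 2 * h" using h by (simp add: ennreal_le_iff)
  have "4 * ((a * X) * (b * Y)) = s\<^sup>2 * (4 * X * Y)" using s by simp
  also have "\<dots> \<le> s\<^sup>2 * (X + Y)\<^sup>2"
    using sum_squares_ge_zero[of "X - Y" 0] by (intro mult_left_mono) (auto simp: power2_eq_square algebra_simps)
  also have "\<dots> = (s * (X + Y))\<^sup>2" by (simp add: power_mult_distrib)
  also have "\<dots> \<le> (2 * h)\<^sup>2" using le s X Y by (intro power_mono) auto
  finally have "(a * X) * (b * Y) \<le> h\<^sup>2" by simp
  then have "ennreal ((a * X) * (b * Y)) \<le> ennreal (h\<^sup>2)" by (rule ennreal_leI)
  then show ?thesis unfolding F G X(1) Y(1) h(1) using ab X Y h by (simp add: ennreal_mult ennreal_power)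
qed

text \<open>Truncating F and G in both argument and value makes them bounded and integrable. This
  only weakens what is demanded of H, which stays fixed, and monotone convergence removes the two
  truncations one after the other.\<close>

lemma prekopa_leindler_real:
  fixes F G H :: "real \<Rightarrow> ennreal"
  assumes [measurable]: "F \<in> borel_measurable borel" "G \<in> borel_measurable borel" "H \<in> borel_measurable borel"
    and H: "\<And>x y. F x * G y \<le> (H ((x + y) / 2))\<^sup>2"
  shows "integral\<^sup>N lborel F * integral\<^sup>N lborel G \<le> (\<integral>\<^sup>+x. H x \<partial>lborel)\<^sup>2"
proof -
  define T where "T F k x = (if x \<in> {- real k..real k} then min (F x) (ennreal (real k)) else 0)" for F :: "real \<Rightarrow> ennreal" and k x
  have Tm[measurable]: "T F k \<in> borel_measurable borel" if [measurable]: "F \<in> borel_measurable borel" for F k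
    unfolding T_def by measurable
  have Tle: "T F k x \<le> ennreal (real k)" "T F k x \<le> F x" for F k x by (auto simp: T_def)
  have Tr: "T F k x = ennreal (enn2real (T F k x))" for F k x
    using Tle(1)[of F k x] by (metis ennreal_enn2real ennreal_less_top le_less_trans)
  have Tfin: "integral\<^sup>N lborel (T F k) < \<infinity>" for F k
  proof -
    have "integral\<^sup>N lborel (T F k) \<le> (\<integral>\<^sup>+x. ennreal (real k) * indicator {- real k..real k} x \<partial>lborel)"
      by (intro nn_integral_mono) (auto simp: T_def)
    also have "\<dots> < \<infinity>" by (subst nn_integral_cmult) (auto simp: ennreal_mult_less_top)
    finally show ?thesis .
  qed
  have Tlim: "(SUP k. \<integral>\<^sup>+x. T F k x \<partial>lborel) = integral\<^sup>N lborel F" if [measurable]: "F \<in> borel_measurable borel" for F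
  proof -
    have inc: "incseq (\<lambda>k. T F k)"
      by (auto simp: incseq_def le_fun_def T_def intro: min.mono ennreal_leI) (auto intro!: min.coboundedI2 ennreal_leI)
    have "(SUP k. \<integral>\<^sup>+x. T F k x \<partial>lborel) = (\<integral>\<^sup>+x. (SUP k. T F k x) \<partial>lborel)"
      using nn_integral_monotone_convergence_SUP[OF inc, of lborel] Tm[OF that] by simp
    moreover have "(SUP k. T F k x) = F x" for x
    proof (rule antisym)
      show "(SUP k. T F k x) \<le> F x" by (intro SUP_least Tle)
      obtain k0 where k0: "\<bar>x\<bar> \<le> real k0" using real_arch_simple by blast
      show "F x \<le> (SUP k. T F k x)"
      proof (cases "F x")
        case (real r)
        obtain k1 where k1: "r \<le> real k1" using real_arch_simple by blast
        have "F x = T F (max k0 k1) x"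
          using k0 k1 real by (auto simp: T_def min_def abs_le_iff)
        then show ?thesis by (metis SUP_upper UNIV_I)
      next
        case top
        have "of_nat k \<le> (SUP k. T F k x)" for k
        proof -
          have "of_nat k \<le> T F (max k0 k) x"
            using k0 top by (auto simp: T_def abs_le_iff ennreal_of_nat_eq_real_of_nat)
          also have "\<dots> \<le> (SUP k. T F k x)" by (rule SUP_upper) simp
          finally show ?thesis .
        qed
        then have "(SUP k. of_nat k :: ennreal) \<le> (SUP k. T F k x)" by (intro SUP_least)
        then have "(SUP k. T F k x) = top" by (simp only: ennreal_SUP_of_nat_eq_top top_unique)
        then show ?thesis by (simp only: top_greatest)
      qed
    qed
    ultimately show ?thesis by simp
  qed
  have "integral\<^sup>N lborel (T F j) * integral\<^sup>N lborel (T G k) \<le> (\<integral>\<^sup>+x. H x \<partial>lborel)\<^sup>2" for j k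
  proof -
    have "(\<integral>\<^sup>+x. ennreal (enn2real (T F j x)) \<partial>lborel) * (\<integral>\<^sup>+x. ennreal (enn2real (T G k x)) \<partial>lborel) \<le> (\<integral>\<^sup>+x. H x \<partial>lborel)\<^sup>2"
    proof (rule prekopa_leindler_bounded[where K = "real (max j k)"])
      show "enn2real (T F j x) \<le> real (max j k)" "enn2real (T G k x) \<le> real (max j k)" for x
        using Tle(1)[of F j x] Tle(1)[of G k x] by (auto intro!: enn2real_leI elim: order_trans intro: ennreal_leI)
      fix x y
      have "T F j x * T G k y \<le> F x * G y" by (intro mult_mono Tle) auto
      also note H
      finally show "ennreal (enn2real (T F j x)) * ennreal (enn2real (T G k y)) \<le> (H ((x + y) / 2))\<^sup>2"
        by (simp only: Tr[symmetric])
    qed (simp_all only: Tr[symmetric] Tfin enn2real_nonneg, measurable)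
    then show ?thesis by (simp only: Tr[symmetric])
  qed
  then have "(SUP k. integral\<^sup>N lborel (T F j) * integral\<^sup>N lborel (T G k)) \<le> (\<integral>\<^sup>+x. H x \<partial>lborel)\<^sup>2" for j
    by (intro SUP_least)
  then have "integral\<^sup>N lborel (T F j) * integral\<^sup>N lborel G \<le> (\<integral>\<^sup>+x. H x \<partial>lborel)\<^sup>2" for j
    by (simp add: SUP_mult_left_ennreal[symmetric] Tlim)
  then have "(SUP j. integral\<^sup>N lborel (T F j) * integral\<^sup>N lborel G) \<le> (\<integral>\<^sup>+x. H x \<partial>lborel)\<^sup>2"
    by (intro SUP_least)
  then show ?thesis by (simp add: SUP_mult_right_ennreal[symmetric] Tlim)
qed

text \<open>Tensorisation: with one coordinate frozen at u, v and (u + v)/2, the induction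
  hypothesis for the slices is exactly the pointwise hypothesis of the one-dimensional inequality
  for the partial integrals.\<close>

lemma prekopa_leindler_PiM:
  fixes F G H :: "(nat \<Rightarrow> real) \<Rightarrow> ennreal"
  assumes "finite I"
    and "F \<in> borel_measurable (\<Pi>\<^sub>M i\<in>I. lborel)" "G \<in> borel_measurable (\<Pi>\<^sub>M i\<in>I. lborel)" "H \<in> borel_measurable (\<Pi>\<^sub>M i\<in>I. lborel)"
    and "\<And>x y. x \<in> extensional I \<Longrightarrow> y \<in> extensional I \<Longrightarrow> F x * G y \<le> (H (\<lambda>i\<in>I. (x i + y i) / 2))\<^sup>2"
  shows "(\<integral>\<^sup>+x. F x \<partial>(\<Pi>\<^sub>M i\<in>I. lborel)) * (\<integral>\<^sup>+x. G x \<partial>(\<Pi>\<^sub>M i\<in>I. lborel)) \<le> (\<integral>\<^sup>+x. H x \<partial>(\<Pi>\<^sub>M i\<in>I. lborel))\<^sup>2"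
  using assms
proof (induction I arbitrary: F G H rule: finite_induct)
  case empty
  then show ?case
    using empty.prems(4)[of "\<lambda>_. undefined" "\<lambda>_. undefined"]
    by (simp add: lborel_product.nn_integral_empty restrict_def)
next
  case (insert i I)
  let ?P = "\<Pi>\<^sub>M i\<in>I. (lborel :: real measure)"
  have fn: "finite I" "i \<notin> I" by fact+
  have upd: "(\<lambda>(u, x). x(i := u)) \<in> lborel \<Otimes>\<^sub>M ?P \<rightarrow>\<^sub>M (\<Pi>\<^sub>M i\<in>insert i I. lborel)"
    by measurable
  have m2: "(\<lambda>(u, x). A (x(i := u))) \<in> borel_measurable (lborel \<Otimes>\<^sub>M ?P)"
    if "A \<in> borel_measurable (\<Pi>\<^sub>M i\<in>insert i I. lborel)" for A :: "(nat \<Rightarrow> real) \<Rightarrow> ennreal"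
    using measurable_compose[OF upd that] by (simp add: case_prod_beta' )
  have m1: "(\<lambda>u. \<integral>\<^sup>+x. A (x(i := u)) \<partial>?P) \<in> borel_measurable borel"
    if "A \<in> borel_measurable (\<Pi>\<^sub>M i\<in>insert i I. lborel)" for A :: "(nat \<Rightarrow> real) \<Rightarrow> ennreal"
    using sigma_finite_measure.borel_measurable_nn_integral[OF lborel_product.sigma_finite[OF fn(1)] m2[OF that]] by simp
  have m3: "(\<lambda>x. A (x(i := u))) \<in> borel_measurable ?P"
    if "A \<in> borel_measurable (\<Pi>\<^sub>M i\<in>insert i I. lborel)" for A :: "(nat \<Rightarrow> real) \<Rightarrow> ennreal" and u
  proof -
    have "(\<lambda>x. x(i := u)) \<in> ?P \<rightarrow>\<^sub>M (\<Pi>\<^sub>M i\<in>insert i I. lborel)" by measurable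
    from measurable_compose[OF this that] show ?thesis .
  qed
  note ins = lborel_product.product_nn_integral_insert_rev[OF fn]
  show ?case
    unfolding ins[OF insert.prems(1)] ins[OF insert.prems(2)] ins[OF insert.prems(3)]
  proof (rule prekopa_leindler_real)
    fix u v :: real
    show "(\<integral>\<^sup>+x. F (x(i := u)) \<partial>?P) * (\<integral>\<^sup>+x. G (x(i := v)) \<partial>?P) \<le> (\<integral>\<^sup>+x. H (x(i := (u + v) / 2)) \<partial>?P)\<^sup>2"
    proof (rule insert.IH)
      fix x y :: "nat \<Rightarrow> real" assume xy: "x \<in> extensional I" "y \<in> extensional I"
      have e: "x(i := u) \<in> extensional (insert i I)" "y(i := v) \<in> extensional (insert i I)"
        using xy by (auto simp: extensional_def)
      have "(\<lambda>j\<in>insert i I. ((x(i := u)) j + (y(i := v)) j) / 2) = (\<lambda>j\<in>I. (x j + y j) / 2)(i := (u + v) / 2)"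
        by (auto simp: fun_eq_iff restrict_def)
      then show "F (x(i := u)) * G (y(i := v)) \<le> (H ((\<lambda>j\<in>I. (x j + y j) / 2)(i := (u + v) / 2)))\<^sup>2"
        using insert.prems(4)[OF e] by (simp only:)
    qed (intro m3 insert.prems)+
  qed (intro m1 insert.prems)+
qed

lemma prekopa_leindler_lebesgue_Rn:
  fixes F G H :: "(nat \<Rightarrow> real) \<Rightarrow> ennreal"
  assumes m: "F \<in> borel_measurable borel" "G \<in> borel_measurable borel" "H \<in> borel_measurable borel"
    and H: "\<And>x y. F x * G y \<le> (H (\<lambda>i. (x i + y i) / 2))\<^sup>2"
  shows "integral\<^sup>N (lebesgue_Rn n) F * integral\<^sup>N (lebesgue_Rn n) G \<le> (\<integral>\<^sup>+x. H x \<partial>lebesgue_Rn n)\<^sup>2"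
  unfolding nn_integral_lebesgue_Rn[OF m(1)] nn_integral_lebesgue_Rn[OF m(2)] nn_integral_lebesgue_Rn[OF m(3)]
proof (rule prekopa_leindler_PiM)
  fix x y :: "nat \<Rightarrow> real"
  have "ext0 n (\<lambda>i\<in>{..<n}. (x i + y i) / 2) = (\<lambda>i. (ext0 n x i + ext0 n y i) / 2)"
    by (auto simp: fun_eq_iff)
  then show "F (ext0 n x) * G (ext0 n y) \<le> (H (ext0 n (\<lambda>i\<in>{..<n}. (x i + y i) / 2)))\<^sup>2"
    using H[of "ext0 n x" "ext0 n y"] by simp
qed (use m ext0_measurable in \<open>auto intro: measurable_compose\<close>)

section \<open>Tails of linear functionals on the sphere\<close>

abbreviation ball_measure :: "nat \<Rightarrow> (nat \<Rightarrow> real) measure" where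
  "ball_measure n \<equiv> uniform_measure (lebesgue_Rn n) (unit_ball n)"

lemma sphere_measure_eq: "sphere_measure n = distr (ball_measure n) borel (dir n)"
  by (simp add: sphere_measure_def dir_def[abs_def])

lemma sets_sphere_measure [measurable_cong, simp]: "sets (sphere_measure n) = sets borel"
  by (simp add: sphere_measure_def)

lemma space_sphere_measure [simp]: "space (sphere_measure n) = UNIV"
  by (simp add: sphere_measure_def)

lemma prob_space_ball_measure: "prob_space (ball_measure n)"
  using emeasure_unit_ball_finite[of n] emeasure_unit_ball_pos[of n]
  by (intro prob_space_uniform_measure) auto

lemma prob_space_sphere_measure: "prob_space (sphere_measure n)"
  unfolding sphere_measure_eq by (intro prob_space.prob_space_distr prob_space_ball_measure) simp

lemma measure_sphere_measure:
  assumes "Y \<in> sets borel"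
  shows "measure (sphere_measure n) Y = measure (ball_measure n) {x. dir n x \<in> Y}"
  unfolding sphere_measure_eq using assms by (subst measure_distr) (auto simp: vimage_def)

lemma measure_ball_measure:
  assumes "X \<in> sets borel"
  shows "measure (ball_measure n) X = measure (lebesgue_Rn n) (unit_ball n \<inter> X) / measure (lebesgue_Rn n) (unit_ball n)"
  using emeasure_unit_ball_finite[of n] emeasure_unit_ball_pos[of n] assms
  by (intro measure_uniform_measure) auto

lemma measure_unit_ball_pos: "0 < measure (lebesgue_Rn n) (unit_ball n)"
  using emeasure_unit_ball_finite[of n] emeasure_unit_ball_pos[of n]
  by (simp add: measure_def enn2real_positive_iff)

lemma measure_lebesgue_Rn_affine:
  assumes "E \<in> sets borel" "c \<noteq> 0" "\<And>i. i \<ge> n \<Longrightarrow> v i = 0"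
  shows "measure (lebesgue_Rn n) E = \<bar>c\<bar> ^ n * measure (lebesgue_Rn n) {x. (\<lambda>i. v i + c * x i) \<in> E}"
  unfolding measure_def using emeasure_lebesgue_Rn_affine[OF assms] by (simp add: enn2real_mult)

lemma measure_cball_lebesgue_Rn:
  assumes "0 < r" "Y \<in> sets borel"
  shows "measure (lebesgue_Rn n) {x. enorm n x \<le> r \<and> dir n x \<in> Y} = r ^ n * measure (lebesgue_Rn n) {x. enorm n x \<le> 1 \<and> dir n x \<in> Y}"
  unfolding measure_def using emeasure_cball_lebesgue_Rn[OF assms, of n] assms by (simp add: enn2real_mult)

lemma bounded_lebesgue_Rn_finite:
  assumes "\<And>x. x \<in> X \<Longrightarrow> enorm n x \<le> r"
  shows "emeasure (lebesgue_Rn n) X < \<infinity>"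
proof -
  have "emeasure (lebesgue_Rn n) X \<le> emeasure (lebesgue_Rn n) {x. enorm n x \<le> max 1 r \<and> dir n x \<in> UNIV}"
    using assms by (intro emeasure_mono) force+
  also have "\<dots> < \<infinity>"
    using emeasure_unit_ball_finite[of n] by (subst emeasure_cball_lebesgue_Rn) (auto simp: ennreal_mult_less_top)
  finally show ?thesis .
qed

lemma measure_lebesgue_Rn_mono:
  assumes "X \<subseteq> Y" "Y \<in> sets borel" "\<And>x. x \<in> Y \<Longrightarrow> enorm n x \<le> r"
  shows "measure (lebesgue_Rn n) X \<le> measure (lebesgue_Rn n) Y"
  unfolding measure_def using bounded_lebesgue_Rn_finite[OF assms(3)] assms(1,2)
  by (intro enn2real_mono emeasure_mono) auto

lemma measure_ball_measure_mono:
  assumes "unit_ball n \<inter> X \<subseteq> Y" "X \<in> sets borel" "Y \<in> sets borel"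
  shows "measure (ball_measure n) X \<le> measure (ball_measure n) Y"
proof -
  have "measure (lebesgue_Rn n) (unit_ball n \<inter> X) \<le> measure (lebesgue_Rn n) (unit_ball n \<inter> Y)"
    using assms by (intro measure_lebesgue_Rn_mono[where r=1]) auto
  then show ?thesis
    using assms measure_unit_ball_pos[of n] by (simp add: measure_ball_measure divide_right_mono)
qed

lemma borel_add [measurable]: "(\<lambda>x i. v i + c * x i) \<in> borel \<rightarrow>\<^sub>M (borel :: (nat \<Rightarrow> real) measure)"
  by (intro borel_measurable_funI) measurable

lemma sqrt_power_le_exp:
  assumes "0 \<le> 1 + y"
  shows "sqrt (1 + y) ^ n \<le> exp (real n * y / 2)"
proof -
  have "sqrt (1 + y) \<le> sqrt (exp y)" using exp_ge_add_one_self[of y] by simp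
  also have "\<dots> = exp (y / 2)"
    by (rule real_sqrt_unique) (simp_all add: power2_eq_square exp_add[symmetric])
  finally have "sqrt (1 + y) ^ n \<le> exp (y / 2) ^ n" using assms by (intro power_mono) auto
  then show ?thesis by (simp add: exp_of_nat_mult[symmetric])
qed

text \<open>Translating a slab of the ball by \<open>t e\<close> lands in a ball of radius \<open>sqrt (1 + 3 t\<^sup>2)\<close>.\<close>
lemma measure_shift_le:
  assumes [measurable]: "Y \<in> sets borel" and e: "enorm n e = 1" "\<And>i. i \<ge> n \<Longrightarrow> e i = 0" and t: "0 \<le> t"
  shows "measure (ball_measure n) {x. 0 \<le> ip n x e \<and> ip n x e \<le> t \<and> dir n (\<lambda>i. t * e i + 1 * x i) \<in> Y}
    \<le> exp (3 / 2 * real n * t\<^sup>2) * measure (sphere_measure n) Y"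
proof -
  define R where "R = sqrt (1 + 3 * t\<^sup>2)"
  have R: "0 < R" "R\<^sup>2 = 1 + 3 * t\<^sup>2"
    using zero_le_power2[of t] by (auto simp: R_def intro!: real_sqrt_gt_zero add_pos_nonneg)
  define E where "E = {y. enorm n y \<le> R \<and> dir n y \<in> Y}"
  have [measurable]: "E \<in> sets borel" unfolding E_def by measurable
  let ?Z = "{x. 0 \<le> ip n x e \<and> ip n x e \<le> t \<and> dir n (\<lambda>i. t * e i + 1 * x i) \<in> Y}"
  have Z[measurable]: "?Z \<in> sets borel" by measurable
  have E': "{x. (\<lambda>i. t * e i + 1 * x i) \<in> E} \<in> sets borel" by measurable
  have sub: "unit_ball n \<inter> ?Z \<subseteq> {x. (\<lambda>i. t * e i + 1 * x i) \<in> E}"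
  proof
    fix x assume x: "x \<in> unit_ball n \<inter> ?Z"
    have "(enorm n (\<lambda>i. t * e i + 1 * x i))\<^sup>2 = t\<^sup>2 + 2 * (t * ip n x e) + (enorm n x)\<^sup>2"
      using enorm_add_sq[of "\<lambda>i. t * e i" x n] e
      by (simp add: enorm_scale ip_scale_left ip_commute[of e] del: sum_distrib_left)
    \<comment> \<open>Being in the slab makes the cross term quadratic in t. For an arbitrary point
      of the ball it would be linear, and the cost of the shift would be exponential in n t instead
      of n t^2.\<close>
    also have "\<dots> \<le> t\<^sup>2 + 2 * (t * t) + 1\<^sup>2"
      using x t enorm_nonneg[of x n] by (intro add_mono mult_left_mono power_mono) auto
    also have "\<dots> = R\<^sup>2" unfolding R(2) by (simp add: power2_eq_square)
    finally have "enorm n (\<lambda>i. t * e i + 1 * x i) \<le> R" using R(1) by (rule power2_le_imp_le[OF _ less_imp_le])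
    then show "x \<in> {x. (\<lambda>i. t * e i + 1 * x i) \<in> E}" using x by (simp add: E_def)
  qed
  have "measure (lebesgue_Rn n) (unit_ball n \<inter> ?Z) \<le> measure (lebesgue_Rn n) {x. (\<lambda>i. t * e i + 1 * x i) \<in> E}"
  proof (rule measure_lebesgue_Rn_mono[OF sub E', where r="R + t"])
    fix x assume "x \<in> {x. (\<lambda>i. t * e i + 1 * x i) \<in> E}"
    then have "enorm n (\<lambda>i. t * e i + x i) \<le> R" by (simp add: E_def)
    moreover have "enorm n x \<le> enorm n (\<lambda>i. t * e i + x i) + enorm n (\<lambda>i. x i - (t * e i + x i))"
      by (rule enorm_triangle_diff)
    moreover have "enorm n (\<lambda>i. x i - (t * e i + x i)) = t"
      using enorm_scale[of "-t" e n] e t by simp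
    ultimately show "enorm n x \<le> R + t" by simp
  qed
  also have "\<dots> = measure (lebesgue_Rn n) E"
    using measure_lebesgue_Rn_affine[of E 1 n "\<lambda>i. t * e i"] e by simp
  also have "\<dots> = R ^ n * measure (lebesgue_Rn n) (unit_ball n \<inter> {x. dir n x \<in> Y})"
    unfolding E_def using R by (subst measure_cball_lebesgue_Rn) (auto simp: Collect_conj_eq)
  finally have "measure (lebesgue_Rn n) (unit_ball n \<inter> ?Z) / measure (lebesgue_Rn n) (unit_ball n)
      \<le> R ^ n * measure (lebesgue_Rn n) (unit_ball n \<inter> {x. dir n x \<in> Y}) / measure (lebesgue_Rn n) (unit_ball n)"
    by (intro divide_right_mono) simp_all
  then have "measure (ball_measure n) ?Z \<le> R ^ n * measure (ball_measure n) {x. dir n x \<in> Y}"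
    by (subst (1 2) measure_ball_measure) (simp_all only: times_divide_eq_right Z, measurable)
  also have "\<dots> \<le> exp (3 / 2 * real n * t\<^sup>2) * measure (ball_measure n) {x. dir n x \<in> Y}"
    using sqrt_power_le_exp[of "3 * t\<^sup>2" n] by (intro mult_right_mono) (auto simp: R_def mult_ac)
  finally show ?thesis by (simp add: measure_sphere_measure)
qed

text \<open>Scaling requires r > 0; the case r = 0 follows by shrinking positive radii. That
  degenerate case shows that the points where \<open>dir\<close> vanishes form a null set.\<close>

lemma measure_small_ball:
  assumes "0 \<le> r" "r \<le> 1" "1 \<le> n"
  shows "measure (ball_measure n) {x. enorm n x \<le> r} \<le> r ^ n"
proof -
  have *: "measure (ball_measure n) {x. enorm n x \<le> r} \<le> r ^ n" if "0 < r" "r \<le> 1" for r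
  proof -
    have "unit_ball n \<inter> {x. enorm n x \<le> r} = {x. enorm n x \<le> r \<and> dir n x \<in> UNIV}" using that by auto
    then have "measure (lebesgue_Rn n) (unit_ball n \<inter> {x. enorm n x \<le> r}) = r ^ n * measure (lebesgue_Rn n) (unit_ball n)"
      using measure_cball_lebesgue_Rn[OF that(1), of UNIV n] by simp
    then show ?thesis using measure_unit_ball_pos[of n] by (simp add: measure_ball_measure)
  qed
  show ?thesis
  proof (cases "r = 0")
    case True
    have "measure (ball_measure n) {x. enorm n x \<le> 0} \<le> e" if "0 < e" for e
    proof -
      have "measure (ball_measure n) {x. enorm n x \<le> 0} \<le> measure (ball_measure n) {x. enorm n x \<le> min 1 e}"
        using that by (intro measure_ball_measure_mono) auto
      also have "\<dots> \<le> min 1 e ^ n" using that by (intro *) auto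
      also have "\<dots> \<le> min 1 e ^ 1" using that assms by (intro power_decreasing) auto
      finally show ?thesis by simp
    qed
    then have "measure (ball_measure n) {x. enorm n x \<le> 0} \<le> 0" by (rule field_le_epsilon[of _ 0, simplified])
    then show ?thesis using True assms by (simp add: zero_power)
  qed (use * assms in auto)
qed

lemma AE_ball_measure_nonzero:
  assumes "1 \<le> n" shows "AE x in ball_measure n. enorm n x \<noteq> 0"
proof -
  interpret prob_space "ball_measure n" by (rule prob_space_ball_measure)
  have "prob {x. enorm n x \<le> 0} = 0"
    using measure_small_ball[of 0 n] assms by (simp add: zero_power measure_le_0_iff)
  then have "AE x in ball_measure n. x \<notin> {x. enorm n x \<le> 0}"
    by (subst (asm) prob_eq_0) auto
  then show ?thesis by eventually_elim auto
qed

lemma AE_sphere_measure: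
  assumes "1 \<le> n" shows "AE x in sphere_measure n. enorm n x = 1 \<and> (\<forall>i\<ge>n. x i = 0)"
proof -
  have m: "{x :: nat \<Rightarrow> real. enorm n x = 1 \<and> (\<forall>i\<ge>n. x i = 0)} \<in> sets borel" by measurable
  have "AE x in ball_measure n. \<forall>i\<ge>n. x i = 0"
    using AE_lebesgue_Rn_ext0[of n] by (intro AE_uniform_measureI) auto
  with AE_ball_measure_nonzero[OF assms]
  have "AE x in ball_measure n. enorm n (dir n x) = 1 \<and> (\<forall>i\<ge>n. dir n x i = 0)"
    by eventually_elim (simp add: enorm_dir, simp add: dir_def)
  then show ?thesis unfolding sphere_measure_eq using m by (subst AE_distr_iff) auto
qed

text \<open>For t^2 \<le> 1/2 the part of the unit ball in the cone over the cap lies in the ball of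
  radius sqrt (1 - t^2) around t e, and the ratio of volumes is (1 - t^2)^(n/2).\<close>

lemma sphere_upper_tail:
  assumes e: "enorm n e = 1" "\<And>i. i \<ge> n \<Longrightarrow> e i = 0" and t: "0 \<le> t"
  shows "measure (sphere_measure n) {x. t \<le> ip n x e} \<le> exp (- (real n * t\<^sup>2 / 4))"
proof -
  interpret S: prob_space "sphere_measure n" by (rule prob_space_sphere_measure)
  have m: "{x. t \<le> ip n x e} \<in> sets borel" for t by measurable
  have small: "measure (sphere_measure n) {x. t \<le> ip n x e} \<le> exp (- (real n * t\<^sup>2 / 2))"
    if t: "0 < t" "t\<^sup>2 \<le> 1/2" for t
  proof -
    define r where "r = sqrt (1 - t\<^sup>2)"
    have r: "0 < r" "r\<^sup>2 = 1 - t\<^sup>2" using t by (auto simp: r_def intro!: real_sqrt_gt_zero)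
    let ?E = "{x. enorm n (\<lambda>i. x i - t * e i) \<le> r}"
    have [measurable]: "?E \<in> sets borel" by measurable
    have sub: "unit_ball n \<inter> {x. t \<le> ip n (dir n x) e} \<subseteq> ?E"
    proof
      fix x assume x: "x \<in> unit_ball n \<inter> {x. t \<le> ip n (dir n x) e}"
      then have "enorm n x \<noteq> 0" using t by (auto simp: ip_dir)
      then have pos: "0 < enorm n x" by (rule enorm_pos)
      then have ip: "t * enorm n x \<le> ip n x e" using x by (auto simp: ip_dir pos_le_divide_eq)
      have "(enorm n (\<lambda>i. x i - t * e i))\<^sup>2 = (enorm n x)\<^sup>2 - 2 * (t * ip n x e) + t\<^sup>2"
        using enorm_diff_sq[of x "\<lambda>i. t * e i" n] e t
        by (simp add: enorm_scale ip_commute[of x] ip_scale_left)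
      also have "\<dots> \<le> (enorm n x)\<^sup>2 - 2 * (t * (t * enorm n x)) + t\<^sup>2"
        using ip t by (intro add_mono diff_mono mult_left_mono) auto
      \<comment> \<open>Both factors of the product are nonnegative because |x| \<le> 1 and t^2
        \<le> 1/2; larger t therefore need another argument.\<close>
      also have "\<dots> = r\<^sup>2 - (1 - enorm n x) * ((1 - 2 * t\<^sup>2) + enorm n x)"
        unfolding r(2) by (simp add: power2_eq_square algebra_simps)
      also have "\<dots> \<le> r\<^sup>2" using x pos t by simp
      finally show "x \<in> ?E" using r by (auto intro: power2_le_imp_le)
    qed
    have "measure (lebesgue_Rn n) (unit_ball n \<inter> {x. t \<le> ip n (dir n x) e}) \<le> measure (lebesgue_Rn n) ?E"
    proof (rule measure_lebesgue_Rn_mono[OF sub, where r = "r + t"])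
      fix x assume "x \<in> ?E"
      then show "enorm n x \<le> r + t"
        using enorm_triangle_diff[of x n "\<lambda>i. t * e i"] e t by (simp add: enorm_scale)
    qed simp
    also have "\<dots> = r ^ n * measure (lebesgue_Rn n) (unit_ball n)"
      using measure_lebesgue_Rn_affine[of ?E r n "\<lambda>i. t * e i"] e r by (simp add: enorm_scale)
    also have "\<dots> \<le> exp (- (real n * t\<^sup>2 / 2)) * measure (lebesgue_Rn n) (unit_ball n)"
      using sqrt_power_le_exp[of "- t\<^sup>2" n] t by (intro mult_right_mono) (auto simp: r_def)
    finally have "measure (ball_measure n) {x. t \<le> ip n (dir n x) e} \<le> exp (- (real n * t\<^sup>2 / 2))"
      using measure_unit_ball_pos[of n] by (subst measure_ball_measure) (measurable, simp add: pos_divide_le_eq)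
    then show ?thesis by (subst measure_sphere_measure) (use m in auto)
  qed
  consider "t = 0" | "0 < t" "t\<^sup>2 \<le> 1/2" | "t\<^sup>2 > 1/2" "t \<le> 1" | "t > 1" using t by linarith
  then show ?thesis
  proof cases
    case 1 then show ?thesis using S.prob_le_1 by simp
  next
    case 2
    have "exp (- (real n * t\<^sup>2 / 2)) \<le> exp (- (real n * t\<^sup>2 / 4))" by (simp add: field_simps)
    then show ?thesis using small[OF 2] by linarith
  next
    case 3
    \<comment> \<open>The cap lies in the one at height sqrt (1/2), whose measure is at most exp (-
      n/4). The constant 4 in the claimed exponent leaves room for this.\<close>
    let ?s = "sqrt (1/2)"
    have "?s \<le> t" using 3 t by (intro real_le_lsqrt) auto
    then have "measure (sphere_measure n) {x. t \<le> ip n x e} \<le> measure (sphere_measure n) {x. ?s \<le> ip n x e}"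
      using m by (intro S.finite_measure_mono) auto
    also have "\<dots> \<le> exp (- (real n * ?s\<^sup>2 / 2))" by (rule small) auto
    also have "\<dots> = exp (- (real n * 1 / 4))" by simp
    also have "\<dots> \<le> exp (- (real n * t\<^sup>2 / 4))"
      using 3 t power_le_one[of t 2] mult_left_mono[of "t\<^sup>2" 1 "real n"] by simp
    finally show ?thesis .
  next
    case 4
    have "{x. dir n x \<in> {x. t \<le> ip n x e}} = {}"
      using 4 ip_le[of "dir n _" e n] enorm_dir_le[of n] e by (auto simp: not_le) (smt (verit) mult.right_neutral)
    then show ?thesis using m by (simp add: measure_sphere_measure)
  qed
qed

lemma ball_half_space:
  assumes e: "enorm n e = 1"
  shows "1/2 \<le> measure (ball_measure n) {x. 0 \<le> ip n x e}"
proof -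
  interpret B: prob_space "ball_measure n" by (rule prob_space_ball_measure)
  let ?P = "{x. 0 \<le> ip n x e}" and ?N = "{x. ip n x e \<le> 0}"
  have [measurable]: "?P \<in> sets borel" "?N \<in> sets borel" by measurable
  have "measure (lebesgue_Rn n) (unit_ball n \<inter> ?N) = measure (lebesgue_Rn n) {x. (\<lambda>i. 0 + (-1) * x i) \<in> unit_ball n \<inter> ?N}"
    by (subst measure_lebesgue_Rn_affine[where c = "-1" and v = "\<lambda>_. 0"]) auto
  also have "{x. (\<lambda>i. 0 + (-1) * x i) \<in> unit_ball n \<inter> ?N} = unit_ball n \<inter> ?P"
    by (auto simp: enorm_uminus sum_negf)
  finally have eq: "B.prob ?N = B.prob ?P" by (simp add: measure_ball_measure)
  have "1 = B.prob (?P \<union> ?N)" using B.prob_space by (simp add: Un_def linear)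
  also have "\<dots> \<le> B.prob ?P + B.prob ?N" by (rule measure_Un_le) auto
  finally show ?thesis using eq by simp
qed

text \<open>In the unit ball, a point with inner product above t also has a direction with inner
  product above t. So the half ball is covered by the slab and the cone over a cap.\<close>

lemma ball_slab:
  assumes e: "enorm n e = 1" "\<And>i. i \<ge> n \<Longrightarrow> e i = 0" and t: "0 < t"
  shows "1/2 - exp (- (real n * t\<^sup>2 / 4)) \<le> measure (ball_measure n) {x. 0 \<le> ip n x e \<and> ip n x e \<le> t}"
proof -
  interpret B: prob_space "ball_measure n" by (rule prob_space_ball_measure)
  let ?S = "{x. 0 \<le> ip n x e \<and> ip n x e \<le> t}" and ?D = "{x. t \<le> ip n (dir n x) e}"
  have [measurable]: "?S \<in> sets borel" "?D \<in> sets borel" by measurable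
  have "1/2 \<le> B.prob {x. 0 \<le> ip n x e}" by (rule ball_half_space[OF e(1)])
  also have "\<dots> \<le> B.prob (?S \<union> ?D)"
  proof (rule measure_ball_measure_mono)
    show "unit_ball n \<inter> {x. 0 \<le> ip n x e} \<subseteq> ?S \<union> ?D"
    proof
      fix x assume x: "x \<in> unit_ball n \<inter> {x. 0 \<le> ip n x e}"
      show "x \<in> ?S \<union> ?D"
      proof (cases "ip n x e \<le> t")
        case False
        then have "enorm n x \<noteq> 0" using ip_le[of x e n] t by auto
        then have pos: "0 < enorm n x" by (rule enorm_pos)
        have "t * enorm n x \<le> t * 1" using x t by (intro mult_left_mono) auto
        then have "t \<le> ip n (dir n x) e" using False pos by (simp add: ip_dir pos_le_divide_eq)
        then show ?thesis by simp
      qed (use x in auto)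
    qed
  qed auto
  also have "\<dots> \<le> B.prob ?S + B.prob ?D" by (rule measure_Un_le) auto
  also have "B.prob ?D = measure (sphere_measure n) {x. t \<le> ip n x e}"
    by (subst measure_sphere_measure) auto
  also have "\<dots> \<le> exp (- (real n * t\<^sup>2 / 4))" using t by (intro sphere_upper_tail e) auto
  finally show ?thesis by simp
qed

lemma exp_minus_3_2_le: "exp (- (3/2 :: real)) \<le> 1/4"
proof -
  have "(1 + 1/4 + (1/4)\<^sup>2 / 2 :: real) ^ 6 \<le> exp (1/4) ^ 6"
    using exp_lower_Taylor_quadratic[of "1/4::real"] by (intro power_mono) auto
  also have "exp (1/4) ^ 6 = exp (3/2 :: real)" by (simp add: exp_of_nat_mult[symmetric])
  finally have "4 \<le> exp (3/2 :: real)" by (simp add: power_divide field_simps)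
  then show ?thesis by (simp add: exp_minus field_simps)
qed

lemma two_power_le_exp: "2 ^ k \<le> exp (real k)"
  using power_mono[of 2 "exp 1 :: real" k] exp_ge_add_one_self[of 1] by (simp add: exp_of_nat_mult[symmetric])

text \<open>Shift a slab of ball measure at least 1/4 by r e: the shifted points have inner product
  at least r and norm at most 2, so their directions lie in the cap, and
  \<open>measure_shift_le\<close> bounds the cost by exp (3/2 n r^2).\<close>

lemma sphere_lower_tail:
  assumes n: "1 \<le> n" and e: "enorm n e = 1" "\<And>i. i \<ge> n \<Longrightarrow> e i = 0" and t: "0 \<le> t" "t \<le> 1"
  shows "exp (- 9) / 4 * exp (- (3/2 * real n * t\<^sup>2)) \<le> measure (sphere_measure n) {x. t / 2 \<le> ip n x e}"
proof -
  interpret S: prob_space "sphere_measure n" by (rule prob_space_sphere_measure)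
  interpret B: prob_space "ball_measure n" by (rule prob_space_ball_measure)
  have m[measurable]: "{x. t \<le> ip n x e} \<in> sets borel" for t by measurable
  \<comment> \<open>The slab has mass at least 1/4 if r = 1 or n r^2 \<ge> 6. Enlarging t to r adds
    at most 6 to n t^2, which is the origin of 9 = 3/2 * 6.\<close>
  define r where "r = max t (min 1 (sqrt (6 / real n)))"
  have r: "0 < r" "r \<le> 1" "t \<le> r" using t n by (auto simp: r_def less_max_iff_disj)
  have "r\<^sup>2 \<le> t\<^sup>2 + 6 / real n"
  proof (cases "t \<le> min 1 (sqrt (6 / real n))")
    case True
    then have "r \<le> sqrt (6 / real n)" by (auto simp: r_def)
    then have "r\<^sup>2 \<le> (sqrt (6 / real n))\<^sup>2" using r by (intro power_mono) auto
    then show ?thesis using n by (simp add: add_increasing)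
  qed (use n in \<open>auto simp: r_def max_def\<close>)
  then have "real n * r\<^sup>2 \<le> real n * (t\<^sup>2 + 6 / real n)" by (intro mult_left_mono) auto
  then have nr: "real n * r\<^sup>2 \<le> real n * t\<^sup>2 + 6" using n by (simp add: distrib_left)
  have slab: "1/4 \<le> B.prob {x. 0 \<le> ip n x e \<and> ip n x e \<le> r}"
  proof (cases "r = 1")
    case True
    have "1/2 \<le> B.prob {x. 0 \<le> ip n x e}" by (rule ball_half_space[OF e(1)])
    also have "\<dots> \<le> B.prob {x. 0 \<le> ip n x e \<and> ip n x e \<le> r}"
    proof (rule measure_ball_measure_mono)
      show "unit_ball n \<inter> {x. 0 \<le> ip n x e} \<subseteq> {x. 0 \<le> ip n x e \<and> ip n x e \<le> r}"
        using ip_le[of _ e n] True e by (auto intro: order_trans)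
    qed auto
    finally show ?thesis by simp
  next
    case False
    then have "sqrt (6 / real n) \<le> r" using r by (auto simp: r_def)
    then have "6 / real n \<le> r\<^sup>2" using real_le_lsqrt sqrt_le_D by blast
    then have "6 \<le> real n * r\<^sup>2" using n by (simp add: field_simps)
    then have "exp (- (real n * r\<^sup>2 / 4)) \<le> exp (- (3/2))" by simp
    then show ?thesis using ball_slab[OF e r(1)] exp_minus_3_2_le by linarith
  qed
  let ?Y = "{x. t / 2 \<le> ip n x e}"
  have sub: "unit_ball n \<inter> {x. 0 \<le> ip n x e \<and> ip n x e \<le> r} \<subseteq> {x. 0 \<le> ip n x e \<and> ip n x e \<le> r \<and> dir n (\<lambda>i. r * e i + 1 * x i) \<in> ?Y}"
  proof
    fix x assume x: "x \<in> unit_ball n \<inter> {x. 0 \<le> ip n x e \<and> ip n x e \<le> r}"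
    let ?y = "\<lambda>i. r * e i + 1 * x i"
    have ee: "ip n e e = 1" using e enorm_sq[of e n] by simp
    have ipy: "r \<le> ip n ?y e"
      using x ee by (simp add: ip_add_left ip_scale_left)
    have "enorm n ?y \<le> enorm n (\<lambda>i. r * e i) + enorm n x"
      using L2_set_triangle_ineq[of "\<lambda>i. r * e i" x "{..<n}"] by simp
    then have ny: "enorm n ?y \<le> 2" using x r e by (simp add: enorm_scale)
    have "0 < enorm n ?y" using ip_le[of ?y e n] ipy r e by simp
    have "t / 2 * enorm n ?y \<le> r / 2 * 2" using r t ny by (intro mult_mono) auto
    then have "t / 2 * enorm n ?y \<le> ip n ?y e" using ipy by linarith
    then have "dir n ?y \<in> ?Y" using \<open>0 < enorm n ?y\<close> by (simp only: mem_Collect_eq ip_dir pos_le_divide_eq)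
    then show "x \<in> {x. 0 \<le> ip n x e \<and> ip n x e \<le> r \<and> dir n (\<lambda>i. r * e i + 1 * x i) \<in> ?Y}" using x by simp
  qed
  have "B.prob {x. 0 \<le> ip n x e \<and> ip n x e \<le> r} \<le> B.prob {x. 0 \<le> ip n x e \<and> ip n x e \<le> r \<and> dir n (\<lambda>i. r * e i + 1 * x i) \<in> ?Y}"
    by (rule measure_ball_measure_mono[OF sub]) measurable
  also have "\<dots> \<le> exp (3 / 2 * real n * r\<^sup>2) * S.prob ?Y"
    using r by (intro measure_shift_le e) auto
  also have "\<dots> \<le> exp (3 / 2 * real n * t\<^sup>2 + 9) * S.prob ?Y"
    using nr by (intro mult_right_mono) auto
  finally have "1/4 \<le> exp (3 / 2 * real n * t\<^sup>2 + 9) * S.prob ?Y" using slab by linarith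
  then have "1/4 * exp (- (3 / 2 * real n * t\<^sup>2 + 9)) \<le> exp (3 / 2 * real n * t\<^sup>2 + 9) * S.prob ?Y * exp (- (3 / 2 * real n * t\<^sup>2 + 9))"
    by (rule mult_right_mono) simp
  also have "\<dots> = S.prob ?Y * (exp (3 / 2 * real n * t\<^sup>2 + 9) * exp (- (3 / 2 * real n * t\<^sup>2 + 9)))" by (simp only: mult_ac)
  also have "\<dots> = S.prob ?Y" by (simp only: exp_minus_inverse mult_1_right)
  also have "exp (- (3 / 2 * real n * t\<^sup>2 + 9)) = exp (- 9) * exp (- (3 / 2 * real n * t\<^sup>2))"
    by (simp only: mult_exp_exp minus_add_distrib add.commute)
  finally show ?thesis by simp
qed

text \<open>Bound exp X by 1 plus the sum of e^(k+1) over the integers k \<ge> 0 with k \<le> X. The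
  tails turn this into a geometric series with sum K e^2/(e - 1), and (e - 2)(e - 3) \<le> 0 gives
  e^2 \<le> 5 (e - 1).\<close>

lemma nn_integral_exp_le:
  assumes "prob_space M" and [measurable]: "X \<in> borel_measurable M" and K: "0 \<le> K"
    and tail: "\<And>k::nat. measure M {x \<in> space M. real k \<le> X x} \<le> K * exp (- (2 * real k))"
  shows "(\<integral>\<^sup>+x. ennreal (exp (X x)) \<partial>M) \<le> ennreal (1 + 5 * K)"
proof -
  interpret prob_space M by fact
  have e: "2 \<le> exp (1::real)" "exp (1::real) \<le> 3" using exp_ge_add_one_self[of 1] exp_le by auto
  let ?A = "\<lambda>k. {x \<in> space M. real k \<le> X x}"
  have gen: "f k \<le> suminf f" for f :: "nat \<Rightarrow> ennreal" and k
    using sum_le_suminf[OF summableI, of "{k}" f] by simp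
  have "(\<integral>\<^sup>+x. ennreal (exp (X x)) \<partial>M) \<le> (\<integral>\<^sup>+x. 1 + (\<Sum>k. ennreal (exp (real k + 1)) * indicator (?A k) x) \<partial>M)"
  proof (intro nn_integral_mono)
    fix x assume x: "x \<in> space M"
    show "ennreal (exp (X x)) \<le> 1 + (\<Sum>k. ennreal (exp (real k + 1)) * indicator (?A k) x)"
    proof (cases "X x < 0")
      case True
      then have "ennreal (exp (X x)) \<le> 1" by (simp add: ennreal_le_1)
      then show ?thesis by (meson le_iff_add order_trans)
    next
      case False
      define k where "k = nat \<lfloor>X x\<rfloor>"
      have k: "real k \<le> X x" "X x \<le> real k + 1" using False by (auto simp: k_def)
      have "ennreal (exp (X x)) \<le> ennreal (exp (real k + 1)) * indicator (?A k) x"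
        using k x by (auto intro!: ennreal_leI)
      also have "\<dots> \<le> (\<Sum>k. ennreal (exp (real k + 1)) * indicator (?A k) x)" by (rule gen)
      finally show ?thesis by (simp add: add_increasing)
    qed
  qed
  also have "\<dots> = 1 + (\<Sum>k. ennreal (exp (real k + 1)) * emeasure M (?A k))"
    by (subst nn_integral_add) (auto simp: nn_integral_suminf nn_integral_cmult emeasure_space_1)
  also have "(\<Sum>k. ennreal (exp (real k + 1)) * emeasure M (?A k)) \<le> (\<Sum>k. ennreal (K * exp 1 * exp (-1) ^ k))"
  proof (intro suminf_le)
    fix k
    have "ennreal (exp (real k + 1)) * emeasure M (?A k) \<le> ennreal (exp (real k + 1)) * ennreal (K * exp (- (2 * real k)))"
      using tail[of k] by (intro mult_left_mono) (auto simp: emeasure_eq_measure intro!: ennreal_leI)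
    also have "\<dots> = ennreal (exp (real k + 1) * (K * exp (- (2 * real k))))"
      using K by (subst ennreal_mult) auto
    also have "exp (real k + 1) * (K * exp (- (2 * real k))) = K * exp 1 * exp (-1) ^ k"
      by (simp add: exp_of_nat_mult[symmetric] exp_add[symmetric] mult_ac)
    finally show "ennreal (exp (real k + 1)) * emeasure M (?A k) \<le> ennreal (K * exp 1 * exp (-1) ^ k)" .
  qed auto
  also have "(\<Sum>k. ennreal (K * exp 1 * exp (-1) ^ k)) = ennreal (K * exp 1 * (1 / (1 - exp (-1))))"
    using K by (intro suminf_ennreal_eq sums_mult geometric_sums) auto
  also have "\<dots> \<le> ennreal (5 * K)"
  proof (rule ennreal_leI)
    define E where "E = exp (1::real)"
    have E: "2 \<le> E" "E \<le> 3" using e by (auto simp: E_def)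
    have "(E - 2) * (E - 3) \<le> 0" using E by (intro mult_nonneg_nonpos) auto
    then have "E * E \<le> 5 * (E - 1)" by (simp add: algebra_simps)
    then have "E * E / (E - 1) \<le> 5" using E by (simp add: pos_divide_le_eq)
    moreover have "exp 1 * (1 / (1 - exp (-1))) = E * E / (E - 1)" using E by (simp add: E_def exp_minus field_simps)
    moreover have "K * exp 1 * (1 / (1 - exp (-1))) = K * (exp 1 * (1 / (1 - exp (-1))))" by (simp only: mult.assoc)
    ultimately show "K * exp 1 * (1 / (1 - exp (-1))) \<le> 5 * K"
      using K mult_left_mono[of "E * E / (E - 1)" 5 K] by (simp only: mult.commute[of 5])
  qed
  finally show ?thesis using K by (simp add: ennreal_plus add_left_mono)
qed

text \<open>The 8 is twice the 4 of \<open>sphere_upper_tail\<close>, so that level k has tail exp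
  (- 2 k).\<close>

lemma sphere_exp_moment:
  assumes n: "1 \<le> n" and e: "enorm n e = 1" "\<And>i. i \<ge> n \<Longrightarrow> e i = 0"
  shows "(\<integral>\<^sup>+x. ennreal (exp (real n * (max 0 (ip n x e))\<^sup>2 / 8)) \<partial>sphere_measure n) \<le> ennreal 6"
proof -
  interpret S: prob_space "sphere_measure n" by (rule prob_space_sphere_measure)
  have "(\<integral>\<^sup>+x. ennreal (exp (real n * (max 0 (ip n x e))\<^sup>2 / 8)) \<partial>sphere_measure n) \<le> ennreal (1 + 5 * 1)"
  proof (rule nn_integral_exp_le)
    fix k :: nat
    let ?A = "{x \<in> space (sphere_measure n). real k \<le> real n * (max 0 (ip n x e))\<^sup>2 / 8}"
    show "S.prob ?A \<le> 1 * exp (- (2 * real k))"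
    proof (cases "k = 0")
      case False
      let ?t = "sqrt (8 * real k / real n)"
      have "?A \<subseteq> {x. ?t \<le> ip n x e}"
      proof
        fix x assume "x \<in> ?A"
        then have "8 * real k / real n \<le> (max 0 (ip n x e))\<^sup>2" using n by (simp add: field_simps)
        then have "?t \<le> max 0 (ip n x e)" by (intro real_le_lsqrt) auto
        moreover have "0 < ?t" using n False by simp
        ultimately show "x \<in> {x. ?t \<le> ip n x e}"
          by (auto simp: max_def simp del: real_sqrt_gt_0_iff split: if_splits)
      qed
      then have "S.prob ?A \<le> S.prob {x. ?t \<le> ip n x e}" by (intro S.finite_measure_mono) auto
      also have "\<dots> \<le> exp (- (real n * ?t\<^sup>2 / 4))" by (intro sphere_upper_tail e) auto
      also have "\<dots> = exp (- (2 * real k))" using n by simp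
      finally show ?thesis by simp
    qed simp
  qed (use prob_space_sphere_measure in auto)
  then show ?thesis by simp
qed

text \<open>The translates of the boundary of a cone along its axis are pairwise disjoint.\<close>
lemma sphere_measure_latitude:
  assumes n: "1 \<le> n" and \<theta>: "0 \<le> \<theta>" "\<theta> < 1"
  shows "measure (sphere_measure n) {x. x 0 = \<theta>} = 0"
proof -
  define e :: "nat \<Rightarrow> real" where "e = (\<lambda>i. if i = 0 then 1 else 0)"
  have e: "enorm n e = 1" "\<And>i. i \<ge> n \<Longrightarrow> e i = 0"
    using n by (auto simp: e_def L2_set_def if_distrib[of "\<lambda>x. x\<^sup>2"] sum.delta cong: if_cong)
  define \<Gamma> where "\<Gamma> = {x. enorm n x \<le> 1 \<and> x 0 = \<theta> * enorm n x}"
  \<comment> \<open>Infinitely many disjoint sets of equal measure inside a ball of radius 2 must be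
    null; any infinite set of shifts in (0, 1] serves.\<close>
  define t where "t k = 1 / real (Suc k)" for k :: nat
  define A where "A k = {x. (\<lambda>i. (- t k) * e i + 1 * x i) \<in> \<Gamma>}" for k
  have t: "0 < t k" "t k \<le> 1" "t k = t j \<Longrightarrow> k = j" for k j by (auto simp: t_def)
  have G[measurable]: "\<Gamma> \<in> sets borel"
  proof -
    have [measurable]: "(\<lambda>x. x 0 - \<theta> * enorm n x) \<in> borel_measurable borel" by measurable
    have "\<Gamma> = unit_ball n \<inter> ((\<lambda>x. x 0 - \<theta> * enorm n x) -` {0} \<inter> space borel)" by (auto simp: \<Gamma>_def)
    then show ?thesis using measurable_sets[of "\<lambda>x. x 0 - \<theta> * enorm n x" borel borel "{0}"] by simp
  qed
  have Am[measurable]: "A k \<in> sets borel" for k unfolding A_def by measurable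
  have Ameas: "measure (lebesgue_Rn n) (A k) = measure (lebesgue_Rn n) \<Gamma>" for k
    unfolding A_def using measure_lebesgue_Rn_affine[OF G, of 1 n "\<lambda>i. (- t k) * e i"] e by simp
  have Abd: "enorm n x \<le> 2" if "x \<in> A k" for x k
  proof -
    have "enorm n (\<lambda>i. x i - t k * e i) \<le> 1" using that by (simp add: A_def \<Gamma>_def add.commute)
    moreover have "enorm n (\<lambda>i. t k * e i) = t k" using t(1)[of k] e by (simp add: enorm_scale)
    ultimately show ?thesis using enorm_triangle_diff[of x n "\<lambda>i. t k * e i"] t(2)[of k] by linarith
  qed
  \<comment> \<open>Moving along the axis changes the first coordinate by the full length of the
    move, but \<theta> times the norm by at most \<theta> < 1 times that length.\<close>
  have no: False if x: "x \<in> A j" "x \<in> A k" and lt: "t j < t k" for x j k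
  proof -
    let ?y = "\<lambda>i. (- t j) * e i + 1 * x i" and ?z = "\<lambda>i. (- t k) * e i + 1 * x i"
    have yz: "?y 0 = \<theta> * enorm n ?y" "?z 0 = \<theta> * enorm n ?z" using x by (auto simp: A_def \<Gamma>_def)
    have d: "(\<lambda>i. ?y i - ?z i) = (\<lambda>i. (t k - t j) * e i)" by (auto simp: algebra_simps)
    have nd: "edist n ?y ?z = t k - t j" unfolding d using lt e by (simp only: enorm_scale) simp
    have le1: "enorm n ?y \<le> enorm n ?z + (t k - t j)"
      using enorm_triangle_diff[of ?y n ?z] unfolding nd .
    have le2: "enorm n ?z \<le> enorm n ?y + (t k - t j)"
      using enorm_triangle_diff[of ?z n ?y] unfolding enorm_minus_commute[of ?z ?y n] nd .
    have "?y 0 - ?z 0 = t k - t j" by (simp add: e_def)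
    then have "\<theta> * (enorm n ?y - enorm n ?z) = t k - t j" using yz by (simp add: algebra_simps)
    moreover have "\<theta> * (enorm n ?y - enorm n ?z) < t k - t j"
    proof (cases "0 \<le> enorm n ?y - enorm n ?z")
      case True
      have "\<theta> * (enorm n ?y - enorm n ?z) \<le> \<theta> * (t k - t j)" using le1 \<theta> by (intro mult_left_mono) auto
      also have "\<dots> < 1 * (t k - t j)" using \<theta> lt by (intro mult_strict_right_mono) auto
      finally show ?thesis by simp
    next
      case False
      then have "\<theta> * (enorm n ?y - enorm n ?z) \<le> 0" using \<theta> by (intro mult_nonneg_nonpos) auto
      then show ?thesis using lt by simp
    qed
    ultimately show False by simp
  qed
  have dis: "disjoint_family_on A S" for S
  proof (unfold disjoint_family_on_def, intro ballI impI)
    fix j k :: nat assume "j \<noteq> k"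
    then have "t j < t k \<or> t k < t j" using t(3)[of j k] by linarith
    then show "A j \<inter> A k = {}" using no by blast
  qed
  have fin: "emeasure (lebesgue_Rn n) (A k) \<noteq> \<infinity>" for k
    using bounded_lebesgue_Rn_finite[of "A k" n 2] Abd by auto
  define D where "D = measure (lebesgue_Rn n) {x. enorm n x \<le> 2}"
  have "real N * measure (lebesgue_Rn n) \<Gamma> \<le> D" for N
  proof -
    have "real N * measure (lebesgue_Rn n) \<Gamma> = (\<Sum>k<N. measure (lebesgue_Rn n) (A k))" by (simp add: Ameas)
    also have "\<dots> = measure (lebesgue_Rn n) (\<Union>k<N. A k)"
      using dis fin by (intro measure_finite_Union[symmetric]) auto
    also have "\<dots> \<le> D" unfolding D_def using Abd by (intro measure_lebesgue_Rn_mono[where r=2]) auto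
    finally show ?thesis .
  qed
  then have "\<not> 0 < measure (lebesgue_Rn n) \<Gamma>" using ex_less_of_nat_mult[of "measure (lebesgue_Rn n) \<Gamma>" D] by (metis not_le)
  then have G0: "measure (lebesgue_Rn n) \<Gamma> = 0" using measure_nonneg[of "lebesgue_Rn n" \<Gamma>] by linarith
  have "measure (lebesgue_Rn n) (unit_ball n \<inter> {x. dir n x 0 = \<theta>}) \<le> measure (lebesgue_Rn n) (\<Gamma> \<union> {x. enorm n x \<le> 0})"
  proof (rule measure_lebesgue_Rn_mono[where r=1])
    show "unit_ball n \<inter> {x. dir n x 0 = \<theta>} \<subseteq> \<Gamma> \<union> {x. enorm n x \<le> 0}"
    proof
      fix x assume x: "x \<in> unit_ball n \<inter> {x. dir n x 0 = \<theta>}"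
      show "x \<in> \<Gamma> \<union> {x. enorm n x \<le> 0}"
      proof (cases "enorm n x = 0")
        case False then show ?thesis using x by (auto simp: \<Gamma>_def dir_def)
      qed simp
    qed
  next
    show "\<Gamma> \<union> {x. enorm n x \<le> 0} \<in> sets borel" by measurable
    show "enorm n x \<le> 1" if "x \<in> \<Gamma> \<union> {x. enorm n x \<le> 0}" for x using that by (auto simp: \<Gamma>_def)
  qed
  also have "\<dots> \<le> measure (lebesgue_Rn n) \<Gamma> + measure (lebesgue_Rn n) {x. enorm n x \<le> 0}"
    by (rule measure_Un_le) auto
  also have "measure (lebesgue_Rn n) {x. enorm n x \<le> 0} = 0"
  proof -
    have un: "unit_ball n \<inter> {x. enorm n x \<le> 0} = {x. enorm n x \<le> 0}" by auto
    have m0: "{x. enorm n x \<le> 0} \<in> sets borel" by measurable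
    have "measure (ball_measure n) {x. enorm n x \<le> 0} = measure (lebesgue_Rn n) {x. enorm n x \<le> 0} / measure (lebesgue_Rn n) (unit_ball n)"
      unfolding measure_ball_measure[OF m0] un ..
    then have "measure (lebesgue_Rn n) {x. enorm n x \<le> 0} / measure (lebesgue_Rn n) (unit_ball n) \<le> 0"
      using measure_small_ball[of 0 n] n by (simp add: zero_power)
    then show ?thesis using measure_unit_ball_pos[of n] by (simp add: divide_le_0_iff measure_le_0_iff)
  qed
  finally have "measure (lebesgue_Rn n) (unit_ball n \<inter> {x. dir n x 0 = \<theta>}) = 0" using G0 by (simp add: measure_le_0_iff)
  then have "measure (ball_measure n) {x. dir n x 0 = \<theta>} = 0" by (subst measure_ball_measure) simp_all
  then show ?thesis by (subst measure_sphere_measure) simp_all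
qed

section \<open>Concentration of Lipschitz functions on the sphere\<close>

lemma nn_integral_ball_measure:
  assumes [measurable]: "F \<in> borel_measurable borel"
  shows "(\<integral>\<^sup>+x. F x * indicator (unit_ball n) x \<partial>lebesgue_Rn n) = emeasure (lebesgue_Rn n) (unit_ball n) * integral\<^sup>N (ball_measure n) F"
proof -
  let ?v = "emeasure (lebesgue_Rn n) (unit_ball n)"
  have "integral\<^sup>N (ball_measure n) F = (\<integral>\<^sup>+x. F x * indicator (unit_ball n) x \<partial>lebesgue_Rn n) / ?v"
    by (intro nn_integral_uniform_measure) auto
  then show ?thesis
    using emeasure_unit_ball_finite[of n] emeasure_unit_ball_pos[of n]
    by (simp add: ennreal_times_divide mult_divide_eq_ennreal mult.commute[of ?v])
qed

text \<open>The level set at k is the ball of squared radius 1 - 4 k/n, whose mass is at most exp (-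
  2 k).\<close>

lemma ball_exp_moment:
  assumes n: "1 \<le> n"
  shows "(\<integral>\<^sup>+x. ennreal (exp (real n * (1 - (enorm n x)\<^sup>2) / 4)) \<partial>ball_measure n) \<le> ennreal 6"
proof -
  have "(\<integral>\<^sup>+x. ennreal (exp (real n * (1 - (enorm n x)\<^sup>2) / 4)) \<partial>ball_measure n) \<le> ennreal (1 + 5 * 1)"
  proof (rule nn_integral_exp_le[OF prob_space_ball_measure])
    interpret B: prob_space "ball_measure n" by (rule prob_space_ball_measure)
    fix k :: nat
    let ?A = "{x \<in> space (ball_measure n). real k \<le> real n * (1 - (enorm n x)\<^sup>2) / 4}"
    have le: "(enorm n x)\<^sup>2 \<le> 1 - 4 * real k / real n" if "x \<in> ?A" for x
      using that n by (simp add: field_simps)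
    show "B.prob ?A \<le> 1 * exp (- (2 * real k))"
    proof (cases "0 \<le> 1 - 4 * real k / real n")
      case True
      let ?r = "sqrt (1 - 4 * real k / real n)"
      have "?A \<subseteq> {x. enorm n x \<le> ?r}" using le by (auto intro!: real_le_rsqrt)
      then have "B.prob ?A \<le> B.prob {x. enorm n x \<le> ?r}" by (intro B.finite_measure_mono) auto
      also have "\<dots> \<le> ?r ^ n" using True n by (intro measure_small_ball) auto
      also have "\<dots> \<le> exp (real n * (- (4 * real k / real n)) / 2)"
        using sqrt_power_le_exp[of "- (4 * real k / real n)" n] True by simp
      also have "\<dots> = exp (- (2 * real k))" using n by simp
      finally show ?thesis by simp
    next
      case False
      have "?A = {}"
      proof (rule ccontr)
        assume "?A \<noteq> {}"
        then obtain x where "x \<in> ?A" by blast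
        from le[OF this] show False using False zero_le_power2[of "enorm n x"] by linarith
      qed
      then show ?thesis by (simp only: measure_empty) simp
    qed
  qed auto
  then show ?thesis by simp
qed

text \<open>Prekopa--Leindler is applied with the midpoint map: the midpoint of two points of the unit ball
  at distance \<open>d\<close> has squared norm at most \<open>1 - d\<^sup>2/4\<close>.\<close>
lemma sphere_concentration:
  assumes n: "2 \<le> n" and g[measurable]: "g \<in> borel_measurable borel"
    and lip: "\<And>x y. enorm n x = 1 \<Longrightarrow> enorm n y = 1 \<Longrightarrow> g x - g y \<le> edist n x y"
    and le1: "\<And>x. enorm n x = 1 \<Longrightarrow> g x \<le> 1" and a: "0 \<le> a"
    and med: "1/2 \<le> measure (sphere_measure n) {x. g x \<le> a}"
  shows "(\<integral>\<^sup>+x. ennreal (exp (real n * (max 0 (g x - a))\<^sup>2 / 128)) \<partial>sphere_measure n) \<le> ennreal 145"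
proof -
  interpret B: prob_space "ball_measure n" by (rule prob_space_ball_measure)
  have n1: "1 \<le> n" using n by simp
  define u where "u x = max 0 (g (dir n x) - a)" for x
  have [measurable]: "u \<in> borel_measurable borel" unfolding u_def by measurable
  let ?v = "emeasure (lebesgue_Rn n) (unit_ball n)"
  \<comment> \<open>Outside the ball of radius 1/2 directions depend on points in a 4-Lipschitz way;
    the removed mass is at most 2^(-n) \<le> 1/4.\<close>
  define W where "W = {x. 1/2 \<le> enorm n x}"
  define L where "L = {x. g (dir n x) \<le> a}"
  have [measurable]: "W \<in> sets borel" "L \<in> sets borel" unfolding W_def L_def by measurable
  \<comment> \<open>A point with g at most a and a point y with excess u y are at distance at least
    u y/4, so their midpoint lies deep inside the ball, where H is large.\<close>
  define F where "F x = (indicator W x * indicator L x :: ennreal)" for x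
  define G where "G x = indicator W x * ennreal (exp (real n * (u x)\<^sup>2 / 128))" for x
  define H where "H x = ennreal (exp (real n * (1 - (enorm n x)\<^sup>2) / 4))" for x
  have [measurable]: "F \<in> borel_measurable borel" "G \<in> borel_measurable borel" "H \<in> borel_measurable borel"
    unfolding F_def G_def H_def by measurable
  have mid: "(F x * indicator (unit_ball n) x) * (G y * indicator (unit_ball n) y)
      \<le> (H (\<lambda>i. (x i + y i) / 2) * indicator (unit_ball n) (\<lambda>i. (x i + y i) / 2))\<^sup>2" for x y
  proof (cases "x \<in> W \<and> x \<in> L \<and> y \<in> W \<and> enorm n x \<le> 1 \<and> enorm n y \<le> 1")
    case False then show ?thesis by (auto simp: F_def G_def indicator_def)
  next
    case True
    let ?w = "\<lambda>i. (x i + y i) / 2"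
    define d where "d = edist n x y"
    have xy: "1/2 \<le> enorm n x" "1/2 \<le> enorm n y" "enorm n x \<le> 1" "enorm n y \<le> 1" "g (dir n x) \<le> a"
      using True by (auto simp: W_def L_def)
    have w: "(enorm n ?w)\<^sup>2 = ((enorm n x)\<^sup>2 + (enorm n y)\<^sup>2) / 2 - d\<^sup>2 / 4"
      unfolding d_def enorm_divide using enorm_add_sq[of x y n] enorm_diff_sq[of x y n]
      by (simp add: power_divide field_simps)
    have "(enorm n x)\<^sup>2 \<le> 1" "(enorm n y)\<^sup>2 \<le> 1" using xy enorm_nonneg by (auto intro!: power_le_one)
    then have w1: "d\<^sup>2 / 4 \<le> 1 - (enorm n ?w)\<^sup>2" unfolding w by (simp add: field_simps)
    then have "(enorm n ?w)\<^sup>2 \<le> 1\<^sup>2" using zero_le_power2[of d] unfolding one_power2 by linarith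
    then have wB: "enorm n ?w \<le> 1" by (rule power2_le_imp_le) simp
    have "g (dir n y) - g (dir n x) \<le> edist n (dir n y) (dir n x)"
      using xy by (intro lip enorm_dir) auto
    also have "\<dots> \<le> 4 * d" using dir_dist[OF xy(2,1)] enorm_minus_commute[of x y n] by (simp add: d_def)
    finally have "u y \<le> 4 * d" using xy(5) enorm_nonneg[of "\<lambda>i. x i - y i" n] by (auto simp: u_def d_def)
    then have "(u y)\<^sup>2 \<le> (4 * d)\<^sup>2" by (intro power_mono) (auto simp: u_def)
    \<comment> \<open>With u y \<le> 4 d, (u y)^2/128 is at most d^2/8, half of the norm deficit
      d^2/4 of the midpoint. This fixes 128, given the 4 in the exponent of H and the square on
      H.\<close>
    then have "(u y)\<^sup>2 / 128 \<le> (1 - (enorm n ?w)\<^sup>2) / 2" using w1 by (simp add: power_mult_distrib)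
    then have "real n * ((u y)\<^sup>2 / 128) \<le> real n * ((1 - (enorm n ?w)\<^sup>2) / 2)" by (rule mult_left_mono) simp
    then have "exp (real n * (u y)\<^sup>2 / 128) \<le> exp (2 * (real n * (1 - (enorm n ?w)\<^sup>2) / 4))" by simp
    also have "\<dots> = (exp (real n * (1 - (enorm n ?w)\<^sup>2) / 4))\<^sup>2" by (rule exp_double)
    finally have "ennreal (exp (real n * (u y)\<^sup>2 / 128)) \<le> (H ?w)\<^sup>2"
      unfolding H_def by (subst ennreal_power) (auto intro: ennreal_leI)
    then show ?thesis using True wB by (simp add: F_def G_def)
  qed
  have "(\<integral>\<^sup>+x. F x * indicator (unit_ball n) x \<partial>lebesgue_Rn n) * (\<integral>\<^sup>+x. G x * indicator (unit_ball n) x \<partial>lebesgue_Rn n)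
     \<le> (\<integral>\<^sup>+x. H x * indicator (unit_ball n) x \<partial>lebesgue_Rn n)\<^sup>2"
    by (intro prekopa_leindler_lebesgue_Rn mid) measurable
  then have "(?v * integral\<^sup>N (ball_measure n) F) * (?v * integral\<^sup>N (ball_measure n) G) \<le> (?v * integral\<^sup>N (ball_measure n) H)\<^sup>2"
    by (simp only: nn_integral_ball_measure \<open>F \<in> _\<close> \<open>G \<in> _\<close> \<open>H \<in> _\<close>)
  also have "\<dots> \<le> (?v * ennreal 6)\<^sup>2"
    unfolding H_def using n by (intro power_mono mult_left_mono ball_exp_moment) auto
  finally have PL: "(?v * integral\<^sup>N (ball_measure n) F) * (?v * integral\<^sup>N (ball_measure n) G) \<le> (?v * ennreal 6)\<^sup>2" .
  have half: "B.prob {x. enorm n x \<le> 1/2} \<le> (1/2) ^ n" using n by (intro measure_small_ball) auto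
  have half4: "(1/2 :: real) ^ n \<le> (1/2)\<^sup>2" using n by (intro power_decreasing) auto
  have FW: "ennreal (1/4) \<le> integral\<^sup>N (ball_measure n) F"
  proof -
    have "1/2 \<le> B.prob L" using med unfolding L_def by (subst (asm) measure_sphere_measure) auto
    also have "\<dots> \<le> B.prob ((W \<inter> L) \<union> {x. enorm n x \<le> 1/2})" by (intro B.finite_measure_mono) (auto simp: W_def)
    also have "\<dots> \<le> B.prob (W \<inter> L) + B.prob {x. enorm n x \<le> 1/2}" by (rule measure_Un_le) auto
    finally have "1/4 \<le> B.prob (W \<inter> L)" using half half4 by (simp add: power2_eq_square)
    moreover have "integral\<^sup>N (ball_measure n) F = emeasure (ball_measure n) (W \<inter> L)"
      unfolding F_def by (subst indicator_inter_arith[symmetric]) (rule nn_integral_indicator, simp)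
    ultimately show ?thesis by (simp add: B.emeasure_eq_measure ennreal_leI del: emeasure_uniform_measure)
  qed
  \<comment> \<open>144 = 4 * 6^2: F has integral at least 1/4 and H has integral at most 6.\<close>
  have GB: "integral\<^sup>N (ball_measure n) G \<le> ennreal 144"
  proof -
    obtain v where v: "?v = ennreal v" "0 < v"
      using emeasure_unit_ball_finite[of n] emeasure_unit_ball_pos[of n] by (cases ?v) auto
    have "ennreal (v * v / 4) * integral\<^sup>N (ball_measure n) G = (?v * ennreal (1/4)) * (?v * integral\<^sup>N (ball_measure n) G)"
      unfolding v(1) using v(2) by (simp add: ennreal_mult[symmetric] mult.assoc[symmetric])
    also have "\<dots> \<le> (?v * integral\<^sup>N (ball_measure n) F) * (?v * integral\<^sup>N (ball_measure n) G)"
      by (intro mult_right_mono mult_left_mono FW) auto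
    also note PL
    also have "(?v * ennreal 6)\<^sup>2 = ennreal (v * v / 4) * ennreal 144"
    proof -
      have "(?v * ennreal 6)\<^sup>2 = ennreal ((v * 6)\<^sup>2)"
        unfolding v(1) using v(2) by (subst ennreal_mult[symmetric]) (simp_all add: ennreal_power)
      moreover have "ennreal (v * v / 4) * ennreal 144 = ennreal (v * v / 4 * 144)"
        using v(2) by (subst ennreal_mult[symmetric]) simp_all
      ultimately show ?thesis by (simp only:) (simp add: power2_eq_square)
    qed
    finally have "ennreal (v * v / 4) * integral\<^sup>N (ball_measure n) G \<le> ennreal (v * v / 4) * ennreal 144" .
    then show ?thesis using v(2) by (subst (asm) ennreal_mult_le_mult_iff) auto
  qed
  have [measurable]: "(\<lambda>x. ennreal (exp (real n * (max 0 (g x - a))\<^sup>2 / 128))) \<in> borel_measurable borel" by measurable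
  have "(\<integral>\<^sup>+x. ennreal (exp (real n * (max 0 (g x - a))\<^sup>2 / 128)) \<partial>sphere_measure n)
     = (\<integral>\<^sup>+x. ennreal (exp (real n * (u x)\<^sup>2 / 128)) \<partial>ball_measure n)"
    unfolding sphere_measure_eq u_def by (subst nn_integral_distr) auto
  \<comment> \<open>On the removed ball only g \<le> 1 is available, so the integrand may reach exp
    (n/128); the mass 2^(-n) outweighs this and adds at most 1 to 144.\<close>
  also have "\<dots> \<le> (\<integral>\<^sup>+x. G x + ennreal (exp (real n / 128)) * indicator {x. enorm n x \<le> 1/2} x \<partial>ball_measure n)"
  proof (rule nn_integral_mono_AE)
    show "AE x in ball_measure n. ennreal (exp (real n * (u x)\<^sup>2 / 128)) \<le> G x + ennreal (exp (real n / 128)) * indicator {x. enorm n x \<le> 1/2} x"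
      using AE_ball_measure_nonzero[OF n1]
    proof eventually_elim
      case (elim x)
      show ?case
      proof (cases "x \<in> W")
        case True then show ?thesis by (simp add: G_def)
      next
        case False
        have "g (dir n x) \<le> 1" using elim n by (intro le1 enorm_dir) auto
        then have "(u x)\<^sup>2 \<le> 1" using a by (intro power_le_one) (auto simp: u_def)
        then have "real n * (u x)\<^sup>2 / 128 \<le> real n / 128" using mult_left_mono[of "(u x)\<^sup>2" 1 "real n"] by simp
        then show ?thesis using False by (simp add: G_def W_def ennreal_leI)
      qed
    qed
  qed
  also have "\<dots> = integral\<^sup>N (ball_measure n) G + ennreal (exp (real n / 128)) * emeasure (ball_measure n) {x. enorm n x \<le> 1/2}"
    by (subst nn_integral_add) (auto simp: nn_integral_cmult simp del: emeasure_uniform_measure)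
  also have "\<dots> \<le> ennreal 144 + ennreal 1"
  proof (intro add_mono GB)
    have "exp (real n / 128) * B.prob {x. enorm n x \<le> 1/2} \<le> exp (real n / 128) * (1/2) ^ n"
      using half by (intro mult_left_mono) auto
    also have "\<dots> = (exp (1/128) / 2) ^ n" by (simp add: power_divide exp_of_nat_mult[symmetric])
    also have "\<dots> \<le> 1"
    proof (rule power_le_one)
      have "exp (1/128 :: real) \<le> 2" using exp_bound[of "1/128 :: real"] by (simp add: power2_eq_square)
      then show "exp (1/128) / 2 \<le> (1::real)" by simp
    qed simp
    finally show "ennreal (exp (real n / 128)) * emeasure (ball_measure n) {x. enorm n x \<le> 1/2} \<le> ennreal 1"
      by (simp only: B.emeasure_eq_measure) (subst ennreal_mult[symmetric], auto intro!: ennreal_leI simp del: ennreal_1)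
  qed
  finally show ?thesis by (simp add: ennreal_plus[symmetric] del: ennreal_plus)
qed

section \<open>The metric projection\<close>

lemma convex_classD:
  assumes "C \<in> convex_class n"
  shows "closed C" "\<And>x i. x \<in> C \<Longrightarrow> i \<ge> n \<Longrightarrow> x i = 0" "(\<lambda>_. 0) \<in> C"
    "\<And>x y u v. x \<in> C \<Longrightarrow> y \<in> C \<Longrightarrow> 0 \<le> u \<Longrightarrow> 0 \<le> v \<Longrightarrow> u + v = 1 \<Longrightarrow> (\<lambda>i. u * x i + v * y i) \<in> C"
  using assms by (auto simp: convex_class_def closedin_Euclidean_space_iff topspace_Euclidean_space subset_iff)

lemma compact_box:
  fixes a b :: "nat \<Rightarrow> real"
  shows "compact {x. \<forall>i. x i \<in> {a i..b i}}"
proof -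
  have "compactin (product_topology (\<lambda>_. euclidean) UNIV) (Pi\<^sub>E UNIV (\<lambda>i. {a i..b i}))"
    by (subst compactin_PiE) simp
  then have "compact (Pi\<^sub>E UNIV (\<lambda>i. {a i..b i}))" by (simp add: euclidean_product_topology)
  also have "Pi\<^sub>E UNIV (\<lambda>i. {a i..b i}) = {x. \<forall>i. x i \<in> {a i..b i}}" by auto
  finally show ?thesis .
qed

lemma continuous_on_enorm [continuous_intros]:
  assumes "\<And>i. continuous_on S (\<lambda>x. f x i)"
  shows "continuous_on S (\<lambda>x. enorm n (f x))"
  unfolding L2_set_def using assms by (intro continuous_intros)

lemma continuous_on_coord [continuous_intros]: "continuous_on S (\<lambda>x :: nat \<Rightarrow> real. x i)"
  by (rule continuous_on_product_coordinates[THEN continuous_on_subset]) simp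

text \<open>A point of C with norm above 2 |x| is farther from x than the origin is, so the minimum
  is sought on a box, compact in the product topology.\<close>

lemma metric_proj_is_arg_min:
  assumes C: "C \<in> convex_class n"
  shows "is_arg_min (\<lambda>y. edist n x y) (\<lambda>y. y \<in> C) (metric_proj n C x)"
proof -
  note C = convex_classD[OF C]
  let ?f = "\<lambda>y. edist n x y"
  let ?r = "2 * enorm n x"
  define K where "K = {y :: nat \<Rightarrow> real. \<forall>i. y i \<in> {if i < n then - ?r else 0..if i < n then ?r else 0}}"
  have K: "compact (C \<inter> K)" unfolding K_def by (intro closed_Int_compact compact_box C)
  have "(\<lambda>_. 0) \<in> C \<inter> K" using C(3) by (auto simp: K_def)
  then have ne: "C \<inter> K \<noteq> {}" by blast
  have "continuous_on (C \<inter> K) ?f" by (intro continuous_intros)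
  from continuous_attains_inf[OF K ne this]
  obtain y where y: "y \<in> C \<inter> K" "\<And>z. z \<in> C \<inter> K \<Longrightarrow> ?f y \<le> ?f z" by blast
  have "?f y \<le> ?f z" if z: "z \<in> C" for z
  proof (cases "z \<in> K")
    case True then show ?thesis using y z by simp
  next
    case False
    then obtain i where i: "z i \<notin> {if i < n then - ?r else 0..if i < n then ?r else 0}" by (auto simp: K_def)
    then have "i < n" using C(2)[OF z, of i] by (cases "i < n") auto
    then have "?r < \<bar>z i\<bar>" using i by auto
    also have "\<dots> \<le> enorm n z" by (rule abs_le_enorm[OF \<open>i < n\<close>])
    also have "\<dots> \<le> enorm n x + ?f z" using enorm_triangle_diff[of z n x] enorm_minus_commute[of x z n] by simp
    finally have "enorm n x \<le> ?f z" by simp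
    moreover have "?f y \<le> ?f (\<lambda>_. 0)" using \<open>(\<lambda>_. 0) \<in> C \<inter> K\<close> by (rule y)
    ultimately show ?thesis by simp
  qed
  then have "is_arg_min ?f (\<lambda>y. y \<in> C) y" using y by (auto simp: is_arg_min_linorder)
  then have "is_arg_min ?f (\<lambda>y. y \<in> C) (SOME y. is_arg_min ?f (\<lambda>y. y \<in> C) y)"
    by (rule someI[where P = "is_arg_min ?f (\<lambda>y. y \<in> C)"])
  then show ?thesis unfolding metric_proj_def arg_min_on_def arg_min_def .
qed

lemma metric_proj_in: "C \<in> convex_class n \<Longrightarrow> metric_proj n C x \<in> C"
  using metric_proj_is_arg_min[of C n x] by (simp add: is_arg_min_def)

lemma metric_proj_le:
  "C \<in> convex_class n \<Longrightarrow> z \<in> C \<Longrightarrow> edist n x (metric_proj n C x) \<le> edist n x z"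
  using metric_proj_is_arg_min[of C n x] by (simp add: is_arg_min_linorder)

lemma metric_proj_sq_le:
  assumes "C \<in> convex_class n" "z \<in> C"
  shows "(enorm n (metric_proj n C x))\<^sup>2 - 2 * ip n x (metric_proj n C x) \<le> (enorm n z)\<^sup>2 - 2 * ip n x z"
proof -
  have "(edist n x (metric_proj n C x))\<^sup>2 \<le> (edist n x z)\<^sup>2"
    by (intro power_mono metric_proj_le assms enorm_nonneg)
  then show ?thesis unfolding enorm_diff_sq by simp
qed

text \<open>Minimality along the segment towards z gives 2 <a, b> \<le> t |b|^2 for all t in (0, 1].
  Were <a, b> positive, t = <a, b>/|b|^2 would be a contradictory choice, so no limit is
  taken.\<close>

lemma metric_proj_obtuse:
  assumes C: "C \<in> convex_class n" and z: "z \<in> C"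
  shows "ip n (\<lambda>i. x i - metric_proj n C x i) (\<lambda>i. z i - metric_proj n C x i) \<le> 0"
proof -
  let ?y = "metric_proj n C x"
  let ?a = "\<lambda>i. x i - ?y i" and ?b = "\<lambda>i. z i - ?y i"
  have *: "2 * ip n ?a ?b \<le> t * (enorm n ?b)\<^sup>2" if t: "0 < t" "t \<le> 1" for t
  proof -
    let ?w = "\<lambda>i. (1 - t) * ?y i + t * z i"
    have "?w \<in> C" using t by (intro convex_classD(4)[OF C] metric_proj_in C z) auto
    then have "(enorm n ?a)\<^sup>2 \<le> (edist n x ?w)\<^sup>2" by (intro power_mono metric_proj_le C enorm_nonneg)
    also have "(\<lambda>i. x i - ?w i) = (\<lambda>i. ?a i - t * ?b i)" by (auto simp: algebra_simps)
    also have "(enorm n \<dots>)\<^sup>2 = (enorm n ?a)\<^sup>2 - 2 * (t * ip n ?a ?b) + t\<^sup>2 * (enorm n ?b)\<^sup>2"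
      unfolding enorm_diff_sq[of ?a "\<lambda>i. t * ?b i" n] enorm_scale ip_commute[of ?a "\<lambda>i. t * ?b i"] ip_scale_left
      by (simp only: power_mult_distrib power2_abs ip_commute[of ?b ?a])
    finally have "t * (2 * ip n ?a ?b) \<le> t * (t * (enorm n ?b)\<^sup>2)" by (simp add: power2_eq_square)
    then show ?thesis using t by (simp only: mult_le_cancel_left_pos)
  qed
  show ?thesis
  proof (rule ccontr)
    assume "\<not> ?thesis"
    then have pos: "0 < ip n ?a ?b" by simp
    define B where "B = (enorm n ?b)\<^sup>2"
    have "2 * ip n ?a ?b \<le> 1 * B" unfolding B_def by (rule *) auto
    then have B: "0 < B" "ip n ?a ?b / B \<le> 1" using pos by (auto simp: divide_le_eq)
    have "2 * ip n ?a ?b \<le> (ip n ?a ?b / B) * B" unfolding B_def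
      by (rule *) (use B pos in \<open>auto simp: B_def\<close>)
    then show False using B pos by simp
  qed
qed

lemma metric_proj_obtuse':
  assumes "C \<in> convex_class n" "z \<in> C"
  shows "ip n x z \<le> ip n x (metric_proj n C x) + ip n (metric_proj n C x) z - (enorm n (metric_proj n C x))\<^sup>2"
  using metric_proj_obtuse[OF assms, of x] unfolding enorm_sq
  by (simp add: algebra_simps sum.distrib sum_subtractf)

lemma metric_proj_nonexpansive:
  assumes C: "C \<in> convex_class n"
  shows "edist n (metric_proj n C x) (metric_proj n C y) \<le> edist n x y"
proof -
  let ?u = "metric_proj n C x" and ?v = "metric_proj n C y"
  let ?d = "\<lambda>i. ?u i - ?v i"
  have "(enorm n ?d)\<^sup>2 \<le> ip n (\<lambda>i. x i - y i) ?d"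
  proof -
    have "ip n (\<lambda>i. x i - y i) ?d = ip n x ?u - ip n x ?v - ip n y ?u + ip n y ?v"
      by (simp add: algebra_simps sum.distrib sum_subtractf)
    then show ?thesis
      using metric_proj_obtuse'[OF C metric_proj_in[OF C], of x y] metric_proj_obtuse'[OF C metric_proj_in[OF C], of y x]
      unfolding enorm_diff_sq[of ?u ?v n] ip_commute[of ?v ?u] by linarith
  qed
  also have "\<dots> \<le> edist n x y * enorm n ?d" by (rule ip_le)
  finally have "enorm n ?d * enorm n ?d \<le> edist n x y * enorm n ?d" by (simp add: power2_eq_square)
  then show ?thesis
    by (cases "enorm n ?d = 0") (auto dest!: enorm_pos simp: mult_le_cancel_right)
qed

lemma metric_proj_norm_le:
  assumes C: "C \<in> convex_class n"
  shows "(enorm n (metric_proj n C x))\<^sup>2 \<le> ip n x (metric_proj n C x)"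
    "enorm n (metric_proj n C x) \<le> enorm n x"
proof -
  let ?y = "metric_proj n C x"
  show *: "(enorm n ?y)\<^sup>2 \<le> ip n x ?y"
    using metric_proj_obtuse'[OF C convex_classD(3)[OF C], of x] by simp
  also have "\<dots> \<le> enorm n x * enorm n ?y" by (rule ip_le)
  finally have "enorm n ?y * enorm n ?y \<le> enorm n x * enorm n ?y" by (simp add: power2_eq_square)
  then show "enorm n ?y \<le> enorm n x"
    by (cases "enorm n ?y = 0") (auto dest!: enorm_pos simp: mult_le_cancel_right)
qed

text \<open>The properties of \<open>x \<mapsto> \<parallel>\<Pi>\<^sub>C x\<parallel>\<close> that the upper bound uses; \<open>A * e\<close> plays the role of
  the point \<open>\<Pi>\<^sub>C x0\<close> of \<open>C\<close>.\<close>
locale proj_profile =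
  fixes n :: nat and f :: "(nat \<Rightarrow> real) \<Rightarrow> real"
  assumes n: "1 \<le> n" and meas [measurable]: "f \<in> borel_measurable borel"
    and nonneg: "0 \<le> f x" and le_norm: "f x \<le> enorm n x"
    and lip: "f x - f y \<le> edist n x y"
    and support: "enorm n x0 = 1 \<Longrightarrow> 0 < f x0 \<Longrightarrow>
      \<exists>e. enorm n e = 1 \<and> (\<forall>i\<ge>n. e i = 0) \<and>
        (\<forall>x x'. enorm n x = 1 \<longrightarrow> enorm n x' = 1 \<longrightarrow>
          f x0 * ip n x e - f x * (f x0 + edist n x x') \<le> f x')"

text \<open>The support inequality combines the obtuse angle property at x, tested with the
  projection of x0, and the minimality at x', tested with the projection of x. The second costs f
  x^2/2, which the term - f x^2 of the first absorbs.\<close>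

lemma proj_profile_metric_proj:
  assumes n: "1 \<le> n" and C: "C \<in> convex_class n"
  shows "proj_profile n (\<lambda>x. enorm n (metric_proj n C x))"
proof
  let ?P = "metric_proj n C"
  let ?f = "\<lambda>x. enorm n (?P x)"
  show "1 \<le> n" by fact
  show "0 \<le> ?f x" for x by (rule enorm_nonneg)
  show "?f x \<le> enorm n x" for x by (rule metric_proj_norm_le[OF C])
  show lip: "?f x - ?f y \<le> edist n x y" for x y
    using enorm_triangle_diff[of "?P x" n "?P y"] metric_proj_nonexpansive[OF C, of x y] by simp
  have "isCont ?f x" for x
  proof -
    have "continuous_on UNIV (\<lambda>y. edist n y x)" by (intro continuous_intros)
    then have "isCont (\<lambda>y. edist n y x) x" by (simp add: continuous_on_eq_continuous_at)
    then have lim: "((\<lambda>y. edist n y x) \<longlongrightarrow> 0) (at x)" unfolding isCont_def by (simp add: enorm_zero)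
    have "((\<lambda>y. ?f y - ?f x) \<longlongrightarrow> 0) (at x)"
    proof (rule Lim_null_comparison[OF _ lim])
      show "\<forall>\<^sub>F y in at x. norm (?f y - ?f x) \<le> edist n y x"
      proof (intro always_eventually allI)
        fix y show "norm (?f y - ?f x) \<le> edist n y x"
          using lip[of x y] lip[of y x] enorm_minus_commute[of x y n] by (simp add: abs_le_iff)
      qed
    qed
    then show ?thesis unfolding isCont_def by (rule LIM_zero_cancel)
  qed
  then have "continuous_on UNIV ?f" by (simp add: continuous_at_imp_continuous_on)
  then show "?f \<in> borel_measurable borel" by (rule borel_measurable_continuous_onI)
  fix x0 assume x0: "enorm n x0 = 1" "0 < ?f x0"
  define e where "e = dir n (?P x0)"
  have Pe: "?P x0 i = ?f x0 * e i" for i using x0 by (simp add: e_def dir_def)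
  have "enorm n e = 1" unfolding e_def using x0 by (intro enorm_dir) auto
  moreover have "\<forall>i\<ge>n. e i = 0" using convex_classD(2)[OF C metric_proj_in[OF C]] by (simp add: e_def dir_def)
  moreover have "?f x0 * ip n x e - ?f x * (?f x0 + edist n x x') \<le> ?f x'" if x: "enorm n x = 1" "enorm n x' = 1" for x x'
  proof -
    have "ip n x (?P x0) = (\<Sum>i<n. ?f x0 * (x i * e i))"
    proof (intro sum.cong refl)
      fix i show "x i * ?P x0 i = ?f x0 * (x i * e i)" by (subst Pe) (rule mult.left_commute)
    qed
    then have "ip n x (?P x0) = ?f x0 * ip n x e" by (simp only: sum_distrib_left)
    then have 1: "?f x0 * ip n x e \<le> ip n x (?P x) + ip n (?P x) (?P x0) - (?f x)\<^sup>2"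
      using metric_proj_obtuse'[OF C metric_proj_in[OF C, of x0], of x] by simp
    have 2: "(?f x')\<^sup>2 - 2 * ip n x' (?P x') \<le> (?f x)\<^sup>2 - 2 * ip n x' (?P x)"
      by (intro metric_proj_sq_le C metric_proj_in)
    have 3: "ip n x' (?P x') \<le> 1 * ?f x'" using ip_le[of x' "?P x'" n] x by simp
    have 4: "ip n (?P x) (?P x0) \<le> ?f x * ?f x0" by (rule ip_le)
    have 5: "ip n x (?P x) - ip n x' (?P x) \<le> edist n x x' * ?f x"
      using ip_le[of "\<lambda>i. x i - x' i" "?P x" n] by (simp only: ip_diff_left)
    have 6: "?f x * (?f x0 + edist n x x') = ?f x * ?f x0 + edist n x x' * ?f x"
      by (simp add: algebra_simps)
    show ?thesis using 1 2 3 4 5 zero_le_power2[of "?f x"] zero_le_power2[of "?f x'"] unfolding 6 by linarith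
  qed
  ultimately show "\<exists>e. enorm n e = 1 \<and> (\<forall>i\<ge>n. e i = 0) \<and>
        (\<forall>x x'. enorm n x = 1 \<longrightarrow> enorm n x' = 1 \<longrightarrow>
          ?f x0 * ip n x e - ?f x * (?f x0 + edist n x x') \<le> ?f x')" by blast
qed

section \<open>Upper bound\<close>

lemma exp_9_le: "exp (- 9) / 4 \<le> (1 / 4 :: real)"
  using exp_le_cancel_iff[of "- 9 :: real" 0] by (simp del: exp_le_cancel_iff)

lemma exp_9_powr_le: "1 \<le> p \<Longrightarrow> (exp (- 9) / 4) powr p \<le> exp (- 9) / (4 :: real)"
  using powr_mono'[of 1 p "exp (- 9) / 4"] exp_9_le by simp

lemma powr_mono_base1:
  fixes C t :: real
  assumes "1 \<le> C" "t \<le> 1" shows "C powr t \<le> C"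
  using powr_mono[of t 1 C] assms by simp

text \<open>The reciprocal of 1/4 * (exp (- 9)/4) * exp (- 3/2): the first factor is the loss in the
  value of f on a cap, the others bound the p-th root of the measure of the cap.\<close>

definition sup_const :: real where "sup_const = 16 * exp (21 / 2)"

lemma sup_const_ge: "1 \<le> sup_const" "1024 \<le> sup_const"
proof -
  have "(2 :: real) ^ 10 \<le> exp (real 10)" by (rule two_power_le_exp)
  also have "\<dots> \<le> exp (21 / 2 :: real)" by simp
  finally show "1024 \<le> sup_const" by (simp add: sup_const_def)
  then show "1 \<le> sup_const" by simp
qed

section \<open>Moments of the projection norm, supremum bound and interpolation\<close>

context proj_profile
begin

abbreviation S where "S \<equiv> sphere_measure n"

definition mom :: "real \<Rightarrow> real" where "mom r = (LINT x|S. f x powr r)"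
definition Lp :: "real \<Rightarrow> real" where "Lp r = mom r powr (1 / r)"

sublocale S: prob_space "sphere_measure n" by (rule prob_space_sphere_measure)

lemma AE_unit: "AE x in S. enorm n x = 1"
  using AE_sphere_measure[OF n] by eventually_elim simp

lemma f_le_1: "enorm n x = 1 \<Longrightarrow> f x \<le> 1"
  using le_norm[of x] by simp

lemma integrable_powr: "0 \<le> r \<Longrightarrow> integrable S (\<lambda>x. f x powr r)"
proof (rule S.integrable_const_bound[where B = 1])
  assume r: "0 \<le> r"
  show "AE x in S. norm (f x powr r) \<le> 1"
    using AE_unit by eventually_elim (use r in \<open>auto simp: powr_le1 nonneg f_le_1\<close>)
qed simp

lemma mom_nonneg: "0 \<le> mom r" unfolding mom_def by (intro integral_nonneg_AE) simp

lemma Lp_nonneg: "0 \<le> Lp r" unfolding Lp_def by simp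

lemma Lp_powr: "0 < r \<Longrightarrow> Lp r powr r = mom r"
  unfolding Lp_def using mom_nonneg[of r] by (simp add: powr_powr)

lemma nn_integral_powr: "0 \<le> r \<Longrightarrow> (\<integral>\<^sup>+x. ennreal (f x powr r) \<partial>S) = ennreal (mom r)"
  unfolding mom_def by (intro nn_integral_eq_integral integrable_powr) auto

lemma mom_ge:
  assumes E: "E \<in> sets borel" and a: "0 \<le> a" "0 < p" and le: "\<And>x. enorm n x = 1 \<Longrightarrow> x \<in> E \<Longrightarrow> a \<le> f x"
  shows "a powr p * S.prob E \<le> mom p"
proof -
  have "a powr p * S.prob E = (LINT x|S. a powr p * indicator E x)" using E by simp
  also have "\<dots> \<le> mom p" unfolding mom_def
  proof (rule integral_mono_AE)
    show "integrable S (\<lambda>x. a powr p * indicator E x)" using E by (simp add: less_top[symmetric])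
    show "integrable S (\<lambda>x. f x powr p)" using a by (intro integrable_powr) auto
    show "AE x in S. a powr p * indicator E x \<le> f x powr p"
      using AE_unit by eventually_elim (use a le in \<open>auto simp: indicator_def intro!: powr_mono2\<close>)
  qed
  finally show ?thesis .
qed

lemma Lp_ge:
  assumes E: "E \<in> sets borel" and a: "0 \<le> a" and p: "1 \<le> p" and le: "\<And>x. enorm n x = 1 \<Longrightarrow> x \<in> E \<Longrightarrow> a \<le> f x"
    and k: "0 \<le> k" "k powr p \<le> S.prob E"
  shows "a * k \<le> Lp p"
proof -
  have "(a * k) powr p = a powr p * k powr p" using a k by (simp add: powr_mult)
  also have "\<dots> \<le> a powr p * S.prob E" using k by (intro mult_left_mono) auto
  also have "\<dots> \<le> mom p" using p by (intro mom_ge E a le) auto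
  finally have "((a * k) powr p) powr (1 / p) \<le> Lp p" unfolding Lp_def using p by (intro powr_mono2) auto
  then show ?thesis using a k p by (simp add: powr_powr)
qed

text \<open>At height of order sqrt ((p \<and> n)/n) the measure of a cap is still at least a
  constant to the power p, so passing to the \<open>L\<^sup>p\<close> norm costs a constant
  only.\<close>

lemma sup_bound:
  assumes x0: "enorm n x0 = 1" and p: "1 \<le> p"
  shows "f x0 \<le> sup_const * sqrt (real n / min p (real n)) * Lp p"
proof (cases "f x0 = 0")
  case True
  then show ?thesis using Lp_nonneg sup_const_ge p n by simp
next
  case False
  then have A: "0 < f x0" "f x0 \<le> 1" using nonneg[of x0] f_le_1[OF x0] by auto
  obtain e where e: "enorm n e = 1" "\<And>i. i \<ge> n \<Longrightarrow> e i = 0"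
    and sup: "\<And>x x'. enorm n x = 1 \<Longrightarrow> enorm n x' = 1 \<Longrightarrow> f x0 * ip n x e - f x * (f x0 + edist n x x') \<le> f x'"
    using support[OF x0 A(1)] by blast
  define t where "t = sqrt (min p (real n) / real n)"
  have t: "0 < t" "t \<le> 1" "real n * t\<^sup>2 \<le> p" using p n by (auto simp: t_def divide_le_eq_1)
  define k where "k = exp (- 21 / 2) / (4::real)"
  have h: "f x0 * t / 4 * k \<le> Lp p"
  proof (rule Lp_ge[where E = "{x. t / 2 \<le> ip n x e}"])
    show "{x. t / 2 \<le> ip n x e} \<in> sets borel" by measurable
    show "0 \<le> f x0 * t / 4" "0 \<le> k" using A t by (auto simp: k_def)
    fix x assume x: "enorm n x = 1" "x \<in> {x. t / 2 \<le> ip n x e}"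
    have "f x0 * (t / 2) \<le> f x0 * ip n x e" using x A by (intro mult_left_mono) auto
    also have "\<dots> \<le> f x * (1 + f x0)" using sup[OF x(1) x(1)] by (simp add: enorm_zero algebra_simps)
    also have "\<dots> \<le> f x * 2" using A nonneg by (intro mult_left_mono) auto
    finally show "f x0 * t / 4 \<le> f x" by simp
  next
    have "k powr p = (exp (- 9) / 4) powr p * exp (- (3/2) * p)"
    proof -
      have "k = (exp (- 9) / 4) * exp (- (3/2))" by (simp add: k_def exp_add[symmetric])
      then show ?thesis by (simp only:) (subst powr_mult, auto simp: powr_def)
    qed
    also have "\<dots> \<le> (exp (- 9) / 4) * exp (- (3/2 * real n * t\<^sup>2))"
    proof (intro mult_mono)
      show "(exp (- 9) / 4) powr p \<le> exp (- 9) / (4::real)" using p by (rule exp_9_powr_le)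
    qed (use t in auto)
    also have "\<dots> \<le> S.prob {x. t / 2 \<le> ip n x e}" by (intro sphere_lower_tail e n) (use t in auto)
    finally show "k powr p \<le> S.prob {x. t / 2 \<le> ip n x e}" .
  qed (use p in auto)
  have "k / 4 = 1 / sup_const" by (simp add: k_def sup_const_def exp_minus inverse_eq_divide)
  then have "f x0 * t / 4 * k = f x0 * t / sup_const" by (simp add: field_simps)
  with h have "f x0 * t \<le> sup_const * Lp p" using sup_const_ge by (simp add: divide_le_eq mult.commute)
  then have "f x0 \<le> sup_const * Lp p / t" using t by (simp add: pos_le_divide_eq)
  moreover have "sqrt (real n / min p (real n)) = 1 / t" by (simp add: t_def real_sqrt_divide)
  ultimately show ?thesis by simp
qed

lemma Lp_interpolate:
  assumes pq: "1 \<le> p" "p < q" and B: "1 \<le> C" "0 \<le> R" "\<And>x. enorm n x = 1 \<Longrightarrow> f x \<le> C * R * Lp p"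
  shows "Lp q \<le> C * R powr (1 - p / q) * Lp p"
proof -
  let ?B = "C * R * Lp p"
  have B0: "0 \<le> ?B" using B Lp_nonneg by simp
  have "mom q \<le> (LINT x|S. ?B powr (q - p) * f x powr p)"
    unfolding mom_def
  proof (rule integral_mono_AE)
    show "AE x in S. f x powr q \<le> ?B powr (q - p) * f x powr p"
      using AE_unit
    proof eventually_elim
      case (elim x)
      have "f x powr q = f x powr (q - p) * f x powr p" by (simp add: powr_add[symmetric])
      also have "\<dots> \<le> ?B powr (q - p) * f x powr p"
        using B(3)[OF elim] pq nonneg by (intro mult_right_mono powr_mono2) auto
      finally show ?case .
    qed
  qed (use pq in \<open>auto intro: integrable_powr\<close>)
  also have "\<dots> = ?B powr (q - p) * Lp p powr p"
    using pq by (simp add: mom_def[symmetric] Lp_powr)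
  finally have "Lp q \<le> (?B powr (q - p) * Lp p powr p) powr (1 / q)"
    unfolding Lp_def[of q] using pq mom_nonneg by (intro powr_mono2) auto
  also have "\<dots> = ?B powr ((q - p) / q) * Lp p powr (p / q)"
    using B0 Lp_nonneg by (simp add: powr_mult powr_powr)
  also have "(q - p) / q = 1 - p / q" using pq by (simp add: field_simps)
  also have "?B powr (1 - p / q) = C powr (1 - p / q) * R powr (1 - p / q) * Lp p powr (1 - p / q)"
    using B Lp_nonneg by (simp add: powr_mult)
  also have "\<dots> * Lp p powr (p / q) = C powr (1 - p / q) * R powr (1 - p / q) * (Lp p powr (1 - p / q) * Lp p powr (p / q))"
    by (simp only: mult.assoc)
  also have "Lp p powr (1 - p / q) * Lp p powr (p / q) = Lp p" using Lp_nonneg by (simp add: powr_add[symmetric])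
  also have "C powr (1 - p / q) * R powr (1 - p / q) * Lp p \<le> C * R powr (1 - p / q) * Lp p"
    using pq B Lp_nonneg by (intro mult_right_mono powr_mono_base1) auto
  finally show ?thesis .
qed

end

text \<open>The range where the logarithm cannot be absorbed into the constant. Here q/n = exp (1 -
  L) is exponentially small, and L \<ge> 200 pays for all numerical factors.\<close>

locale upper_setting = proj_profile +
  fixes p q L :: real
  assumes pq: "1 \<le> p" "p < q" "q < real n" and L_def: "L = ln (exp 1 * (real n / q))" and L: "200 \<le> L"
    and Lp_pos: "0 < Lp p"
begin

definition R where "R = sqrt (real n / (p * L))"
abbreviation m where "m \<equiv> Lp p"

lemma basics: "q / real n = exp (1 - L)" "0 < L" "0 < p" "0 < q" "0 < real n" "200 \<le> real n" "0 < R" "R\<^sup>2 = real n / (p * L)"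
proof -
  show pos: "0 < L" "0 < p" "0 < q" "0 < real n" using L pq n by auto
  have "L = 1 + ln (real n / q)" using pos unfolding L_def by (subst ln_mult) auto
  then have "exp (1 - L) = exp (- ln (real n / q))" by simp
  also have "\<dots> = q / real n" using pos by (simp add: exp_minus)
  finally show qn: "q / real n = exp (1 - L)" ..
  then have "real n = q * exp (L - 1)" using pos by (simp add: exp_diff field_simps)
  moreover have "1 * (1 + (L - 1)) \<le> q * exp (L - 1)" using pq L exp_ge_add_one_self[of "L - 1"] by (intro mult_mono) auto
  ultimately have "L \<le> real n" by simp
  then show "200 \<le> real n" using L by linarith
  show "0 < R" "R\<^sup>2 = real n / (p * L)" using pos by (auto simp: R_def)
qed

text \<open>As p < q, R^2 is at least n/(q L) = exp (L - 1)/L. The bound exp (L/8)/4 is chosen to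
  match the Markov level used in \<open>sup_bound_small\<close>; R \<ge> 4 serves
  \<open>mom_bound_large\<close>.\<close>

lemma R_ge: "exp (L / 8) / 4 \<le> R" "4 \<le> R"
proof -
  note b = basics
  have "exp (L / 4) / 16 \<le> exp (L - 1) / L"
  proof -
    have "L \<le> 16 * (1 + (3 * L / 4 - 1))" using L by simp
    also have "\<dots> \<le> 16 * exp (3 * L / 4 - 1)" using exp_ge_add_one_self[of "3 * L / 4 - 1"] by (intro mult_left_mono) auto
    finally have "exp (L / 4) * L \<le> exp (L / 4) * (16 * exp (3 * L / 4 - 1))" by (intro mult_left_mono) auto
    also have "\<dots> = 16 * exp (L - 1)" by (simp add: exp_add[symmetric])
    finally show ?thesis using b by (simp add: field_simps)
  qed
  also have "exp (L - 1) = real n / q" using b(1) b(2-5) by (simp add: exp_diff field_simps)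
  also have "real n / q / L \<le> real n / p / L" using b pq by (intro divide_right_mono divide_left_mono) auto
  also have "\<dots> = R\<^sup>2" using b by simp
  finally have "exp (L / 4) / 16 \<le> R\<^sup>2" .
  moreover have "exp (L / 4) / 16 = (exp (L / 8) / 4)\<^sup>2" by (simp add: power_divide exp_double[symmetric])
  ultimately have "(exp (L / 8) / 4)\<^sup>2 \<le> R\<^sup>2" by simp
  then show 1: "exp (L / 8) / 4 \<le> R" by (rule power2_le_imp_le[OF _ less_imp_le[OF b(7)]])
  have "1 + L / 8 \<le> exp (L / 8)" by (rule exp_ge_add_one_self)
  then show "4 \<le> R" using 1 L by linarith
qed

lemma markov: "0 < a \<Longrightarrow> S.prob {x. a * m < f x} \<le> a powr (- p)"
proof -
  assume a: "0 < a"
  have "(a * m) powr p * S.prob {x. a * m < f x} \<le> mom p"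
    using a Lp_pos pq by (intro mom_ge) auto
  then have "(a powr p * S.prob {x. a * m < f x}) * m powr p \<le> 1 * m powr p"
    using a Lp_pos pq by (simp add: powr_mult Lp_powr mult_ac)
  then have "a powr p * S.prob {x. a * m < f x} \<le> 1" using Lp_pos by (simp only: mult_le_cancel_right_pos powr_gt_zero)
  then show ?thesis using a by (simp add: powr_minus field_simps)
qed

text \<open>If f x0 exceeds 32 K m, the shift argument applies and even yields the constant 64;
  otherwise \<open>R_ge\<close> compares K directly with R.\<close>

lemma sup_bound_small:
  assumes small: "m \<le> 23 * sqrt (p * L / real n) * exp ((1 - L) / 4)" and x0: "enorm n x0 = 1"
  shows "f x0 \<le> 1024 * R * m"
proof -
  note b = basics
  define A where "A = f x0"
  \<comment> \<open>With 12, the shift factor exp (3/2 n s^2) is exactly exp (p L/8).\<close>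
  define s where "s = sqrt (p * L / (12 * real n))"
  \<comment> \<open>K^(-p) cancels the shift factor exp (p L/8) and leaves at most 1/8.\<close>
  define K where "K = 8 * exp (L / 8)"
  have s0: "0 < s" "real n * s\<^sup>2 = p * L / 12" using b by (auto simp: s_def)
  have s12: "sqrt (p * L / real n) \<le> 4 * s" "s \<le> sqrt (p * L / real n)"
  proof -
    have "sqrt (p * L / real n) \<le> sqrt (16 * (p * L / (12 * real n)))" using b by (intro real_sqrt_le_mono) (simp add: field_simps)
    also have "\<dots> = 4 * s" by (simp only: real_sqrt_mult s_def) simp
    finally show "sqrt (p * L / real n) \<le> 4 * s" .
    show "s \<le> sqrt (p * L / real n)" unfolding s_def using b by (intro real_sqrt_le_mono divide_left_mono) auto
  qed
  have s1: "s \<le> 1"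
  proof -
    have "p * L / real n \<le> q * L / real n" using b pq by (intro divide_right_mono mult_right_mono) auto
    also have "\<dots> = exp (1 - L) * L" unfolding b(1)[symmetric] by simp
    also have "\<dots> \<le> exp (1 - L) * exp (L - 1)" using exp_ge_add_one_self[of "L - 1"] by (intro mult_left_mono) auto
    also have "\<dots> = 1" by (simp add: exp_add[symmetric])
    finally show ?thesis using s12(2) real_sqrt_le_1_iff by (meson order_trans)
  qed
  consider "A = 0" | "0 < A" "A / 32 < K * m" | "0 < A" "K * m \<le> A / 32" using nonneg[of x0] unfolding A_def by linarith
  then show ?thesis
  proof cases
    case 1 then show ?thesis using b Lp_pos by (simp add: A_def)
  next
    case 2
    then have "A \<le> 32 * (K * m)" by simp
    \<comment> \<open>1024 = 32 * 8 * 4, where the 4 is the one of \<open>R_ge\<close>.\<close>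
    also have "\<dots> = 1024 * (exp (L / 8) / 4) * m" by (simp add: K_def)
    also have "\<dots> \<le> 1024 * R * m" using R_ge Lp_pos by (intro mult_right_mono mult_left_mono) auto
    finally show ?thesis by (simp add: A_def)
  next
    case 3
    have A1: "A \<le> 1" using f_le_1[OF x0] by (simp add: A_def)
    \<comment> \<open>The threshold enters here: it supplies exp ((1 - L)/4) against the exp (L/8)
      in K, and the combined exponent is below -24 for L \<ge> 200. The factor is 736 = 8 * 23 *
      4.\<close>
    have Ks: "K * m \<le> s / 8"
    proof -
      have "K * m \<le> K * (23 * sqrt (p * L / real n) * exp ((1 - L) / 4))" using small by (intro mult_left_mono) (auto simp: K_def)
      also have "\<dots> \<le> K * (23 * (4 * s) * exp ((1 - L) / 4))" using s12 by (intro mult_left_mono mult_right_mono) (auto simp: K_def)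
      also have "\<dots> = 736 * s * exp (L / 8 + (1 - L) / 4)" by (simp add: K_def exp_add)
      also have "\<dots> \<le> 736 * s * exp (- 24)"
      proof (intro mult_left_mono)
        have "L / 8 + (1 - L) / 4 \<le> - 24" using L by (simp add: field_simps)
        then show "exp (L / 8 + (1 - L) / 4) \<le> exp (- 24)" by (simp only: exp_le_cancel_iff)
      qed (use s0 in auto)
      also have "\<dots> \<le> 736 * s * (1 / 2 ^ 24)"
      proof (intro mult_left_mono)
        show "exp (- 24) \<le> 1 / (2 :: real) ^ 24" using two_power_le_exp[of 24] by (simp add: exp_minus field_simps)
      qed (use s0 in auto)
      also have "\<dots> \<le> s / 8" using s0 by simp
      finally show ?thesis .
    qed
    obtain e where e: "enorm n e = 1" "\<And>i. i \<ge> n \<Longrightarrow> e i = 0"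
      and sup: "\<And>x x'. enorm n x = 1 \<Longrightarrow> enorm n x' = 1 \<Longrightarrow> A * ip n x e - f x * (A + edist n x x') \<le> f x'"
      using support[OF x0] 3 unfolding A_def by blast
    interpret B: prob_space "ball_measure n" by (rule prob_space_ball_measure)
    define bad where "bad = {x. K * m < f x}"
    have bm[measurable]: "bad \<in> sets borel" unfolding bad_def by measurable
    let ?T = "\<lambda>x. \<lambda>i. s * e i + 1 * x i"
    define slab where "slab = {x. 0 \<le> ip n x e \<and> ip n x e \<le> s}"
    define Bad where "Bad = {x. 0 \<le> ip n x e \<and> ip n x e \<le> s \<and> dir n (?T x) \<in> bad}"
    define tiny where "tiny = {x. enorm n x \<le> 1/2}"
    define Good where "Good = slab - Bad - tiny"
    have [measurable]: "slab \<in> sets borel" "Bad \<in> sets borel" "tiny \<in> sets borel" unfolding slab_def Bad_def tiny_def by measurable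
    have [measurable]: "Good \<in> sets borel" unfolding Good_def by measurable
    have "B.prob Bad \<le> exp (3 / 2 * real n * s\<^sup>2) * S.prob bad"
      unfolding Bad_def using s0 by (intro measure_shift_le e bm) auto
    also have "3 / 2 * real n * s\<^sup>2 = p * L / 8" using s0(2) by simp
    also have "S.prob bad \<le> K powr (- p)" unfolding bad_def by (intro markov) (simp add: K_def)
    also have "K powr (- p) = 8 powr (- p) * exp (- (p * L / 8))" by (simp add: K_def powr_mult exp_powr_real mult.commute[of L])
    also have "\<dots> \<le> 8 powr (- 1) * exp (- (p * L / 8))" using pq by (intro mult_right_mono powr_mono) auto
    finally have PB: "B.prob Bad \<le> 1 / 8" by (simp add: exp_minus powr_minus mult.assoc[symmetric])
    have "1/2 - exp (- (real n * s\<^sup>2 / 4)) \<le> B.prob slab"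
      unfolding slab_def using s0 by (intro ball_slab e) auto
    moreover have "exp (- (real n * s\<^sup>2 / 4)) \<le> 1 / 16"
    proof -
      have "200 \<le> p * L" using pq L mult_mono[of 1 p 200 L] by simp
      then have "exp (- (real n * s\<^sup>2 / 4)) \<le> exp (- 4)" using s0 by simp
      also have "\<dots> \<le> 1 / 16" using two_power_le_exp[of 4] by (simp add: exp_minus field_simps)
      finally show ?thesis .
    qed
    ultimately have PS: "7 / 16 \<le> B.prob slab" by linarith
    have "B.prob tiny \<le> (1/2) ^ n" unfolding tiny_def using n by (intro measure_small_ball) auto
    also have "\<dots> \<le> (1/2) ^ 4" using b by (intro power_decreasing) auto
    finally have PT: "B.prob tiny \<le> 1 / 16" by (simp add: power_divide)
    have "B.prob slab \<le> B.prob (Good \<union> (Bad \<union> tiny))" by (intro B.finite_measure_mono) (auto simp: Good_def)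
    also have "\<dots> \<le> B.prob Good + B.prob (Bad \<union> tiny)" by (rule measure_Un_le) auto
    also have "\<dots> \<le> B.prob Good + (B.prob Bad + B.prob tiny)" by (intro add_left_mono measure_Un_le) auto
    \<comment> \<open>7/16 - 1/8 - 1/16 = 1/4.\<close>
    finally have PG: "1 / 4 \<le> B.prob Good" using PB PS PT by linarith
    \<comment> \<open>The shifted direction takes the place of x in the support inequality and the
      unshifted one that of x'. The main term is A s/2. The error K m (A + 4 s) is at most A s/8 + A
      s/8, by K m \<le> s/8 for the first summand and K m \<le> A/32 for the second.\<close>
    have Gf: "A * s / 4 \<le> f (dir n x)" if x: "x \<in> Good" "enorm n x \<le> 1" for x
    proof -
      have xs: "0 \<le> ip n x e" "ip n x e \<le> s" "dir n (?T x) \<notin> bad" "1/2 < enorm n x"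
        using x by (auto simp: Good_def slab_def Bad_def tiny_def)
      have ee: "ip n e e = 1" using e enorm_sq[of e n] by simp
      have ipT: "ip n (?T x) e = s + ip n x e" using ee by (simp add: ip_add_left ip_scale_left)
      have T2: "enorm n (?T x) \<le> 2"
        using L2_set_triangle_ineq[of "\<lambda>i. s * e i" x "{..<n}"] x s0 s1 e by (simp add: enorm_scale)
      have Tx: "enorm n x \<le> enorm n (?T x)"
      proof (rule power2_le_imp_le)
        have "(enorm n (?T x))\<^sup>2 = s\<^sup>2 + 2 * (s * ip n x e) + (enorm n x)\<^sup>2"
          using enorm_add_sq[of "\<lambda>i. s * e i" x n] e
          by (simp add: enorm_scale ip_scale_left ip_commute[of e] del: sum_distrib_left)
        then show "(enorm n x)\<^sup>2 \<le> (enorm n (?T x))\<^sup>2" using xs s0 by simp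
      qed (rule enorm_nonneg)
      then have T: "1/2 \<le> enorm n (?T x)" "enorm n (?T x) \<noteq> 0" using xs by auto
      have "s / 2 \<le> ip n (?T x) e / enorm n (?T x)"
      proof -
        have "s / 2 * enorm n (?T x) \<le> s / 2 * 2" using T2 s0 by (intro mult_left_mono) auto
        then have "s / 2 * enorm n (?T x) \<le> ip n (?T x) e" using ipT xs by linarith
        moreover have "0 < enorm n (?T x)" using T by linarith
        ultimately show ?thesis by (simp only: pos_le_divide_eq)
      qed
      then have ipd: "s / 2 \<le> ip n (dir n (?T x)) e" by (simp only: ip_dir)
      have dd: "edist n (dir n (?T x)) (dir n x) \<le> 4 * s"
      proof -
        have "edist n (?T x) x = s" using e s0 by (simp add: enorm_scale)
        then show ?thesis using dir_dist[OF T(1), of x] xs by simp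
      qed
      have fT: "f (dir n (?T x)) \<le> K * m" using xs by (simp add: bad_def)
      have "f (dir n (?T x)) * (A + edist n (dir n (?T x)) (dir n x)) \<le> K * m * (A + 4 * s)"
        using fT dd 3 nonneg enorm_nonneg by (intro mult_mono add_left_mono) (auto intro: order_trans[OF nonneg])
      also have "\<dots> = K * m * A + K * m * (4 * s)" by (simp add: algebra_simps)
      also have "\<dots> \<le> s / 8 * A + A / 32 * (4 * s)" using Ks 3 s0 by (intro add_mono mult_right_mono) auto
      finally have 1: "f (dir n (?T x)) * (A + edist n (dir n (?T x)) (dir n x)) \<le> A * s / 4" by simp
      have 2: "A * (s / 2) \<le> A * ip n (dir n (?T x)) e" using ipd 3 by (intro mult_left_mono) auto
      have "A * ip n (dir n (?T x)) e - f (dir n (?T x)) * (A + edist n (dir n (?T x)) (dir n x)) \<le> f (dir n x)"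
        using T xs by (intro sup enorm_dir) auto
      then show ?thesis using 1 2 by (simp add: algebra_simps)
    qed
    have "A * s / 4 * (1/4) \<le> m"
    proof (rule Lp_ge[where E = "{x. A * s / 4 \<le> f x}"])
      have "(1/4) powr p \<le> (1/4 :: real) powr 1" using pq by (intro powr_mono') auto
      also have "\<dots> \<le> B.prob Good" using PG by simp
      also have "\<dots> \<le> B.prob {x. dir n x \<in> {x. A * s / 4 \<le> f x}}"
        using Gf by (intro measure_ball_measure_mono) auto
      also have "\<dots> = S.prob {x. A * s / 4 \<le> f x}" by (subst measure_sphere_measure) auto
      finally show "(1/4) powr p \<le> S.prob {x. A * s / 4 \<le> f x}" .
    qed (use pq 3 s0 in auto)
    then have "A * s \<le> 16 * m" by simp
    then have "A * (sqrt (p * L / real n) / 4) \<le> 16 * m" using s12(1) 3 mult_left_mono[of "sqrt (p * L / real n) / 4" s A] by linarith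
    moreover have "sqrt (p * L / real n) = 1 / R" by (simp add: R_def real_sqrt_divide real_sqrt_mult)
    ultimately have "A * (1 / R / 4) \<le> 16 * m" by simp
    then have "A \<le> 64 * (R * m)" using b(7) by (simp add: field_simps)
    also have "\<dots> \<le> 1024 * R * m" using b Lp_pos by simp
    finally show ?thesis by (simp add: A_def)
  qed
qed

text \<open>Split at the level T = R m. Below it, f^q is at most T^(q-p) f^p; above it,
  concentration applies. 146 = 1 + 145 adds these two contributions.\<close>

lemma mom_bound_large:
  assumes large: "23 * sqrt (p * L / real n) * exp ((1 - L) / 4) < m"
  shows "mom q \<le> 146 * (m powr q * R powr (q - p))"
proof -
  note b = basics
  define T where "T = R * m"
  \<comment> \<open>512 = 4 * 128: where f > T, the excess over 2 m is at least f/2.\<close>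
  define c where "c = real n / 512"
  have T0: "0 < T" using b Lp_pos by (simp add: T_def)
  have sq: "sqrt (p * L / real n) = 1 / R" by (simp add: R_def real_sqrt_divide real_sqrt_mult)
  \<comment> \<open>Multiplied by R, the threshold reads T > 23 (q/n)^(1/4). As 23^2 = 529 exceeds
    512, c T^2 is at least sqrt (q n).\<close>
  have "23 * exp ((1 - L) / 4) < T" using large b unfolding sq by (simp add: T_def field_simps)
  then have "(23 * exp ((1 - L) / 4))\<^sup>2 \<le> T\<^sup>2" by (intro power_mono) auto
  also have "(23 * exp ((1 - L) / 4))\<^sup>2 = 529 * exp ((1 - L) / 2)" by (simp add: power_mult_distrib exp_double[symmetric])
  also have "exp ((1 - L) / 2) = sqrt (q / real n)"
    unfolding b(1) by (rule real_sqrt_unique[symmetric]) (simp_all add: exp_double[symmetric])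
  finally have "real n * (529 * sqrt (q / real n)) \<le> real n * T\<^sup>2" using b by (intro mult_left_mono) auto
  moreover have nq: "real n * sqrt (q / real n) = sqrt (q * real n)"
    using b by (simp add: real_sqrt_divide real_sqrt_mult field_simps)
  moreover have "real n * (529 * sqrt (q / real n)) = 529 * (real n * sqrt (q / real n))" by simp
  moreover have "c * T\<^sup>2 = real n * T\<^sup>2 / 512" by (simp add: c_def)
  moreover have "0 \<le> sqrt (q * real n)" using b by simp
  ultimately have cT: "sqrt (q * real n) \<le> c * T\<^sup>2" by linarith
  have qq: "q \<le> sqrt (q * real n)" using b pq by (intro real_le_rsqrt) (simp add: power2_eq_square)
  have pR: "exp (- sqrt (q * real n)) \<le> R powr (- p)"
  proof -
    have "ln R = ln (R\<^sup>2) / 2" using b(7) ln_realpow[of R 2] by simp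
    also have "\<dots> \<le> ln (real n / p) / 2"
      using b L pq unfolding b(8) by (intro divide_right_mono ln_mono) (auto simp: field_simps)
    also have "ln (real n / p) = 2 * ln (sqrt (real n / p))" using b by (simp add: ln_sqrt)
    also have "2 * ln (sqrt (real n / p)) / 2 \<le> sqrt (real n / p)" using b ln_le_minus_one[of "sqrt (real n / p)"] by simp
    finally have "p * ln R \<le> p * sqrt (real n / p)" using b by (intro mult_left_mono) auto
    also have "\<dots> = sqrt (p * real n)" using b by (simp add: real_sqrt_divide real_sqrt_mult field_simps)
    also have "\<dots> \<le> sqrt (q * real n)" using pq by (intro real_sqrt_le_mono mult_right_mono) auto
    finally show ?thesis using b by (simp add: powr_def)
  qed
  \<comment> \<open>Markov's inequality lets 2 m play the part of the median, and R \<ge> 4 keeps it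
    below T/2.\<close>
  have "S.prob {x. 2 * m < f x} \<le> 2 powr (- p)" by (rule markov) simp
  also have "\<dots> \<le> 2 powr (- 1)" using pq by (intro powr_mono) auto
  finally have "S.prob {x. 2 * m < f x} \<le> 1/2" by (simp add: powr_minus)
  moreover have "S.prob {x. f x \<le> 2 * m} = 1 - S.prob {x. 2 * m < f x}"
    by (subst S.prob_compl[symmetric]) (auto simp: not_less Compl_eq intro!: arg_cong[where f = S.prob])
  ultimately have med: "1/2 \<le> S.prob {x. f x \<le> 2 * m}" by simp
  define u where "u x = max 0 (f x - 2 * m)" for x
  have conc: "(\<integral>\<^sup>+x. ennreal (exp (real n * (u x)\<^sup>2 / 128)) \<partial>S) \<le> ennreal 145"
    unfolding u_def using b Lp_pos by (intro sphere_concentration meas lip f_le_1 med) auto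
  have [measurable]: "u \<in> borel_measurable borel" unfolding u_def by measurable
  have pt: "f x powr q \<le> T powr (q - p) * f x powr p + T powr q * exp (- (c * T\<^sup>2)) * exp (real n * (u x)\<^sup>2 / 128)" for x
  proof (cases "f x \<le> T")
    case True
    have "f x powr q = f x powr (q - p) * f x powr p" by (simp add: powr_add[symmetric])
    also have "\<dots> \<le> T powr (q - p) * f x powr p" using True pq nonneg by (intro mult_right_mono powr_mono2) auto
    finally show ?thesis by (simp add: add_increasing2)
  next
    case False
    define r where "r = f x / T"
    have r: "1 < r" "f x = r * T" using False T0 by (auto simp: r_def)
    have "4 * m \<le> T" using R_ge Lp_pos by (simp add: T_def)
    then have "f x / 2 \<le> f x - 2 * m" using False by linarith
    then have "f x / 2 \<le> u x" by (simp only: u_def max.coboundedI2)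
    then have "(f x / 2)\<^sup>2 \<le> (u x)\<^sup>2" using nonneg[of x] by (intro power_mono) auto
    then have "real n * (f x / 2)\<^sup>2 \<le> real n * (u x)\<^sup>2" by (rule mult_left_mono) simp
    then have u: "c * (f x)\<^sup>2 \<le> real n * (u x)\<^sup>2 / 128" by (simp add: c_def power_divide)
    \<comment> \<open>Since q \<le> c T^2, the polynomial growth r^q is dominated by the Gaussian
      gain between the levels T and r T.\<close>
    have "q * ln r \<le> c * T\<^sup>2 * (r\<^sup>2 - 1)"
    proof -
      have "2 * ln r = ln (r\<^sup>2)" using r by (simp add: ln_realpow)
      also have "\<dots> \<le> r\<^sup>2 - 1" using r by (intro ln_le_minus_one) auto
      finally have "2 * ln r \<le> r\<^sup>2 - 1" .
      moreover have "0 \<le> ln r" using r by simp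
      ultimately have "ln r \<le> r\<^sup>2 - 1" by linarith
      then have "q * ln r \<le> q * (r\<^sup>2 - 1)" using b by (intro mult_left_mono) auto
      also have "\<dots> \<le> c * T\<^sup>2 * (r\<^sup>2 - 1)" using qq cT r one_le_power[of r 2] by (intro mult_right_mono) auto
      finally show ?thesis .
    qed
    then have "exp (q * ln r) \<le> exp (c * T\<^sup>2 * (r\<^sup>2 - 1))" by simp
    also have "c * T\<^sup>2 * (r\<^sup>2 - 1) = c * (f x)\<^sup>2 - c * T\<^sup>2" unfolding r(2) by (simp add: algebra_simps power_mult_distrib)
    also have "exp (c * (f x)\<^sup>2 - c * T\<^sup>2) \<le> exp (real n * (u x)\<^sup>2 / 128 - c * T\<^sup>2)" using u by simp
    also have "\<dots> = exp (- (c * T\<^sup>2)) * exp (real n * (u x)\<^sup>2 / 128)" by (simp add: exp_add[symmetric])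
    finally have "r powr q \<le> exp (- (c * T\<^sup>2)) * exp (real n * (u x)\<^sup>2 / 128)" using r by (simp add: powr_def)
    then have "T powr q * r powr q \<le> T powr q * (exp (- (c * T\<^sup>2)) * exp (real n * (u x)\<^sup>2 / 128))" by (rule mult_left_mono) simp
    then show ?thesis unfolding r(2) using r T0 by (simp add: powr_mult mult_ac add_increasing)
  qed
  have "ennreal (mom q) = (\<integral>\<^sup>+x. ennreal (f x powr q) \<partial>S)" using b by (simp add: nn_integral_powr)
  also have "\<dots> \<le> (\<integral>\<^sup>+x. ennreal (T powr (q - p)) * ennreal (f x powr p) + ennreal (T powr q * exp (- (c * T\<^sup>2))) * ennreal (exp (real n * (u x)\<^sup>2 / 128)) \<partial>S)"
    by (intro nn_integral_mono, simp only: ennreal_mult'[symmetric] ennreal_plus[symmetric] powr_ge_zero mult_nonneg_nonneg exp_ge_zero) (rule ennreal_leI, rule pt)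
  also have "\<dots> = ennreal (T powr (q - p)) * ennreal (mom p) + ennreal (T powr q * exp (- (c * T\<^sup>2))) * (\<integral>\<^sup>+x. ennreal (exp (real n * (u x)\<^sup>2 / 128)) \<partial>S)"
    using b by (subst nn_integral_add) (auto simp: nn_integral_cmult nn_integral_powr)
  also have "\<dots> \<le> ennreal (T powr (q - p)) * ennreal (mom p) + ennreal (T powr q * exp (- (c * T\<^sup>2))) * ennreal 145"
    by (intro add_left_mono mult_left_mono conc) auto
  also have "\<dots> = ennreal (T powr (q - p) * mom p + T powr q * exp (- (c * T\<^sup>2)) * 145)"
    using mom_nonneg by (simp add: ennreal_mult ennreal_plus)
  finally have "mom q \<le> T powr (q - p) * mom p + T powr q * exp (- (c * T\<^sup>2)) * 145"
    using mom_nonneg by (subst (asm) ennreal_le_iff) auto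
  also have "\<dots> \<le> T powr (q - p) * mom p + T powr q * R powr (- p) * 145"
    using cT pR by (intro add_left_mono mult_right_mono mult_left_mono) (auto intro: order_trans[rotated])
  also have "T powr (q - p) * mom p = m powr q * R powr (q - p)"
    using b(3,7) Lp_pos by (simp add: T_def powr_mult powr_diff Lp_powr[symmetric])
  also have "T powr q * R powr (- p) = m powr q * R powr (q - p)"
    using b Lp_pos by (simp add: T_def powr_mult powr_diff powr_minus field_simps)
  finally show ?thesis by simp
qed

lemma upper_small: "Lp q \<le> 1024 * R powr (1 - p / q) * m"
proof (cases "m \<le> 23 * sqrt (p * L / real n) * exp ((1 - L) / 4)")
  case True
  then show ?thesis using pq basics by (intro Lp_interpolate sup_bound_small) auto
next
  case False
  then have "mom q \<le> 146 * (m powr q * R powr (q - p))" by (intro mom_bound_large) simp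
  then have "Lp q \<le> (146 * (m powr q * R powr (q - p))) powr (1 / q)"
    unfolding Lp_def[of q] using basics mom_nonneg by (intro powr_mono2) auto
  also have "\<dots> = 146 powr (1 / q) * (m * R powr ((q - p) / q))"
    using basics Lp_pos by (simp add: powr_mult powr_powr)
  also have "(q - p) / q = 1 - p / q" using basics by (simp add: field_simps)
  also have "146 powr (1 / q) * (m * R powr (1 - p / q)) \<le> 1024 * (m * R powr (1 - p / q))"
  proof (intro mult_right_mono)
    have "(146 :: real) powr (1 / q) \<le> 146" using pq by (intro powr_mono_base1) auto
    then show "(146 :: real) powr (1 / q) \<le> 1024" by simp
  qed (use Lp_pos in auto)
  finally show ?thesis by (simp add: mult_ac)
qed

end

section \<open>Combining the ranges of q in the upper bound\<close>

context proj_profile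
begin

text \<open>For q \<ge> n the logarithm in the rate is 1, and for L < 200 its power is at most 200;
  both cases follow from interpolation with the supremum bound.\<close>

lemma upper_finite:
  assumes pq: "1 \<le> p" "p < q" and pos: "0 < Lp p"
  shows "Lp q \<le> 200 * sup_const * rate n (ereal p) (ereal q) * Lp p"
proof -
  have n0: "0 < real n" using n by simp
  have tau: "tau (ereal p) (ereal q) = (1 - p / q) / 2" using pq by (simp add: tau_def)
  have tau01: "0 \<le> 1 - p / q" "1 - p / q \<le> 1" using pq by (auto simp: field_simps)
  have tr: "trunc (ereal r) n = min r (real n)" for r by (simp add: trunc_def min_def)
  have root: "sqrt y powr (1 - p / q) = y powr ((1 - p / q) / 2)" if "0 \<le> y" for y :: real
    using that by (simp add: powr_half_sqrt[symmetric] powr_powr)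
  have gen: "Lp q \<le> sup_const * (real n / min p (real n)) powr ((1 - p / q) / 2) * Lp p"
    using Lp_interpolate[OF pq sup_const_ge(1) _ sup_bound[OF _ pq(1)]] pq n0 by (simp add: root)
  show ?thesis
  proof (cases "real n \<le> q")
    case True
    then have "rate n (ereal p) (ereal q) = (real n / min p (real n)) powr ((1 - p / q) / 2)"
      using n0 by (simp add: rate_def tau tr min_absorb2)
    then show ?thesis using gen sup_const_ge pos
      by (intro order_trans[OF gen]) (auto intro!: mult_right_mono)
  next
    case False
    then have qn: "q < real n" by simp
    define L where "L = ln (exp 1 * (real n / q))"
    have L1: "1 \<le> L"
    proof -
      have "L = 1 + ln (real n / q)" using n0 pq unfolding L_def by (subst ln_mult) auto
      moreover have "0 \<le> ln (real n / q)" using qn pq by (intro ln_ge_zero) auto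
      ultimately show ?thesis by simp
    qed
    have rate: "rate n (ereal p) (ereal q) = (real n / (p * L)) powr ((1 - p / q) / 2)"
      using qn pq by (simp add: rate_def tau tr L_def min_absorb1)
    show ?thesis
    proof (cases "200 \<le> L")
      case True
      interpret U: upper_setting n f p q L
        by unfold_locales (use pq qn L_def True pos in auto)
      have "Lp q \<le> 1024 * rate n (ereal p) (ereal q) * Lp p"
        using U.upper_small pq L1 n0 by (simp add: U.R_def root rate)
      also have "\<dots> \<le> 200 * sup_const * rate n (ereal p) (ereal q) * Lp p"
        using sup_const_ge pos by (intro mult_right_mono) (auto simp: rate)
      finally show ?thesis .
    next
      case False
      have "(real n / min p (real n)) powr ((1 - p / q) / 2) = (L * (real n / (p * L))) powr ((1 - p / q) / 2)"
        using qn pq L1 by (simp add: min_absorb1)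
      also have "\<dots> = L powr ((1 - p / q) / 2) * rate n (ereal p) (ereal q)"
        unfolding rate using L1 pq n0 by (subst powr_mult) auto
      also have "\<dots> \<le> 200 * rate n (ereal p) (ereal q)"
      proof (rule mult_right_mono)
        have "L powr ((1 - p / q) / 2) \<le> L" using L1 tau01 by (intro powr_mono_base1) auto
        then show "L powr ((1 - p / q) / 2) \<le> 200" using False by simp
      qed (simp add: rate)
      finally have "sup_const * (real n / min p (real n)) powr ((1 - p / q) / 2) * Lp p \<le> sup_const * (200 * rate n (ereal p) (ereal q)) * Lp p"
        using sup_const_ge pos by (intro mult_right_mono mult_left_mono) auto
      with gen show ?thesis by (simp add: mult_ac)
    qed
  qed
qed

lemma upper_infinite:
  assumes p: "1 \<le> p" and x: "enorm n x = 1"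
  shows "f x \<le> 200 * sup_const * rate n (ereal p) \<infinity> * Lp p"
proof -
  have rate: "rate n (ereal p) \<infinity> = sqrt (real n / min p (real n))"
    using n p by (simp add: rate_def trunc_def tau_def powr_half_sqrt min_def)
  have "sup_const * sqrt (real n / min p (real n)) * Lp p \<le> 200 * sup_const * sqrt (real n / min p (real n)) * Lp p"
    using sup_const_ge Lp_nonneg p n by (intro mult_right_mono) auto
  with sup_bound[OF x p] show ?thesis unfolding rate by (rule order_trans)
qed

end

section \<open>Lower bound\<close>

abbreviation proj_norm :: "nat \<Rightarrow> (nat \<Rightarrow> real) set \<Rightarrow> (nat \<Rightarrow> real) \<Rightarrow> real" where
  "proj_norm n C x \<equiv> enorm n (metric_proj n C x)"

abbreviation proj_Lp :: "nat \<Rightarrow> (nat \<Rightarrow> real) set \<Rightarrow> real \<Rightarrow> real" where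
  "proj_Lp n C \<equiv> proj_profile.Lp n (proj_norm n C)"

lemma Lp_norm_metric_proj:
  assumes n: "1 \<le> n" and C: "C \<in> convex_class n" and p: "0 < p"
  shows "Lp_norm n (sphere_measure n) (ereal p) (metric_proj n C) = ereal (proj_Lp n C p)"
proof -
  interpret P: proj_profile n "proj_norm n C" by (rule proj_profile_metric_proj[OF n C])
  show ?thesis
    using P.nn_integral_powr[of p] p P.mom_nonneg by (simp add: Lp_norm_def P.Lp_def)
qed

lemma Lp_norm_metric_proj_PInf_le:
  assumes n: "1 \<le> n" and C: "C \<in> convex_class n" and B: "\<And>x. enorm n x = 1 \<Longrightarrow> proj_norm n C x \<le> B"
  shows "Lp_norm n (sphere_measure n) \<infinity> (metric_proj n C) \<le> ereal B"
proof -
  interpret P: proj_profile n "proj_norm n C" by (rule proj_profile_metric_proj[OF n C])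
  have [measurable]: "proj_norm n C \<in> borel_measurable borel" by (rule P.meas)
  have "esssup P.S (\<lambda>x. ereal (proj_norm n C x)) \<le> ereal B"
  proof (rule esssup_I)
    show "AE x in P.S. ereal (proj_norm n C x) \<le> ereal B"
      using P.AE_unit by eventually_elim (simp add: B)
  qed measurable
  then show ?thesis by (simp add: Lp_norm_def)
qed

lemma A_star_upper:
  assumes n: "1 \<le> n" and pq: "1 \<le> p" "p < q"
  shows "A_star n p q (sphere_measure n) \<le> ereal (200 * sup_const * rate n p q)"
  unfolding A_star_def
proof (rule SUP_least)
  fix C assume "C \<in> {C \<in> convex_class n. C \<noteq> {\<lambda>_. 0} \<and> 0 < Lp_norm n (sphere_measure n) p (metric_proj n C)}"
  then have C: "C \<in> convex_class n" and pos: "0 < Lp_norm n (sphere_measure n) p (metric_proj n C)" by auto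
  interpret P: proj_profile n "proj_norm n C" by (rule proj_profile_metric_proj[OF n C])
  obtain r where r: "p = ereal r" "1 \<le> r" using pq by (cases p) auto
  have Lr: "Lp_norm n (sphere_measure n) p (metric_proj n C) = ereal (P.Lp r)"
    unfolding r(1) by (rule Lp_norm_metric_proj) (use n C r in auto)
  have pos': "0 < P.Lp r" using pos unfolding Lr by simp
  have "Lp_norm n (sphere_measure n) q (metric_proj n C) \<le> ereal (200 * sup_const * rate n p q * P.Lp r)"
  proof (cases q)
    case (real s)
    then have s: "r < s" using pq r by simp
    have "Lp_norm n (sphere_measure n) q (metric_proj n C) = ereal (P.Lp s)"
      unfolding real by (rule Lp_norm_metric_proj) (use n C r s in auto)
    then show ?thesis using P.upper_finite[OF r(2) s pos'] by (simp add: real r(1))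
  next
    case PInf
    show ?thesis unfolding PInf r(1)
      by (intro Lp_norm_metric_proj_PInf_le n C P.upper_infinite r)
  qed (use pq in auto)
  then have "Lp_norm n (sphere_measure n) q (metric_proj n C) \<le> ereal (P.Lp r) * ereal (200 * sup_const * rate n p q)"
    by (simp add: mult_ac)
  then show "Lp_norm n (sphere_measure n) q (metric_proj n C) / Lp_norm n (sphere_measure n) p (metric_proj n C) \<le> ereal (200 * sup_const * rate n p q)"
    unfolding Lr using pos' by (subst ereal_divide_le_pos) auto
qed

text \<open>The form in which a test body is used: k bounds the q-th root of the measure of E from
  below. For infinite q the condition on k is vacuous, and positive measure of E with k \<le> 1
  gives the same bound.\<close>

lemma A_star_lower:
  assumes n: "1 \<le> n" and C: "C \<in> convex_class n" and p: "1 \<le> p" and q: "ereal p < q"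
    and E: "E \<in> sets borel" and a: "0 < a" and fE: "\<And>x. enorm n x = 1 \<Longrightarrow> x \<in> E \<Longrightarrow> a \<le> proj_norm n C x"
    and k: "0 \<le> k" "k \<le> 1" and pE: "0 < measure (sphere_measure n) E"
    and kE: "\<And>r. q = ereal r \<Longrightarrow> k powr r \<le> measure (sphere_measure n) E"
    and D: "0 < D" "proj_Lp n C p \<le> D"
  shows "ereal (a * k / D) \<le> A_star n (ereal p) q (sphere_measure n)"
proof -
  interpret P: proj_profile n "proj_norm n C" by (rule proj_profile_metric_proj[OF n C])
  have [measurable]: "proj_norm n C \<in> borel_measurable borel" by (rule P.meas)
  \<comment> \<open>A crude bound showing that the denominator is positive; it takes k = P(E), as
    P(E)^p \<le> P(E).\<close>
  have "a * P.S.prob E \<le> P.Lp p"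
  proof (rule P.Lp_ge[OF E _ p fE])
    show "P.S.prob E powr p \<le> P.S.prob E"
      using powr_mono'[of 1 p "P.S.prob E"] p by simp
  qed (use a in auto)
  then have Lpos: "0 < P.Lp p" using a pE by (meson mult_pos_pos less_le_trans)
  have Lp: "Lp_norm n (sphere_measure n) (ereal p) (metric_proj n C) = ereal (P.Lp p)"
    by (rule Lp_norm_metric_proj) (use n C p in auto)
  have ne: "C \<noteq> {\<lambda>_. 0}"
  proof
    assume "C = {\<lambda>_. 0}"
    then have "metric_proj n C x = (\<lambda>_. 0)" for x using metric_proj_in[OF C, of x] by simp
    then have "P.mom p = 0" unfolding P.mom_def by (simp add: enorm_zero)
    then show False using Lpos by (simp add: P.Lp_def)
  qed
  have "ereal (a * k) \<le> Lp_norm n (sphere_measure n) q (metric_proj n C)"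
  proof (cases q)
    case (real r)
    then have r: "p < r" using q by simp
    have "a * k \<le> P.Lp r" by (rule P.Lp_ge[OF E _ _ fE]) (use a k kE real r p in auto)
    then show ?thesis using r p unfolding real by (subst Lp_norm_metric_proj) (use n C in auto)
  next
    case PInf
    have "ereal a \<le> esssup P.S (\<lambda>x. ereal (proj_norm n C x))"
    proof (rule ccontr)
      assume "\<not> ?thesis"
      then have lt: "esssup P.S (\<lambda>x. ereal (proj_norm n C x)) < ereal a" by simp
      have "AE x in P.S. x \<notin> E"
        using P.AE_unit esssup_AE[of "\<lambda>x. ereal (proj_norm n C x)" P.S]
      proof eventually_elim
        case (elim x)
        show ?case
        proof
          assume "x \<in> E"
          then have "ereal a \<le> ereal (proj_norm n C x)" using fE elim by simp
          then show False using elim lt by (meson leD order_trans)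
        qed
      qed
      then have "P.S.prob E = 0" using E by (subst P.S.prob_eq_0) auto
      then show False using pE by simp
    qed
    moreover have "ereal (a * k) \<le> ereal a" using a k by (simp add: mult_left_le)
    ultimately have "ereal (a * k) \<le> esssup P.S (\<lambda>x. ereal (proj_norm n C x))" by (rule order_trans[rotated])
    then show ?thesis using PInf by (simp add: Lp_norm_def)
  qed (use q in auto)
  then have "ereal (a * k) / ereal (P.Lp p) \<le> Lp_norm n (sphere_measure n) q (metric_proj n C) / ereal (P.Lp p)"
    using Lpos by (intro ereal_divide_right_mono) auto
  also have "\<dots> \<le> A_star n (ereal p) q (sphere_measure n)"
    unfolding A_star_def Lp[symmetric] by (rule SUP_upper) (use C ne Lpos Lp in auto)
  finally have "ereal (a * k / P.Lp p) \<le> A_star n (ereal p) q (sphere_measure n)" using Lpos by simp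
  moreover have "a * k / D \<le> a * k / P.Lp p" using D Lpos a k by (intro divide_left_mono) auto
  ultimately show ?thesis by (meson ereal_less_eq(3) order_trans)
qed

lemma Rn_convex_class: "{x. \<forall>i\<ge>n. x i = 0} \<in> convex_class n"
  by (auto simp: convex_class_def closedin_Euclidean_space_iff topspace_Euclidean_space)
     (metis closedin_Euclidean_space closed_closedin euclidean_product_topology topspace_Euclidean_space)

text \<open>For the whole space the projection has norm 1 on the sphere. This settles all parameters
  for which the rate is bounded.\<close>

lemma A_star_ge_1:
  assumes n: "1 \<le> n" and p: "1 \<le> p" and q: "ereal p < q"
  shows "1 \<le> A_star n (ereal p) q (sphere_measure n)"
proof -
  let ?C = "{x :: nat \<Rightarrow> real. \<forall>i\<ge>n. x i = 0}"
  have C: "?C \<in> convex_class n" by (rule Rn_convex_class)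
  interpret P: proj_profile n "proj_norm n ?C" by (rule proj_profile_metric_proj[OF n C])
  have f: "proj_norm n ?C x = enorm n x" for x
  proof -
    have "enorm n (\<lambda>i. x i - metric_proj n ?C x i) \<le> edist n x (ext0 n x)"
      by (intro metric_proj_le C) auto
    also have "\<dots> = 0" unfolding enorm_eq_0 by simp
    finally have "enorm n (\<lambda>i. x i - metric_proj n ?C x i) = 0" using enorm_nonneg by (rule antisym)
    then have "\<forall>i<n. x i - metric_proj n ?C x i = 0" by (simp only: enorm_eq_0)
    then show ?thesis by (intro enorm_cong) simp
  qed
  have "P.mom p = (LINT x|P.S. 1)" unfolding P.mom_def
  proof (rule integral_cong_AE)
    show "AE x in P.S. proj_norm n ?C x powr p = 1" using P.AE_unit by eventually_elim (simp add: f)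
  qed (use P.meas in auto)
  moreover have one: "P.S.prob UNIV = 1" using P.S.prob_space by simp
  ultimately have Lp: "P.Lp p = 1" by (simp add: P.Lp_def)
  have "ereal (1 * 1 / 1) \<le> A_star n (ereal p) q (sphere_measure n)"
  proof (rule A_star_lower[OF n C p q, where E = UNIV])
    show "P.Lp p \<le> 1" by (simp only: Lp order_refl)
  qed (auto simp: f one)
  then show ?thesis by (simp add: one_ereal_def)
qed

section \<open>The test body: a ball with a spike\<close>

definition ax :: "nat \<Rightarrow> real" where "ax = (\<lambda>i. if i = 0 then 1 else 0)"

lemma ax: "1 \<le> n \<Longrightarrow> enorm n ax = 1" "1 \<le> n \<Longrightarrow> i \<ge> n \<Longrightarrow> ax i = 0" "1 \<le> n \<Longrightarrow> ip n x ax = x 0"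
  by (auto simp: ax_def L2_set_def if_distrib[of "\<lambda>x. x\<^sup>2"] if_distrib[of "\<lambda>y. _ * y"] sum.delta cong: if_cong)

text \<open>The convex hull of the ball of radius \<open>A\<theta>\<close> and the point \<open>A\<cdot>ax\<close>.\<close>
definition spike :: "nat \<Rightarrow> real \<Rightarrow> real \<Rightarrow> (nat \<Rightarrow> real) set" where
  "spike n A \<theta> = {x. (\<forall>i\<ge>n. x i = 0) \<and> (\<exists>t\<in>{0..1}. enorm n (\<lambda>i. x i - t * A * ax i) \<le> (1 - t) * (A * \<theta>))}"

text \<open>The witness t ranges over a compact interval, so the body is the image under projection
  of a compact set of pairs (x, t), hence closed. For convexity the witnesses are combined with the
  same weights as the points.\<close>

lemma spike_convex_class:
  assumes n: "1 \<le> n" and A: "0 < A" and \<theta>: "0 \<le> \<theta>"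
  shows "spike n A \<theta> \<in> convex_class n"
proof -
  define r where "r = A + A * \<theta>"
  define K where "K = {x :: nat \<Rightarrow> real. \<forall>i. x i \<in> {if i < n then - r else 0..if i < n then r else 0}}"
  define G where "G = {z :: (nat \<Rightarrow> real) \<times> real. enorm n (\<lambda>i. fst z i - snd z * A * ax i) \<le> (1 - snd z) * (A * \<theta>)}"
  have "closed G" unfolding G_def
    by (intro closed_Collect_le continuous_on_enorm continuous_intros
        continuous_on_compose2[OF continuous_on_coord[of UNIV] continuous_on_fst[OF continuous_on_id]]) auto
  moreover have "compact (K \<times> {0..1::real})" unfolding K_def by (intro compact_Times compact_box compact_Icc)
  ultimately have "compact ((K \<times> {0..1}) \<inter> G)" by (rule compact_Int_closed[rotated])
  then have "compact (fst ` ((K \<times> {0..1}) \<inter> G))" by (intro compact_continuous_image continuous_intros)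
  also have "fst ` ((K \<times> {0..1}) \<inter> G) = spike n A \<theta>"
  proof (intro equalityI subsetI)
    fix x assume "x \<in> fst ` ((K \<times> {0..1}) \<inter> G)"
    then obtain t where t: "x \<in> K" "t \<in> {0..1}" "(x, t) \<in> G" by auto
    have "x i = 0" if "i \<ge> n" for i
    proof -
      have "x i \<in> {if i < n then - r else 0..if i < n then r else 0}" using t(1) by (auto simp only: K_def)
      then show ?thesis using that by simp
    qed
    then show "x \<in> spike n A \<theta>" using t by (auto simp: spike_def G_def)
  next
    fix x assume x: "x \<in> spike n A \<theta>"
    then obtain t where t: "0 \<le> t" "t \<le> 1" "enorm n (\<lambda>i. x i - t * A * ax i) \<le> (1 - t) * (A * \<theta>)" by (auto simp: spike_def)
    have "enorm n x \<le> r"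
    proof -
      have "enorm n x \<le> enorm n (\<lambda>i. t * A * ax i) + enorm n (\<lambda>i. x i - t * A * ax i)" by (rule enorm_triangle_diff)
      also have "\<dots> \<le> t * A + (1 - t) * (A * \<theta>)" using t A n by (intro add_mono) (simp_all add: enorm_scale ax)
      also have "\<dots> \<le> 1 * A + 1 * (A * \<theta>)" using t A \<theta> by (intro add_mono mult_right_mono) auto
      finally show ?thesis by (simp add: r_def)
    qed
    then have "x i \<in> {if i < n then - r else 0..if i < n then r else 0}" for i
      using abs_le_enorm[of i n x] x by (auto simp: spike_def abs_le_iff)
    then have "(x, t) \<in> (K \<times> {0..1}) \<inter> G" using t by (simp add: K_def G_def)
    then show "x \<in> fst ` ((K \<times> {0..1}) \<inter> G)" by force
  qed
  finally have "closed (spike n A \<theta>)" by (rule compact_imp_closed)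
  moreover have "(\<lambda>i. u * x i + v * y i) \<in> spike n A \<theta>"
    if xy: "x \<in> spike n A \<theta>" "y \<in> spike n A \<theta>" and uv: "0 \<le> u" "0 \<le> v" "u + v = 1" for x y u v
  proof -
    obtain t where t: "0 \<le> t" "t \<le> 1" "enorm n (\<lambda>i. x i - t * A * ax i) \<le> (1 - t) * (A * \<theta>)" using xy by (auto simp: spike_def)
    obtain t' where t': "0 \<le> t'" "t' \<le> 1" "enorm n (\<lambda>i. y i - t' * A * ax i) \<le> (1 - t') * (A * \<theta>)" using xy by (auto simp: spike_def)
    let ?t = "u * t + v * t'"
    have "(\<lambda>i. u * x i + v * y i - ?t * A * ax i) = (\<lambda>i. u * (x i - t * A * ax i) + v * (y i - t' * A * ax i))"
      by (auto simp: algebra_simps)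
    then have "enorm n (\<lambda>i. u * x i + v * y i - ?t * A * ax i) \<le> enorm n (\<lambda>i. u * (x i - t * A * ax i)) + enorm n (\<lambda>i. v * (y i - t' * A * ax i))"
      by (simp only: L2_set_triangle_ineq)
    also have "\<dots> = u * enorm n (\<lambda>i. x i - t * A * ax i) + v * enorm n (\<lambda>i. y i - t' * A * ax i)"
      using uv by (simp only: enorm_scale abs_of_nonneg)
    also have "\<dots> \<le> u * ((1 - t) * (A * \<theta>)) + v * ((1 - t') * (A * \<theta>))" using uv t t' by (intro add_mono mult_left_mono) auto
    also have "\<dots> = ((u + v) - ?t) * (A * \<theta>)" by (simp add: algebra_simps)
    finally have "enorm n (\<lambda>i. u * x i + v * y i - ?t * A * ax i) \<le> (1 - ?t) * (A * \<theta>)" using uv by simp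
    moreover have "0 \<le> ?t" "?t \<le> 1" using uv t t' convex_bound_le[of t 1 t' u v] by auto
    ultimately show ?thesis using xy by (auto simp: spike_def intro!: bexI[of _ ?t])
  qed
  moreover have "(\<lambda>_. 0) \<in> spike n A \<theta>" using A \<theta> by (auto simp: spike_def enorm_zero intro!: bexI[of _ 0])
  moreover have "spike n A \<theta> \<subseteq> {x. \<forall>i\<ge>n. x i = 0}" by (auto simp: spike_def)
  ultimately show ?thesis by (auto simp: convex_class_def closedin_Euclidean_space_iff topspace_Euclidean_space)
qed

text \<open>Comparing the projection, of norm N, with the point A\<theta>x of the ball gives N^2
  \<le> (A\<theta>)^2 + 2 t A (x 0 - \<theta>). As t A \<le> N + A\<theta>, the factor N + A\<theta>
  cancels when x 0 > \<theta>. Comparing with the tip instead forces t \<ge> 1/2 as soon as x 0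
  \<ge> \<theta> + A, and then N is at least A/2 - A/4.\<close>

lemma spike_bounds:
  assumes n: "1 \<le> n" and A: "0 < A" and \<theta>: "0 \<le> \<theta>" "\<theta> \<le> 1/2" and x: "enorm n x = 1"
  shows "proj_norm n (spike n A \<theta>) x \<le> A * \<theta> + 2 * max 0 (x 0 - \<theta>)"
    and "proj_norm n (spike n A \<theta>) x \<le> A"
    and "\<theta> + A \<le> x 0 \<Longrightarrow> A / 4 \<le> proj_norm n (spike n A \<theta>) x"
proof -
  let ?C = "spike n A \<theta>"
  have C: "?C \<in> convex_class n" by (rule spike_convex_class[OF n A \<theta>(1)])
  define z where "z = metric_proj n ?C x"
  define N where "N = enorm n z"
  have N0: "0 \<le> N" by (simp add: N_def)
  have "z \<in> ?C" unfolding z_def by (rule metric_proj_in[OF C])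
  then obtain t where t: "0 \<le> t" "t \<le> 1" "enorm n (\<lambda>i. z i - t * A * ax i) \<le> (1 - t) * (A * \<theta>)" by (auto simp: spike_def)
  have nt: "enorm n (\<lambda>i. t * A * ax i) = t * A" using t A n by (simp add: enorm_scale ax)
  have up: "N \<le> t * A + (1 - t) * (A * \<theta>)"
    using enorm_triangle_diff[of z n "\<lambda>i. t * A * ax i"] t nt unfolding N_def by linarith
  have lo: "t * A \<le> N + (1 - t) * (A * \<theta>)"
    using enorm_triangle_diff[of "\<lambda>i. t * A * ax i" n z] enorm_minus_commute[of z "\<lambda>i. t * A * ax i" n] t nt
    unfolding N_def by linarith
  have ipz: "ip n x z \<le> t * A * x 0 + (1 - t) * (A * \<theta>)"
  proof -
    have "ip n x z = ip n (\<lambda>i. z i - t * A * ax i) x + t * A * ip n ax x"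
      by (simp add: algebra_simps sum.distrib sum_subtractf sum_distrib_left)
    also have "ip n ax x = x 0" using ax(3)[OF n] by (simp add: ip_commute[of ax])
    also have "ip n (\<lambda>i. z i - t * A * ax i) x \<le> (1 - t) * (A * \<theta>)"
      using ip_le[of "\<lambda>i. z i - t * A * ax i" x n] x t by simp
    finally show ?thesis by simp
  qed
  show "proj_norm n ?C x \<le> A"
  proof -
    have "N \<le> t * A + (1 - t) * (A * \<theta>)" by (rule up)
    also have "\<dots> \<le> t * A + (1 - t) * (A * 1)" using t A \<theta> by (intro add_mono mult_left_mono) auto
    also have "\<dots> = A" by (simp add: algebra_simps)
    finally show ?thesis by (simp add: N_def z_def)
  qed
  have nx: "enorm n (\<lambda>i. A * \<theta> * ext0 n x i) = A * \<theta>"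
  proof -
    have "enorm n (\<lambda>i. A * \<theta> * ext0 n x i) = A * \<theta> * enorm n (ext0 n x)" using A \<theta> by (simp add: enorm_scale)
    also have "enorm n (ext0 n x) = enorm n x" by (rule enorm_cong) simp
    finally show ?thesis using x by simp
  qed
  then have "(\<lambda>i. A * \<theta> * ext0 n x i) \<in> ?C" by (auto simp: spike_def intro!: bexI[of _ 0])
  then have "N\<^sup>2 - 2 * ip n x z \<le> (enorm n (\<lambda>i. A * \<theta> * ext0 n x i))\<^sup>2 - 2 * ip n x (\<lambda>i. A * \<theta> * ext0 n x i)"
    unfolding N_def z_def by (rule metric_proj_sq_le[OF C])
  also note nx
  also have "ip n x (\<lambda>i. A * \<theta> * ext0 n x i) = A * \<theta>"
  proof -
    have "ip n x (\<lambda>i. A * \<theta> * ext0 n x i) = (\<Sum>i<n. A * \<theta> * (x i * x i))" by (intro sum.cong) auto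
    also have "\<dots> = A * \<theta> * ip n x x" by (simp only: sum_distrib_left)
    finally show ?thesis using x enorm_sq[of x n] by simp
  qed
  finally have main: "N\<^sup>2 \<le> (A * \<theta>)\<^sup>2 + 2 * (t * A) * (x 0 - \<theta>)" using ipz by (simp add: algebra_simps)
  have "N \<le> A * \<theta> + 2 * max 0 (x 0 - \<theta>)"
  proof (cases "x 0 \<le> \<theta>")
    case True
    then have "t * A * (x 0 - \<theta>) \<le> 0" using t A by (intro mult_nonneg_nonpos) auto
    then have "N\<^sup>2 \<le> (A * \<theta>)\<^sup>2" using main by linarith
    moreover have "0 \<le> A * \<theta>" using A \<theta> by simp
    ultimately have "N \<le> A * \<theta>" by (rule power2_le_imp_le)
    then show ?thesis using True by simp
  next
    case False
    show ?thesis
    proof (rule ccontr)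
      assume "\<not> ?thesis"
      then have big: "2 * (x 0 - \<theta>) < N - A * \<theta>" using False by simp
      moreover have A\<theta>: "0 \<le> A * \<theta>" using A \<theta> by simp
      moreover have "0 < 2 * (x 0 - \<theta>)" using False by simp
      ultimately have pos: "0 < N + A * \<theta>" by linarith
      have "(1 - t) * (A * \<theta>) \<le> 1 * (A * \<theta>)" using t A\<theta> by (intro mult_right_mono) auto
      then have "t * A \<le> N + 1 * (A * \<theta>)" using lo by linarith
      then have "2 * (t * A) * (x 0 - \<theta>) \<le> 2 * (N + A * \<theta>) * (x 0 - \<theta>)" using False by (intro mult_right_mono) simp_all
      also have "\<dots> = (N + A * \<theta>) * (2 * (x 0 - \<theta>))" by (simp add: algebra_simps)
      also have "\<dots> < (N + A * \<theta>) * (N - A * \<theta>)" using big pos by (rule mult_strict_left_mono)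
      also have "\<dots> = N\<^sup>2 - (A * \<theta>)\<^sup>2" by (simp add: power2_eq_square algebra_simps)
      finally show False using main by simp
    qed
  qed
  then show "proj_norm n ?C x \<le> A * \<theta> + 2 * max 0 (x 0 - \<theta>)" by (simp add: N_def z_def)
  assume s: "\<theta> + A \<le> x 0"
  have aux: "2 * d - 2 * w \<le> c" if "a - 2 * b \<le> c - 2 * d" "b \<le> w" "0 \<le> a" for a b c d w :: real
    using that by linarith
  have "(\<lambda>i. A * ax i) \<in> ?C" using n by (auto simp: spike_def enorm_zero ax intro!: bexI[of _ 1])
  then have "N\<^sup>2 - 2 * ip n x z \<le> (enorm n (\<lambda>i. A * ax i))\<^sup>2 - 2 * ip n x (\<lambda>i. A * ax i)"
    unfolding N_def z_def by (rule metric_proj_sq_le[OF C])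
  also have "enorm n (\<lambda>i. A * ax i) = A" using n A by (simp add: enorm_scale ax)
  also have "ip n x (\<lambda>i. A * ax i) = A * x 0"
    unfolding ip_commute[of x "\<lambda>i. A * ax i"] ip_scale_left using ax(3)[OF n, of x] by (simp only: ip_commute[of x ax])
  finally have "N\<^sup>2 - 2 * ip n x z \<le> A\<^sup>2 - 2 * (A * x 0)" .
  then have "2 * (A * x 0) - 2 * (t * A * x 0 + (1 - t) * (A * \<theta>)) \<le> A\<^sup>2"
    using ipz zero_le_power2[of N] by (rule aux)
  moreover have "A * (2 * ((1 - t) * (x 0 - \<theta>))) = 2 * (A * x 0) - 2 * (t * A * x 0 + (1 - t) * (A * \<theta>))"
    by (simp add: algebra_simps)
  ultimately have "A * (2 * ((1 - t) * (x 0 - \<theta>))) \<le> A * A" by (simp only: power2_eq_square)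
  then have "2 * ((1 - t) * (x 0 - \<theta>)) \<le> A" using A by (simp only: mult_le_cancel_left_pos)
  moreover have "(1 - t) * A \<le> (1 - t) * (x 0 - \<theta>)" using s t by (intro mult_left_mono) auto
  moreover have "2 * u \<le> v" if "2 * w \<le> v" "u \<le> w" for u v w :: real using that by linarith
  ultimately have "2 * ((1 - t) * A) \<le> A" by blast
  then have "(2 * (1 - t)) * A \<le> 1 * A" by (simp only: mult.assoc mult_1_left)
  then have "2 * (1 - t) \<le> 1" using A by (simp only: mult_le_cancel_right_pos)
  then have t2: "1/2 \<le> t" by simp
  have "1/2 * A \<le> t * A" using t2 A by (intro mult_right_mono) auto
  moreover have "(1 - t) * (A * \<theta>) \<le> 1/2 * (A * (1/2))" using t2 t A \<theta> by (intro mult_mono mult_left_mono) auto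
  ultimately show "A / 4 \<le> proj_norm n ?C x" using lo by (simp add: N_def z_def)
qed

section \<open>Moment bounds, and the spike for large and for small q\<close>

lemma powr_add_le:
  fixes a b p :: real
  assumes "0 \<le> a" "0 \<le> b" "0 \<le> p"
  shows "(a + b) powr p \<le> 2 powr p * (a powr p + b powr p)"
proof -
  have "(a + b) powr p \<le> (2 * max a b) powr p" using assms by (intro powr_mono2) auto
  also have "\<dots> = 2 powr p * max a b powr p" using assms by (simp add: powr_mult)
  also have "\<dots> \<le> 2 powr p * (a powr p + b powr p)" by (intro mult_left_mono) (auto simp: max_def)
  finally show ?thesis .
qed

lemma (in proj_profile) Lp_le:
  assumes [measurable]: "h \<in> borel_measurable borel" and p: "1 \<le> p" and D: "0 \<le> D"
    and le: "\<And>x. enorm n x = 1 \<Longrightarrow> ennreal (f x powr p) \<le> h x"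
    and int: "integral\<^sup>N S h \<le> ennreal (D powr p)"
  shows "Lp p \<le> D"
proof -
  have "ennreal (mom p) = (\<integral>\<^sup>+x. ennreal (f x powr p) \<partial>S)" using p by (simp add: nn_integral_powr)
  also have "\<dots> \<le> integral\<^sup>N S h"
    by (rule nn_integral_mono_AE) (use AE_unit in eventually_elim, rule le)
  also note int
  finally have "mom p \<le> D powr p" by (simp add: ennreal_le_iff)
  then have "Lp p \<le> (D powr p) powr (1 / p)" unfolding Lp_def using p mom_nonneg by (intro powr_mono2) auto
  then show ?thesis using p D by (simp add: powr_powr)
qed

text \<open>With v = N u^2/(8 p) this is the p-th power of sqrt v \<le> exp v. It reduces the p-th
  moment to \<open>sphere_exp_moment\<close> with the right dependence on p.\<close>

lemma powr_le_exp_sq: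
  fixes u p N :: real
  assumes "0 \<le> u" "1 \<le> p" "0 < N"
  shows "u powr p \<le> sqrt (8 * p / N) powr p * exp (N * u\<^sup>2 / 8)"
proof -
  define v where "v = N * u\<^sup>2 / (8 * p)"
  have v: "0 \<le> v" using assms by (simp add: v_def)
  have "u\<^sup>2 = 8 * p / N * v" using assms by (simp add: v_def)
  then have "u = sqrt (8 * p / N * v)" using assms(1) real_sqrt_unique by metis
  then have u: "u = sqrt (8 * p / N) * sqrt v" by (simp only: real_sqrt_mult)
  have "sqrt v \<le> exp v"
  proof (rule real_le_lsqrt)
    have "v \<le> exp v" using exp_ge_add_one_self[of v] by linarith
    also have "\<dots> \<le> exp v * exp v" using v by simp
    finally show "v \<le> (exp v)\<^sup>2" by (simp add: power2_eq_square)
  qed (use v in auto)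
  then have "sqrt v powr p \<le> exp v powr p" using assms v by (intro powr_mono2) auto
  also have "\<dots> = exp (N * u\<^sup>2 / 8)" using assms by (simp add: exp_powr_real v_def)
  finally have "sqrt (8 * p / N) powr p * sqrt v powr p \<le> sqrt (8 * p / N) powr p * exp (N * u\<^sup>2 / 8)" by (rule mult_left_mono) simp
  moreover have "u powr p = sqrt (8 * p / N) powr p * sqrt v powr p"
    by (subst u) (use assms v in \<open>simp add: powr_mult\<close>)
  ultimately show ?thesis by simp
qed

text \<open>5376 = 4 * 672 * 2, from the value A/4 on the cap, the bound 672 A\<theta> on the
  \<open>L\<^sup>p\<close> norm, and the 2 in \<theta>.\<close>

definition lower_const :: real where "lower_const = exp (- 9) / 4 * exp (- (3/8)) / 5376"

lemma lower_const: "0 < lower_const" "lower_const \<le> 1 / 80"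
proof -
  have "exp (- 9) / 4 * exp (- (3/8)) \<le> 1 / 4 * (1 :: real)" by (rule mult_mono[OF exp_9_le]) auto
  then show "lower_const \<le> 1 / 80" by (simp add: lower_const_def)
qed (simp add: lower_const_def)

text \<open>Q is q \<and> n in the application. The result has exponent 1/2, which is at least
  \<tau>, so it is at least as strong as the rate.\<close>

lemma lower_large_q:
  fixes p Q L :: real
  assumes n: "1 \<le> n" and p: "1 \<le> p" and q: "ereal p < q" and Q: "Q \<le> real n" "ereal Q \<le> q"
    and L: "L = ln (exp 1 * (real n / Q))" "256 * (p * L) \<le> Q" and L1: "1 \<le> L"
  shows "ereal (lower_const * sqrt (real n / (p * L))) \<le> A_star n (ereal p) q (sphere_measure n)"
proof -
  have n0: "0 < real n" using n by simp
  have pL: "1 \<le> p * L" using mult_mono[of 1 p 1 L] p L1 by simp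
  have Q0: "256 \<le> Q" using pL L(2) by linarith
  \<comment> \<open>The cap at height 2 A has measure at least a constant times exp (- 3/8 Q), so
    its q-th root is bounded below because Q \<le> q.\<close>
  define A where "A = sqrt (Q / real n) / 8"
  \<comment> \<open>Makes exp (- n \<theta>^2/8) equal to exp (- p L/2). The assumption with 256
    amounts to \<theta> \<le> A, so that height 2 A is above \<theta> + A.\<close>
  define \<theta> where "\<theta> = 2 * sqrt (p * L / real n)"
  define k where "k = exp (- 9) / 4 * exp (- (3/8) :: real)"
  have k: "0 < k" "k \<le> 1"
  proof -
    have "exp (- 9) / 4 * exp (- (3/8)) \<le> 1 / 4 * (1 :: real)" by (rule mult_mono[OF exp_9_le]) auto
    then show "k \<le> 1" by (simp add: k_def)
  qed (simp add: k_def)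
  have A0: "0 < A" using Q0 n0 by (simp add: A_def)
  have A8: "A \<le> 1/8" using Q Q0 n0 by (simp add: A_def)
  have "0 < p * L / real n" using pL n0 by (intro divide_pos_pos) linarith+
  then have \<theta>0: "0 < \<theta>" by (simp add: \<theta>_def)
  have \<theta>A: "\<theta> \<le> A"
  proof -
    have "\<theta> = sqrt (4 * (p * L / real n))" by (simp only: \<theta>_def real_sqrt_mult) simp
    also have "\<dots> \<le> sqrt (Q / real n / 64)" using L(2) n0 by (intro real_sqrt_le_mono) (simp add: field_simps)
    also have "\<dots> = sqrt (Q / real n) / sqrt 64" by (rule real_sqrt_divide)
    also have "sqrt 64 = (8 :: real)" by (rule real_sqrt_unique) simp_all
    also have "sqrt (Q / real n) / 8 = A" by (simp only: A_def)
    finally show ?thesis .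
  qed
  have \<theta>2: "\<theta> \<le> 1/2" using \<theta>A A8 by linarith
  let ?C = "spike n A \<theta>"
  have C: "?C \<in> convex_class n" using n A0 \<theta>0 by (intro spike_convex_class) auto
  interpret P: proj_profile n "proj_norm n ?C" by (rule proj_profile_metric_proj[OF n C])
  note sb = spike_bounds[OF n A0 less_imp_le[OF \<theta>0] \<theta>2]
  define E where "E = {x :: nat \<Rightarrow> real. 2 * A \<le> x 0}"
  have Em: "E \<in> sets borel" unfolding E_def by measurable
  have PE: "exp (- 9) / 4 * exp (- (3/8 * Q)) \<le> P.S.prob E"
  proof -
    have "exp (- 9) / 4 * exp (- (3/2 * real n * (4 * A)\<^sup>2)) \<le> P.S.prob {x. 4 * A / 2 \<le> ip n x ax}"
      using n A0 A8 by (intro sphere_lower_tail ax) auto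
    also have "{x. 4 * A / 2 \<le> ip n x ax} = E" using ax(3)[OF n] by (simp add: E_def)
    also have "3/2 * real n * (4 * A)\<^sup>2 = 3/8 * Q" using n0 Q0 by (simp add: A_def power_mult_distrib power_divide)
    finally show ?thesis .
  qed
  have "ereal (A / 4 * k / (672 * (A * \<theta>))) \<le> A_star n (ereal p) q (sphere_measure n)"
  proof (rule A_star_lower[OF n C p q Em])
    show "A / 4 \<le> proj_norm n ?C x" if "enorm n x = 1" "x \<in> E" for x
      using that \<theta>A by (intro sb(3)) (auto simp: E_def)
    have "0 < exp (- 9) / 4 * exp (- (3/8 * Q))" by simp
    then show "0 < P.S.prob E" using PE by linarith
    show "k powr r \<le> P.S.prob E" if r: "q = ereal r" for r
    proof -
      have r1: "1 \<le> r" "Q \<le> r" using q p Q(2) unfolding r by auto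
      have "k powr r = (exp (- 9) / 4) powr r * exp (- (3/8)) powr r" unfolding k_def by (subst powr_mult) auto
      also have "exp (- (3/8)) powr r = exp (- (3/8) * r)" by (rule exp_powr_real)
      also have "(exp (- 9) / 4) powr r * exp (- (3/8) * r) \<le> (exp (- 9) / 4) * exp (- (3/8 * Q))"
      proof (intro mult_mono)
        show "(exp (- 9) / 4) powr r \<le> exp (- 9) / (4::real)" using r1(1) by (rule exp_9_powr_le)
      qed (use r1 in auto)
      finally show ?thesis using PE by linarith
    qed
    show "P.Lp p \<le> 672 * (A * \<theta>)"
    proof (rule P.Lp_le)
      define a where "a = A * \<theta>"
      have a0: "0 < a" using A0 \<theta>0 by (simp add: a_def)
      define b where "b = 4 powr p * (sqrt (8 * p / real n) powr p * exp (- (p * L / 2)))"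
      define h where "h x = ennreal (2 powr p * a powr p) + ennreal b * ennreal (exp (real n * (max 0 (ip n x ax))\<^sup>2 / 8))" for x
      show hm: "h \<in> borel_measurable borel" unfolding h_def by measurable
      have b0: "0 \<le> b" by (simp add: b_def)
      show "ennreal (proj_norm n ?C x powr p) \<le> h x" if x: "enorm n x = 1" for x
      proof -
        define u where "u = max 0 (x 0 - \<theta>)"
        define s where "s = max 0 (x 0)"
        have u0: "0 \<le> u" by (simp add: u_def)
        have us: "u powr p \<le> sqrt (8 * p / real n) powr p * (exp (- (p * L / 2)) * exp (real n * s\<^sup>2 / 8))"
        proof (cases "u = 0")
          case False
          then have u: "u = x 0 - \<theta>" "s = x 0" "\<theta> < x 0" using \<theta>0 by (auto simp: u_def s_def max_def split: if_splits)
          \<comment> \<open>Dropping the nonnegative cross term lets the exponential moment of the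
            excess over \<theta> gain the factor exp (- n \<theta>^2/8).\<close>
          have "u\<^sup>2 + \<theta>\<^sup>2 \<le> s\<^sup>2"
          proof -
            have "0 \<le> 2 * \<theta> * u" using u0 \<theta>0 by simp
            moreover have "s\<^sup>2 = u\<^sup>2 + 2 * \<theta> * u + \<theta>\<^sup>2" unfolding u(1,2) by (simp add: power2_eq_square algebra_simps)
            ultimately show ?thesis by simp
          qed
          then have "real n * (u\<^sup>2 + \<theta>\<^sup>2) \<le> real n * s\<^sup>2" by (rule mult_left_mono) simp
          moreover have "real n * \<theta>\<^sup>2 = 4 * (p * L)" using n0 pL by (simp add: \<theta>_def power_mult_distrib)
          ultimately have "real n * u\<^sup>2 / 8 \<le> - (p * L / 2) + real n * s\<^sup>2 / 8" by (simp add: algebra_simps)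
          then have "exp (real n * u\<^sup>2 / 8) \<le> exp (- (p * L / 2)) * exp (real n * s\<^sup>2 / 8)" by (simp only: mult_exp_exp exp_le_cancel_iff)
          then have "sqrt (8 * p / real n) powr p * exp (real n * u\<^sup>2 / 8) \<le> sqrt (8 * p / real n) powr p * (exp (- (p * L / 2)) * exp (real n * s\<^sup>2 / 8))"
            by (rule mult_left_mono) simp
          with powr_le_exp_sq[OF u0 p n0] show ?thesis by (rule order_trans)
        qed (use p in simp)
        have "proj_norm n ?C x powr p \<le> (a + 2 * u) powr p"
          using sb(1)[OF x] p unfolding a_def u_def by (intro powr_mono2) auto
        also have "\<dots> \<le> 2 powr p * (a powr p + (2 * u) powr p)" using a0 u0 p by (intro powr_add_le) auto
        also have "\<dots> = 2 powr p * a powr p + 4 powr p * u powr p"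
        proof -
          have "(4 :: real) powr p = 2 powr p * 2 powr p" by (simp add: powr_mult[symmetric])
          then show ?thesis using u0 by (simp add: powr_mult algebra_simps)
        qed
        also have "\<dots> \<le> 2 powr p * a powr p + 4 powr p * (sqrt (8 * p / real n) powr p * (exp (- (p * L / 2)) * exp (real n * s\<^sup>2 / 8)))"
          by (intro add_left_mono mult_left_mono us) simp
        also have "\<dots> = 2 powr p * a powr p + b * exp (real n * (max 0 (ip n x ax))\<^sup>2 / 8)"
          using ax(3)[OF n, of x] by (simp only: b_def s_def mult.assoc)
        finally show ?thesis unfolding h_def using b0 a0 by (simp add: ennreal_mult[symmetric] ennreal_plus[symmetric] ennreal_leI del: ennreal_plus)
      qed
      have [measurable]: "(\<lambda>x. ennreal (exp (real n * (max 0 (ip n x ax))\<^sup>2 / 8))) \<in> borel_measurable borel" by measurable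
      have "integral\<^sup>N P.S h = ennreal (2 powr p * a powr p) + ennreal b * (\<integral>\<^sup>+x. ennreal (exp (real n * (max 0 (ip n x ax))\<^sup>2 / 8)) \<partial>P.S)"
        unfolding h_def by (subst nn_integral_add) (auto simp: nn_integral_cmult P.S.emeasure_space_1[simplified])
      also have "\<dots> \<le> ennreal (2 powr p * a powr p) + ennreal b * ennreal 6"
        using n by (intro add_left_mono mult_left_mono sphere_exp_moment ax) auto
      also have "\<dots> = ennreal (2 powr p * a powr p + b * 6)" using b0 by (simp add: ennreal_mult ennreal_plus)
      also have "\<dots> \<le> ennreal ((672 * (A * \<theta>)) powr p)"
      proof (rule ennreal_leI)
        \<comment> \<open>The logarithm in the rate is there for this: the p-th root of the gained
          factor is at most 8 A, which brings the spike part down to the order of A\<theta>.\<close>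
        have exp_L: "exp (- (L / 2)) \<le> sqrt (Q / real n)"
        proof -
          have "exp (- L) = Q / (exp 1 * real n)" using n0 Q0 unfolding L(1) exp_minus by (subst exp_ln) (auto simp: field_simps)
          also have "\<dots> \<le> Q / real n" using n0 Q0 by (intro divide_left_mono) auto
          finally show ?thesis by (intro real_le_rsqrt) (simp add: exp_double[symmetric])
        qed
        have "sqrt (8 * p / real n) * exp (- (L / 2)) \<le> 24 * a"
        proof -
          have "sqrt (8 * p / real n) \<le> sqrt (9 * (p * L / real n))"
            using p L1 n0 mult_left_mono[of 1 L p] by (intro real_sqrt_le_mono) (simp add: field_simps)
          also have "\<dots> = 3/2 * \<theta>" by (simp only: real_sqrt_mult \<theta>_def) simp
          finally have "sqrt (8 * p / real n) * exp (- (L / 2)) \<le> 3/2 * \<theta> * sqrt (Q / real n)" using exp_L \<theta>0 by (intro mult_mono) auto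
          also have "\<dots> = 12 * a" by (simp add: a_def A_def)
          finally show ?thesis using a0 by linarith
        qed
        then have "4 * (sqrt (8 * p / real n) * exp (- (L / 2))) \<le> 96 * a" by linarith
        moreover have "0 \<le> 4 * (sqrt (8 * p / real n) * exp (- (L / 2)))" using p n0 by simp
        ultimately have "(4 * (sqrt (8 * p / real n) * exp (- (L / 2)))) powr p \<le> (96 * a) powr p" using p by (intro powr_mono2) auto
        also have "(4 * (sqrt (8 * p / real n) * exp (- (L / 2)))) powr p = b"
          unfolding b_def using p n0 by (simp add: powr_mult exp_powr_real mult.commute)
        finally have b: "b \<le> (96 * a) powr p" .
        have "2 powr p * a powr p \<le> 96 powr p * a powr p" using p by (intro mult_right_mono powr_mono2) auto
        also have "\<dots> = (96 * a) powr p" using a0 by (simp add: powr_mult)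
        \<comment> \<open>7 = 1 + 6 with the 6 of \<open>sphere_exp_moment\<close>; then 672 = 7 *
          96.\<close>
        finally have "2 powr p * a powr p + b * 6 \<le> 7 * (96 * a) powr p" using b by linarith
        also have "\<dots> \<le> 7 powr p * (96 * a) powr p" using powr_mono[of 1 p "7::real"] p by (intro mult_right_mono) auto
        also have "\<dots> = (672 * a) powr p" using a0 by (simp add: powr_mult[symmetric])
        finally show "2 powr p * a powr p + b * 6 \<le> (672 * (A * \<theta>)) powr p" by (simp only: a_def)
      qed
      finally show "integral\<^sup>N P.S h \<le> ennreal ((672 * (A * \<theta>)) powr p)" .
    qed (use p A0 \<theta>0 in auto)
  qed (use A0 \<theta>0 k in auto)
  moreover have "A / 4 * k / (672 * (A * \<theta>)) = lower_const * sqrt (real n / (p * L))"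
  proof -
    have "sqrt (real n / (p * L)) = 2 / \<theta>" by (simp add: \<theta>_def real_sqrt_divide)
    then show ?thesis using A0 by (simp add: lower_const_def k_def field_simps)
  qed
  ultimately show ?thesis by simp
qed

text \<open>The first coordinate has no atoms in [0, 1), so its distribution function is continuous
  there and takes the value 1 - \<delta> between 0, where symmetry leaves mass 1/2 above, and 1/2,
  where at most exp (- n/16) is left. Continuity at \<theta> provides A.\<close>

lemma sphere_quantile:
  assumes n: "1 \<le> n" and \<delta>: "exp (- (real n / 16)) \<le> \<delta>" "\<delta> \<le> 1/2"
  obtains \<theta> A where "0 \<le> \<theta>" "\<theta> \<le> 1/2" "0 < A"
    "measure (sphere_measure n) {x. \<theta> < x 0} = \<delta>"
    "\<delta> / 2 \<le> measure (sphere_measure n) {x. \<theta> + A \<le> x 0}"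
proof -
  interpret S: prob_space "sphere_measure n" by (rule prob_space_sphere_measure)
  define M where "M = distr (sphere_measure n) borel (\<lambda>x. x 0)"
  interpret M: real_distribution M unfolding M_def by (rule S.real_distribution_distr) simp
  have Mm: "measure M B = S.prob {x. x 0 \<in> B}" if "B \<in> sets borel" for B
    unfolding M_def using that by (subst measure_distr) (auto simp: vimage_def)
  have cdf: "cdf M t = 1 - S.prob {x. t < x 0}" for t
  proof -
    have "cdf M t = S.prob {x. x 0 \<le> t}" unfolding cdf_def by (subst Mm) auto
    also have "{x :: nat \<Rightarrow> real. x 0 \<le> t} = space (sphere_measure n) - {x. t < x 0}" by auto
    also have "S.prob \<dots> = 1 - S.prob {x. t < x 0}" by (rule S.prob_compl) simp
    finally show ?thesis .
  qed
  have cont: "isCont (cdf M) t" if "0 \<le> t" "t < 1" for t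
    unfolding M.isCont_cdf using sphere_measure_latitude[OF n that] by (simp add: Mm)
  have 0: "cdf M 0 \<le> 1 - \<delta>"
  proof -
    have "1/2 \<le> measure (ball_measure n) {x. 0 \<le> ip n x ax}" by (rule ball_half_space) (rule ax[OF n])
    also have "\<dots> \<le> measure (ball_measure n) {x. dir n x \<in> {x. 0 \<le> x 0}}"
    proof (rule measure_ball_measure_mono)
      show "unit_ball n \<inter> {x. 0 \<le> ip n x ax} \<subseteq> {x. dir n x \<in> {x. 0 \<le> x 0}}"
        unfolding ax(3)[OF n] by (auto simp: dir_def)
    qed measurable
    also have "\<dots> = S.prob {x. 0 \<le> x 0}" by (subst measure_sphere_measure) auto
    also have "\<dots> \<le> S.prob ({x. 0 < x 0} \<union> {x. x 0 = 0})" by (intro S.finite_measure_mono) auto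
    also have "\<dots> \<le> S.prob {x. 0 < x 0} + S.prob {x. x 0 = 0}" by (rule measure_Un_le) auto
    also have "S.prob {x. x 0 = 0} = 0" using n by (intro sphere_measure_latitude) auto
    finally show ?thesis using \<delta> by (simp add: cdf)
  qed
  have 1: "1 - \<delta> \<le> cdf M (1/2)"
  proof -
    have "S.prob {x. 1/2 < x 0} \<le> S.prob {x. 1/2 \<le> ip n x ax}"
      unfolding ax(3)[OF n] by (intro S.finite_measure_mono) auto
    also have "\<dots> \<le> exp (- (real n * (1/2)\<^sup>2 / 4))" using n by (intro sphere_upper_tail ax) auto
    also have "\<dots> = exp (- (real n / 16))" by (simp add: power2_eq_square)
    finally show ?thesis using \<delta> by (simp add: cdf)
  qed
  have "\<exists>\<theta>\<ge>0. \<theta> \<le> 1/2 \<and> cdf M \<theta> = 1 - \<delta>"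
    using 0 1 by (intro IVT') (auto intro!: continuous_at_imp_continuous_on cont)
  then obtain \<theta> where \<theta>: "0 \<le> \<theta>" "\<theta> \<le> 1/2" "cdf M \<theta> = 1 - \<delta>" by auto
  have \<delta>0: "0 < \<delta>" using \<delta>(1) exp_gt_zero[of "- (real n / 16)"] by linarith
  have "isCont (cdf M) \<theta>" using \<theta> by (intro cont) auto
  then obtain d where d: "0 < d" "\<And>t. dist t \<theta> < d \<Longrightarrow> dist (cdf M t) (cdf M \<theta>) < \<delta> / 2"
    unfolding continuous_at_eps_delta using \<delta>0 by (metis half_gt_zero)
  have "dist (\<theta> + d / 2) \<theta> < d" using d(1) by (simp add: dist_real_def)
  then have "\<bar>cdf M (\<theta> + d / 2) - cdf M \<theta>\<bar> < \<delta> / 2" using d(2) by (simp only: dist_real_def)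
  then have "\<delta> / 2 \<le> S.prob {x. \<theta> + d / 2 < x 0}" using \<theta>(3) unfolding cdf by linarith
  also have "\<dots> \<le> S.prob {x. \<theta> + d / 2 \<le> x 0}" by (intro S.finite_measure_mono) auto
  finally have "\<delta> / 2 \<le> S.prob {x. \<theta> + d / 2 \<le> x 0}" .
  moreover have "S.prob {x. \<theta> < x 0} = \<delta>" using \<theta>(3) unfolding cdf by linarith
  ultimately show thesis using that[of \<theta> "d / 2"] \<theta> d(1) by simp
qed

text \<open>A cancels in the quotient of norms, so it may be as small as continuity demands. What
  remains is sqrt Y times \<delta>^(1/q), up to constants.\<close>

lemma lower_small_q:
  fixes p q L :: real
  assumes n: "1 \<le> n" and pq: "1 \<le> p" "p < q" "q < real n"
    and L: "L = ln (exp 1 * (real n / q))" "q < 256 * (p * L)" and y: "64 \<le> real n / (p * L)"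
  shows "ereal (1 / 80 * (real n / (p * L)) powr ((1 - p / q) / 2)) \<le> A_star n (ereal p) (ereal q) (sphere_measure n)"
proof -
  interpret S: prob_space "sphere_measure n" by (rule prob_space_sphere_measure)
  have n0: "0 < real n" using n by simp
  define Y where "Y = real n / (p * L)"
  have Y: "64 \<le> Y" "0 < Y" using y by (auto simp: Y_def)
  have Leq: "L = 1 + ln (real n / q)" using n0 pq unfolding L(1) by (subst ln_mult) auto
  have "0 \<le> ln (real n / q)" using pq by (intro ln_ge_zero) auto
  then have L1: "1 \<le> L" using Leq by simp
  have pL: "0 < p * L" using pq L1 by simp
  \<comment> \<open>The assumption q < 256 p L is used here: it makes Y at most 256 n/q, so that
    \<delta> is not too small and the quantile \<theta> stays below 4/sqrt Y.\<close>
  have lnY: "ln Y \<le> 8 * L"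
  proof -
    have "Y \<le> 256 * (real n / q)" using L(2) n0 pq pL by (simp add: Y_def field_simps)
    then have "ln Y \<le> ln (256 * (real n / q))" using Y by (intro ln_mono) auto
    also have "\<dots> = ln (2 ^ 8) + ln (real n / q)" using n0 pq by (subst ln_mult) auto
    also have "ln (2 ^ 8 :: real) = 8 * ln 2" by (subst ln_realpow) auto
    also have "ln 2 \<le> (1 :: real)" using ln_le_minus_one[of "2::real"] by simp
    finally show ?thesis using Leq L1 by linarith
  qed
  \<comment> \<open>Balances the two parts of the p-th moment: the mass above \<theta> contributes
    A^p \<delta> = (A/sqrt Y)^p, and A\<theta> is of order at most A/sqrt Y.\<close>
  define \<delta> where "\<delta> = Y powr (- p / 2)"
  have \<delta>0: "0 < \<delta>" using Y by (simp add: \<delta>_def)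
  have ln\<delta>: "- ln \<delta> \<le> 4 * (p * L)" 
  proof -
    have "- ln \<delta> = p / 2 * ln Y" using Y by (simp add: \<delta>_def ln_powr)
    also have "\<dots> \<le> p / 2 * (8 * L)" using lnY pq by (intro mult_left_mono) auto
    finally show ?thesis by (simp add: mult_ac)
  qed
  have "\<delta> \<le> Y powr (- 1 / 2)" unfolding \<delta>_def using pq Y by (intro powr_mono) auto
  also have "\<dots> \<le> 64 powr (- 1 / 2)" using Y by (intro powr_mono2') auto
  also have "(64 :: real) powr (- 1 / 2) = 1 / sqrt 64" 
  proof -
    have "(- 1 / 2 :: real) = - (1 / 2)" by simp
    then show ?thesis by (simp only: powr_minus_divide) (simp add: powr_half_sqrt)
  qed
  also have "sqrt 64 = (8 :: real)" by (rule real_sqrt_unique) simp_all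
  finally have \<delta>2: "\<delta> \<le> 1/2" by simp
  \<comment> \<open>With Y \<ge> 64, 4 p L is at most n/16; this keeps the quantile below
    1/2.\<close>
  have \<delta>n: "exp (- (real n / 16)) \<le> \<delta>"
  proof -
    have "64 * (p * L) \<le> real n" using y pL by (simp add: pos_le_divide_eq)
    then have "- (real n / 16) \<le> ln \<delta>" using ln\<delta> by linarith
    then have "exp (- (real n / 16)) \<le> exp (ln \<delta>)" by simp
    then show ?thesis using \<delta>0 by simp
  qed
  obtain \<theta> A where \<theta>: "0 \<le> \<theta>" "\<theta> \<le> 1/2" and A: "0 < A"
    and P\<theta>: "S.prob {x. \<theta> < x 0} = \<delta>" and PA: "\<delta> / 2 \<le> S.prob {x. \<theta> + A \<le> x 0}"
    using sphere_quantile[OF n \<delta>n \<delta>2] by metis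
  have \<theta>Y: "\<theta> \<le> 4 / sqrt Y"
  proof -
    have "\<delta> \<le> S.prob {x. \<theta> \<le> ip n x ax}"
      unfolding P\<theta>[symmetric] ax(3)[OF n] by (intro S.finite_measure_mono) auto
    also have "\<dots> \<le> exp (- (real n * \<theta>\<^sup>2 / 4))" using \<theta> n by (intro sphere_upper_tail ax) auto
    finally have "ln \<delta> \<le> ln (exp (- (real n * \<theta>\<^sup>2 / 4)))" using \<delta>0 by (subst ln_le_cancel_iff) auto
    then have "ln \<delta> \<le> - (real n * \<theta>\<^sup>2 / 4)" by simp
    then have "real n * \<theta>\<^sup>2 \<le> 16 * (p * L)" using ln\<delta> by linarith
    then have "\<theta>\<^sup>2 \<le> 16 / Y" using n0 pL by (simp add: Y_def field_simps)
    also have "\<dots> = (4 / sqrt Y)\<^sup>2" using Y by (simp add: power_divide)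
    finally show ?thesis by (rule power2_le_imp_le) (use Y in simp)
  qed
  let ?C = "spike n A \<theta>"
  have C: "?C \<in> convex_class n" using n A \<theta> by (intro spike_convex_class) auto
  interpret P: proj_profile n "proj_norm n ?C" by (rule proj_profile_metric_proj[OF n C])
  note sb = spike_bounds[OF n A \<theta>]
  define E where "E = {x :: nat \<Rightarrow> real. \<theta> + A \<le> x 0}"
  have Em: "E \<in> sets borel" unfolding E_def by measurable
  define k where "k = (\<delta> / 2) powr (1 / q)"
  have "ereal (A / 4 * k / (10 * A / sqrt Y)) \<le> A_star n (ereal p) (ereal q) (sphere_measure n)"
  proof (rule A_star_lower[OF n C pq(1) _ Em])
    show "A / 4 \<le> proj_norm n ?C x" if "enorm n x = 1" "x \<in> E" for x
      using that by (intro sb(3)) (auto simp: E_def)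
    show "0 < S.prob E" using PA \<delta>0 unfolding E_def by linarith
    show "0 \<le> k" "k \<le> 1" unfolding k_def using \<delta>0 \<delta>2 pq by (auto intro!: powr_le1)
    show "k powr r \<le> S.prob E" if "ereal q = ereal r" for r
      using that PA \<delta>0 pq by (simp add: k_def powr_powr E_def)
    show "P.Lp p \<le> 10 * A / sqrt Y"
    proof (rule P.Lp_le)
      define h where "h x = ennreal (2 powr p * (A * \<theta>) powr p) + ennreal (2 powr p * A powr p) * indicator {x. \<theta> < x 0} x" for x :: "nat \<Rightarrow> real"
      show "h \<in> borel_measurable borel" unfolding h_def by measurable
      show "ennreal (proj_norm n ?C x powr p) \<le> h x" if x: "enorm n x = 1" for x
      proof (cases "\<theta> < x 0")
        case True
        have "proj_norm n ?C x powr p \<le> A powr p" using sb(2)[OF x] pq by (intro powr_mono2) auto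
        also have "\<dots> \<le> 2 powr p * A powr p" using ge_one_powr_ge_zero[of 2 p] pq by (simp add: mult_le_cancel_right1)
        finally show ?thesis using True by (simp add: h_def add_increasing ennreal_leI)
      next
        case False
        then have "proj_norm n ?C x \<le> A * \<theta>" using sb(1)[OF x] by simp
        then have "proj_norm n ?C x powr p \<le> (A * \<theta>) powr p" using pq by (intro powr_mono2) auto
        also have "\<dots> \<le> 2 powr p * (A * \<theta>) powr p" using ge_one_powr_ge_zero[of 2 p] pq by (simp add: mult_le_cancel_right1)
        finally show ?thesis using False by (simp add: h_def ennreal_leI)
      qed
      have "integral\<^sup>N P.S h = ennreal (2 powr p * (A * \<theta>) powr p) + ennreal (2 powr p * A powr p) * ennreal \<delta>"
        unfolding h_def using S.emeasure_space_1
        by (subst nn_integral_add) (auto simp: nn_integral_cmult P\<theta>[symmetric] S.emeasure_eq_measure)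
      also have "\<dots> = ennreal (2 powr p * (A * \<theta>) powr p + 2 powr p * A powr p * \<delta>)"
        using \<delta>0 by (simp add: ennreal_mult ennreal_plus)
      also have "\<dots> \<le> ennreal ((10 * A / sqrt Y) powr p)"
      proof (rule ennreal_leI)
        have "1 / sqrt Y = Y powr (- (1 / 2))" using Y by (simp add: powr_minus_divide powr_half_sqrt)
        then have "(1 / sqrt Y) powr p = Y powr (- (1 / 2) * p)" by (simp only: powr_powr)
        then have \<delta>eq: "\<delta> = (1 / sqrt Y) powr p" by (simp add: \<delta>_def)
        have "(A * \<theta>) powr p \<le> (A * (4 / sqrt Y)) powr p" using A \<theta> \<theta>Y pq by (intro powr_mono2 mult_left_mono) auto
        also have "\<dots> = 4 powr p * (A powr p * (1 / sqrt Y) powr p)"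
          using A Y by (simp add: powr_mult[symmetric] mult.commute)
        finally have "2 powr p * (A * \<theta>) powr p + 2 powr p * A powr p * \<delta>
            \<le> 2 powr p * (4 powr p * (A powr p * (1 / sqrt Y) powr p)) + 2 powr p * A powr p * (1 / sqrt Y) powr p"
          unfolding \<delta>eq by (intro add_mono mult_left_mono) auto
        also have "\<dots> = 2 powr p * ((4 powr p + 1) * (A powr p * (1 / sqrt Y) powr p))" by (simp add: algebra_simps)
        also have "\<dots> \<le> 2 powr p * (5 powr p * (A powr p * (1 / sqrt Y) powr p))"
        proof (intro mult_left_mono mult_right_mono)
          have "(4 :: real) powr p = 4 powr (p - 1) * 4" by (simp add: powr_diff)
          moreover have "(5 :: real) powr p = 5 powr (p - 1) * 5" by (simp add: powr_diff)
          moreover have "(4 :: real) powr (p - 1) \<le> 5 powr (p - 1)" using pq by (intro powr_mono2) auto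
          moreover have "1 \<le> (5 :: real) powr (p - 1)" using pq by (intro ge_one_powr_ge_zero) auto
          ultimately show "(4 :: real) powr p + 1 \<le> 5 powr p" by linarith
        qed auto
        also have "\<dots> = (10 * A / sqrt Y) powr p" using A Y by (simp add: powr_mult[symmetric])
        finally show "2 powr p * (A * \<theta>) powr p + 2 powr p * A powr p * \<delta> \<le> (10 * A / sqrt Y) powr p" .
      qed
      finally show "integral\<^sup>N P.S h \<le> ennreal ((10 * A / sqrt Y) powr p)" .
    qed (use pq A Y in auto)
  qed (use pq A Y in auto)
  \<comment> \<open>80 = 4 * 10 * 2, the last factor from \<delta>^(1/q) \<le> 2 k.\<close>
  moreover have "1 / 80 * Y powr ((1 - p / q) / 2) \<le> A / 4 * k / (10 * A / sqrt Y)"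
  proof -
    have sY: "sqrt Y = Y powr (1 / 2)" using Y by (simp add: powr_half_sqrt)
    have "(1 - p / q) / 2 = 1 / 2 + - p / 2 * (1 / q)" using pq by (simp add: field_simps)
    then have "Y powr ((1 - p / q) / 2) = sqrt Y * Y powr (- p / 2 * (1 / q))"
      unfolding sY by (simp only: powr_add)
    also have "Y powr (- p / 2 * (1 / q)) = \<delta> powr (1 / q)" unfolding \<delta>_def by (simp only: powr_powr)
    also have "\<delta> powr (1 / q) \<le> 2 * k"
    proof -
      have "(1/2 :: real) powr 1 \<le> (1/2) powr (1 / q)" using pq by (intro powr_mono') auto
      then have "\<delta> powr (1 / q) * (1/2) \<le> \<delta> powr (1 / q) * (1/2) powr (1 / q)" by (intro mult_left_mono) auto
      also have "\<dots> = k" unfolding k_def using \<delta>0 by (subst powr_mult[symmetric]) auto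
      finally show ?thesis by simp
    qed
    finally have "Y powr ((1 - p / q) / 2) \<le> sqrt Y * (2 * k)" using Y by simp
    then show ?thesis using A Y by (simp add: field_simps)
  qed
  ultimately show ?thesis unfolding Y_def by (meson ereal_less_eq(3) order_trans)
qed

text \<open>The spikes are used where their assumptions hold; everywhere else the base of the rate
  is at most 256, hence the rate at most 16 = sqrt 256, and \<open>A_star_ge_1\<close>
  suffices.\<close>

lemma A_star_lower_rate:
  assumes n: "1 \<le> n" and pq: "1 \<le> p" "p < q"
  shows "ereal (lower_const * rate n p q) \<le> A_star n p q (sphere_measure n)"
proof -
  obtain r where r: "p = ereal r" "1 \<le> r" using pq by (cases p) auto
  have n0: "0 < real n" using n by simp
  have rq: "ereal r < q" using pq r by simp
  have triv: "ereal (lower_const * rate n p q) \<le> A_star n p q (sphere_measure n)" if "rate n p q \<le> 16"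
  proof -
    have "0 \<le> rate n p q" by (simp add: rate_def)
    then have "lower_const * rate n p q \<le> 1 / 80 * 16" using lower_const that by (intro mult_mono) auto
    then have "ereal (lower_const * rate n p q) \<le> 1" by (simp add: one_ereal_def)
    also have "\<dots> \<le> A_star n p q (sphere_measure n)" unfolding r(1) by (rule A_star_ge_1[OF n r(2) rq])
    finally show ?thesis .
  qed
  have tau: "0 \<le> tau p q" "tau p q \<le> 1/2"
    using pq r by (cases q; auto simp: tau_def field_simps)+
  define Q where "Q = trunc q n"
  have Q: "Q \<le> real n" "ereal Q \<le> q" "real n \<le> q \<Longrightarrow> Q = real n" "q < real n \<Longrightarrow> q = ereal Q"
    using pq r by (cases q; auto simp: Q_def trunc_def min_def)+
  have pt: "trunc p n = min r (real n)" by (simp add: r(1) trunc_def min_def)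
  define L where "L = ln (exp 1 * (real n / Q))"
  have Qr: "min r (real n) \<le> Q" using rq r by (cases q) (auto simp: Q_def trunc_def min_def)
  have Q0: "0 < Q" using Qr r n0 by linarith
  have L1: "1 \<le> L"
  proof -
    have "L = 1 + ln (real n / Q)" using n0 Q0 unfolding L_def by (subst ln_mult) auto
    moreover have "0 \<le> ln (real n / Q)" using Q Q0 by (intro ln_ge_zero) auto
    ultimately show ?thesis by simp
  qed
  have rate: "rate n p q = (real n / (min r (real n) * L)) powr tau p q"
    by (simp add: rate_def pt Q_def L_def)
  have bounded: "rate n p q \<le> 16" if "real n / (min r (real n) * L) \<le> 256"
  proof -
    have "rate n p q \<le> 256 powr tau p q" unfolding rate using that tau r L1 n0 by (intro powr_mono2) auto
    also have "\<dots> \<le> 256 powr (1/2)" using tau by (intro powr_mono) auto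
    also have "\<dots> = sqrt 256" by (simp add: powr_half_sqrt)
    also have "\<dots> = 16" by (rule real_sqrt_unique) simp_all
    finally show ?thesis .
  qed
  show ?thesis
  proof (cases "real n \<le> r")
    case True
    have "real n / (real n * L) \<le> 1" using L1 n0 by (simp add: divide_le_eq_1)
    then show ?thesis using True by (intro triv bounded) (simp add: min_absorb2)
  next
    case False
    then have mr: "min r (real n) = r" by simp
    have rL: "0 < r * L" using r L1 by simp
    show ?thesis
    proof (cases "256 * (r * L) \<le> Q")
      case True
      have "ereal (lower_const * sqrt (real n / (r * L))) \<le> A_star n p q (sphere_measure n)"
        unfolding r(1) by (rule lower_large_q[OF n r(2) rq Q(1,2) L_def True L1])
      moreover have "rate n p q \<le> sqrt (real n / (r * L))"
      proof -
        have "1 \<le> real n / (r * L)" using True Q(1) rL by (simp add: pos_le_divide_eq)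
        then have "rate n p q \<le> (real n / (r * L)) powr (1/2)" unfolding rate mr using tau by (intro powr_mono) auto
        then show ?thesis using rL n0 by (simp add: powr_half_sqrt)
      qed
      then have "lower_const * rate n p q \<le> lower_const * sqrt (real n / (r * L))" using lower_const by (intro mult_left_mono) auto
      ultimately show ?thesis by (meson ereal_less_eq(3) order_trans)
    next
      case small: False
      show ?thesis
      proof (cases "real n \<le> q \<or> real n / (r * L) \<le> 64")
        case True
        \<comment> \<open>For q \<ge> n one has Q = n, and the failure of the large-q condition is
          precisely this bound.\<close>
        have "real n / (r * L) \<le> 256"
        proof (cases "real n \<le> q")
          case True
          then show ?thesis using small rL Q(3) by (simp add: pos_divide_le_eq)
        qed (use \<open>real n \<le> q \<or> _\<close> in auto)
        then show ?thesis by (intro triv bounded) (simp add: mr)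
      next
        case False
        then have q: "q = ereal Q" "Q < real n" using Q(4) by (auto simp: not_le)
        have "ereal (1 / 80 * (real n / (r * L)) powr ((1 - r / Q) / 2)) \<le> A_star n p q (sphere_measure n)"
          unfolding r(1) q(1) by (rule lower_small_q[OF n r(2) _ q(2) L_def]) (use rq q small False in auto)
        moreover have "rate n p q = (real n / (r * L)) powr ((1 - r / Q) / 2)"
          unfolding rate mr using Q0 by (simp add: tau_def r(1) q(1))
        moreover have "lower_const * rate n p q \<le> 1 / 80 * rate n p q" by (rule mult_right_mono[OF lower_const(2)]) (simp add: rate_def)
        ultimately show ?thesis by (metis ereal_less_eq(3) order_trans)
      qed
    qed
  qed
qed

theorem theorem1p1:
  shows "\<exists>c c' :: real. 0 < c \<and> c \<le> c' \<and>
    (\<forall>(n :: nat) (p :: ereal) (q :: ereal). 1 \<le> n \<longrightarrow> 1 \<le> p \<longrightarrow> p < q \<longrightarrow>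
       ereal (c * rate n p q) \<le> A_star n p q (sphere_measure n) \<and>
       A_star n p q (sphere_measure n) \<le> ereal (c' * rate n p q))"
proof (intro exI conjI allI impI)
  show "0 < lower_const" by (rule lower_const)
  show "lower_const \<le> 200 * sup_const" using lower_const sup_const_ge by linarith
qed (blast intro: A_star_lower_rate A_star_upper)+

end
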